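(* There exist absolute constants $C_0, C>0$ such that the following holds. Let $n\ge 1$ be an integer, $\alpha\in(0,1/2)$, $\beta\in(0,1)$, and let $r$ be an integer with $r\ge C_0\log(n/\beta)$. Then there is a positive integer $k\le C\,\alpha^{-2}\sqrt{r}\,\log^{3/2}(n/\beta)$ such that the following holds. Let $\rho_1,\dots,\rho_n\sim U[0,1]$ be i.i.d., and let an adaptive adversary issue query sets $V_1,\dots,V_t\subset[n]$, each answered by applying the estimator $\mathtt{RobustEst}$ (with parameters $k,r,n,\alpha,\beta$) to the bottom-$k$ sketch $\mathtt{BkSketch}_{\boldsymbol\rho}(V_j)$. Suppose that the query sequence always satisfies $$\forall i\in[n]:\quad \sum_{j\in[t]} \mathbf 1\{\,i \text{ appears in } \mathtt{BkSketch}_{\boldsymbol\rho}(V_j)\,\}\le r .$$ Then with probability at least $1-\beta$ (over $\boldsymbol\rho$, the noise of the estimator, and the adversary's randomness), every output is $(1\pm\alpha)$-accurate, i.e. for every $j\in[t]$ the answer to $V_j$ lies in $[(1-\alpha)|V_j|,(1+\alpha)|V_j|]$.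
   Context: Notation: $[n]=\{1,\dots,n\}$; $\mathrm{Lap}(b)$ is the Laplace distribution with mean $0$ and scale $b$; $\log$ is the natural logarithm. Bottom-$k$ sketch: for $\boldsymbol\rho=(\rho_1,\dots,\rho_n)\in[0,1]^n$ and $V\subset[n]$, $\mathtt{BkSketch}_{\boldsymbol\rho}(V)$ is the set of pairs $(i,\rho_i)$ for the $k$ keys $i\in V$ with the smallest values $\rho_i$; if $|V|\le k$ it is $\{(i,\rho_i): i\in V\}$. (Ties have probability zero.) The same $\boldsymbol\rho$ is used for all queries. Adaptive adversary: the $j$-th set $V_j$ may depend on the answers to the previous queries and on the adversary's own randomness; the adversary has no other access to $\boldsymbol\rho$ or to the estimator's noise. Estimator $\mathtt{RobustEst}$ on input a bottom-$k$ sketch $S$: put $\varepsilon_0=\dfrac{\alpha/8}{4\sqrt{r\log(4n/\beta)}}$. If $|S|<k$, return $|S|$. Otherwise set $\tau\leftarrow k/(2n)$ and $T=(1-\alpha)k$, and, as long as $\tau<1$ and $\tilde h<T$, where $\tilde h=\sum_{(i,\rho_i)\in S}\mathbf 1\{\rho_i<\tau\}+\mathrm{Lap}(1/\varepsilon_0)$ is recomputed with fresh independent Laplace noise at every test, replace $\tau\leftarrow(1+\alpha/4)\tau$. When the loop stops, return $T/\tau$.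
   Formalization: The case n = 1 with β > 1/2 is excluded by assuming 2β ≤ n, since for n = 1 and β near 1 the bound on k drops below 1 and no positive integer k exists; the adversary's randomness is modelled as a real-valued seed with arbitrary distribution. *)

theory Defs
  imports "HOL-Probability.Probability" "HOL-Library.While_Combinator"
begin

text \<open>A key belongs to the sketch iff fewer than \<open>k\<close> keys of the query set precede it in the order
  of the values \<open>\<rho> i\<close>. Ties, which have probability zero, are broken by the key, so
  that the sketch always has \<open>min k (card V)\<close> elements (see \<open>card_bk_sketch\<close>).\<close>

definition bk_sketch :: "nat \<Rightarrow> (nat \<Rightarrow> real) \<Rightarrow> nat set \<Rightarrow> (nat \<times> real) set" where
  "bk_sketch k \<rho> V =
     {(i, \<rho> i) | i. i \<in> V \<and> card {j \<in> V. \<rho> j < \<rho> i \<or> (\<rho> j = \<rho> i \<and> j < i)} < k}"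

definition laplace :: "real \<Rightarrow> real measure" where
  "laplace b = density lborel (\<lambda>x. ennreal (exp (- \<bar>x\<bar> / b) / (2 * b)))"

definition eps0 :: "nat \<Rightarrow> nat \<Rightarrow> real \<Rightarrow> real \<Rightarrow> real" where
  "eps0 n r \<alpha> \<beta> = (\<alpha> / 8) / (4 * sqrt (real r * ln (4 * real n / \<beta>)))"

text \<open>The estimator applied to a sketch \<open>S\<close>. The argument \<open>Z\<close> is the stream of noise values for
  this call, drawn from \<open>laplace (1 / eps0 n r \<alpha> \<beta>)\<close> in \<open>robust_game\<close> below; the loop state
  is the number \<open>m\<close> of tests already performed together with the threshold \<open>\<tau>\<close>, and the test
  number \<open>m\<close> uses the noise \<open>Z m\<close>. The loop terminates because \<open>\<tau>\<close> grows by the factor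
  \<open>1 + \<alpha> / 4 > 1\<close>.\<close>

definition robust_est ::
  "nat \<Rightarrow> nat \<Rightarrow> real \<Rightarrow> (nat \<Rightarrow> real) \<Rightarrow> (nat \<times> real) set \<Rightarrow> real" where
  "robust_est k n \<alpha> Z S =
     (if card S < k then real (card S)
      else
        (let T = (1 - \<alpha>) * real k;
             (m, \<tau>) =
               while (\<lambda>(m, \<tau>). \<tau> < 1 \<and> (\<Sum>(i, x)\<in>S. of_bool (x < \<tau>)) + Z m < T)
                     (\<lambda>(m, \<tau>). (Suc m, (1 + \<alpha> / 4) * \<tau>))
                     (0, real k / (2 * real n))
         in T / \<tau>))"

text \<open>An adaptive adversary draws a private seed \<open>w\<close> from a probability space \<open>W\<close> and then
  issues \<open>A w as\<close> as its next query set after having received the list \<open>as\<close> of answers. Only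
  countably many answer lists can occur, and there are finitely many query sets, so a real-valued
  seed with an arbitrary distribution covers every source of randomness. Measurability is needed
  only separately for each \<open>as\<close>, for the same reason.\<close>

definition adaptive_adversary :: "nat \<Rightarrow> real measure \<Rightarrow> (real \<Rightarrow> real list \<Rightarrow> nat set) \<Rightarrow> bool" where
  "adaptive_adversary n W A \<longleftrightarrow>
     prob_space W \<and> (\<forall>as. (\<lambda>w. A w as) \<in> W \<rightarrow>\<^sub>M count_space (Pow {1..n}))"

text \<open>The sample space: a triple \<open>(\<rho>, Z, w)\<close> of independent components, where \<open>Z (j, m)\<close> is
  the noise of test \<open>m\<close> in query \<open>j\<close>.\<close>

definition robust_game ::
  "nat \<Rightarrow> nat \<Rightarrow> real \<Rightarrow> real \<Rightarrow> real measure \<Rightarrow> ((nat \<Rightarrow> real) \<times> (nat \<times> nat \<Rightarrow> real) \<times> real) measure" where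
  "robust_game n r \<alpha> \<beta> W =
     (\<Pi>\<^sub>M i\<in>{1..n}. uniform_measure lborel {0..1}) \<Otimes>\<^sub>M
     ((\<Pi>\<^sub>M jm\<in>UNIV. laplace (1 / eps0 n r \<alpha> \<beta>)) \<Otimes>\<^sub>M W)"

text \<open>The answers to the first \<open>j\<close> queries, in order. Queries are numbered from 0. The same
  \<open>\<rho>\<close> is used throughout.\<close>

primrec answers ::
  "nat \<Rightarrow> nat \<Rightarrow> real \<Rightarrow> (real \<Rightarrow> real list \<Rightarrow> nat set) \<Rightarrow>
   (nat \<Rightarrow> real) \<times> (nat \<times> nat \<Rightarrow> real) \<times> real \<Rightarrow> nat \<Rightarrow> real list" where
  "answers k n \<alpha> A \<omega> 0 = []"
| "answers k n \<alpha> A \<omega> (Suc j) =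
     (case \<omega> of (\<rho>, Z, w) \<Rightarrow>
        answers k n \<alpha> A \<omega> j @
          [robust_est k n \<alpha> (\<lambda>m. Z (j, m)) (bk_sketch k \<rho> (A w (answers k n \<alpha> A \<omega> j)))])"

definition query ::
  "nat \<Rightarrow> nat \<Rightarrow> real \<Rightarrow> (real \<Rightarrow> real list \<Rightarrow> nat set) \<Rightarrow>
   (nat \<Rightarrow> real) \<times> (nat \<times> nat \<Rightarrow> real) \<times> real \<Rightarrow> nat \<Rightarrow> nat set" where
  "query k n \<alpha> A \<omega> j = (case \<omega> of (\<rho>, Z, w) \<Rightarrow> A w (answers k n \<alpha> A \<omega> j))"

definition sketch ::
  "nat \<Rightarrow> nat \<Rightarrow> real \<Rightarrow> (real \<Rightarrow> real list \<Rightarrow> nat set) \<Rightarrow>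
   (nat \<Rightarrow> real) \<times> (nat \<times> nat \<Rightarrow> real) \<times> real \<Rightarrow> nat \<Rightarrow> (nat \<times> real) set" where
  "sketch k n \<alpha> A \<omega> j = bk_sketch k (fst \<omega>) (query k n \<alpha> A \<omega> j)"

definition answer ::
  "nat \<Rightarrow> nat \<Rightarrow> real \<Rightarrow> (real \<Rightarrow> real list \<Rightarrow> nat set) \<Rightarrow>
   (nat \<Rightarrow> real) \<times> (nat \<times> nat \<Rightarrow> real) \<times> real \<Rightarrow> nat \<Rightarrow> real" where
  "answer k n \<alpha> A \<omega> j =
     (case \<omega> of (\<rho>, Z, w) \<Rightarrow> robust_est k n \<alpha> (\<lambda>m. Z (j, m)) (sketch k n \<alpha> A \<omega> j))"

lemma answers_eq_map: "answers k n \<alpha> A \<omega> j = map (answer k n \<alpha> A \<omega>) [0..<j]"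
  by (induction j) (auto simp: answer_def sketch_def query_def split: prod.splits)

lemma card_less_rank:
  fixes R :: "'a \<Rightarrow> 'a \<Rightarrow> bool"
  assumes "finite V"
    and irr: "\<And>x. \<not> R x x" and tr: "\<And>x y z. R x y \<Longrightarrow> R y z \<Longrightarrow> R x z"
    and tot: "\<And>x y. x \<noteq> y \<Longrightarrow> R x y \<or> R y x"
  shows "card {i \<in> V. card {j \<in> V. R j i} < k} = min k (card V)"
proof -
  define rk where "rk i = card {j \<in> V. R j i}" for i
  have mono: "rk x < rk y" if "x \<in> V" "R x y" for x y
    unfolding rk_def
  proof (rule psubset_card_mono)
    show "{j \<in> V. R j x} \<subset> {j \<in> V. R j y}"
      using that irr tr by blast
  qed (use assms in auto)
  have inj: "inj_on rk V"
    by (rule inj_onI) (metis mono tot less_irrefl)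
  have sub: "rk ` V \<subseteq> {..<card V}"
    unfolding rk_def using assms(1) irr by (auto intro!: psubset_card_mono)
  have img: "rk ` V = {..<card V}"
    by (rule card_subset_eq) (use sub inj in \<open>auto simp: card_image\<close>)
  have "card {i \<in> V. rk i < k} = card (rk ` {i \<in> V. rk i < k})"
    using inj by (intro card_image [symmetric]) (auto simp: inj_on_def)
  also have "rk ` {i \<in> V. rk i < k} = rk ` V \<inter> {..<k}"
    by auto
  also have "\<dots> = {..<min k (card V)}"
    using img by auto
  finally show ?thesis
    by (simp add: rk_def)
qed

lemma card_bk_sketch:
  assumes "finite V"
  shows "card (bk_sketch k \<rho> V) = min k (card V)"
proof -
  have "bk_sketch k \<rho> V =
      (\<lambda>i. (i, \<rho> i)) ` {i \<in> V. card {j \<in> V. \<rho> j < \<rho> i \<or> (\<rho> j = \<rho> i \<and> j < i)} < k}"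
    by (auto simp: bk_sketch_def)
  moreover have "card {i \<in> V. card {j \<in> V. \<rho> j < \<rho> i \<or> (\<rho> j = \<rho> i \<and> j < i)} < k} =
      min k (card V)"
    by (rule card_less_rank [OF assms]) auto
  ultimately show ?thesis
    by (simp add: card_image inj_on_def)
qed

text \<open>For \<open>n = 1\<close> and \<open>\<beta>\<close> close to 1 the bound on \<open>k\<close> may be smaller than 1, whatever the
  constants are. This is why the theorem assumes \<open>2 * \<beta> \<le> n\<close>, which for \<open>\<beta> < 1\<close> excludes
  only \<open>n = 1\<close> with \<open>\<beta> > 1 / 2\<close>.\<close>

lemma no_positive_sketch_size:
  fixes C0 C :: real
  shows "\<exists>\<alpha>\<in>{0<..<1 / 2}. \<exists>\<beta>\<in>{0<..<1}. \<exists>r::nat. C0 * ln (real 1 / \<beta>) \<le> real r \<and>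
           \<not> (\<exists>k\<ge>1::nat. real k \<le> C * \<alpha> powr - 2 * sqrt (real r) * ln (real 1 / \<beta>) powr (3 / 2))"
proof -
  define d where "d = 1 / (1 + \<bar>C0\<bar> + 16 * \<bar>C\<bar>)"
  have d: "0 < d" "d \<le> 1" "C0 * d \<le> 1" "16 * C * d < 1"
    by (auto simp: d_def divide_simps abs_if)
  have "d powr (3 / 2) \<le> d powr 1"
    using d by (intro powr_mono') auto
  then have "d powr (3 / 2) \<le> d"
    using d by simp
  then have "16 * C * d powr (3 / 2) < 1"
  proof (cases "C \<ge> 0")
    case True
    then have "16 * C * d powr (3 / 2) \<le> 16 * C * d"
      using \<open>d powr (3 / 2) \<le> d\<close> by (intro mult_left_mono) auto
    then show ?thesis using d by linarith
  next
    case False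
    then have "16 * C * d powr (3 / 2) \<le> 0"
      using False mult_nonpos_nonneg [of "16 * C" "d powr (3 / 2)"] by simp
    then show ?thesis by linarith
  qed
  moreover have "(1 / 4 :: real) powr - 2 = 16"
    by (simp add: powr_minus powr_numeral power2_eq_square)
  ultimately have "\<not> (\<exists>k\<ge>1::nat. real k \<le>
      C * (1 / 4) powr - 2 * sqrt (real 1) * ln (real 1 / exp (- d)) powr (3 / 2))"
    by (auto simp: ln_div mult.commute)
  moreover have "C0 * ln (real 1 / exp (- d)) \<le> real 1"
    using d by (simp add: ln_div)
  ultimately show ?thesis
    using d by (intro bexI [of _ "1 / 4"] bexI [of _ "exp (- d)"] exI [of _ 1]) auto
qed

end

theory Submission
  imports Defs "HOL-Real_Asymp.Real_Asymp"
begin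

text \<open>Fix the adversary's seed and integrate out the Laplace noise: for fixed keys \<open>\<rho>\<close> the transcript
  has an explicit discrete law, a product over queries of stopping laws of noisy threshold tests.
  A query influences the law as a function of a single key only if that key is in the sketch, which happens at
  most \<open>2 r\<close> times along a transcript when one value of the key is replaced by another. Composing
  Renyi divergences over these queries shows that the transcript is \<open>(\<alpha> / 2, \<delta>)\<close>-private in each key,
  with \<open>\<delta>\<close> a large power of \<open>\<beta> / n\<close>; the number of tests per query does not matter, because
  a test costs an amount proportional to its probability of ending the query.

  Privacy is turned into concentration as in a birth-death chain. Moving one key of a query set
  across a threshold \<open>\<tau>\<close> changes the number of keys below \<open>\<tau>\<close> by one and barely changes the law of
  the transcript, so the expected numbers of queries with \<open>c\<close> and \<open>c - 1\<close> keys below \<open>\<tau>\<close> satisfy an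
  approximate detailed balance equation. Away from the mean their ratio is at most
  \<open>exp (- \<alpha> / 10)\<close>, which gives exponential tails over \<open>\<alpha> k / 50\<close> steps.\<close>

section \<open>Likelihood ratios of adaptive transcripts\<close>

text \<open>The number \<open>t\<close> of queries is unbounded, so a union bound over queries would
  be useless. What is bounded is the number of queries with at least \<open>k\<close> keys: each
  puts \<open>k\<close> keys into its sketch and every key is used at most \<open>r\<close> times,
  so there are at most n r / k of them. Failures are therefore counted in expectation per such
  query, and unions run only over the size \<open>m\<close> of a query set and the index
  \<open>l\<close> of a threshold. Fixing both also makes the coefficients of the balance equation
  constants.

  Moments of integer order \<open>q\<close> suit the adaptive choice of the queries that touch a
  key: after division by exp \<kappa> for each such query so far, the moment is a supermartingale
  whatever the choice. The order is about 25 L / \<alpha> with L = ln (4 n / \<beta>). Then the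
  moment costs at most exp (6 L), truncating the likelihood ratio gains exp (- 12 L), and every
  error rate is at most exp (- 5 L) = (\<beta> / (4 n))^5, which beats the polynomial of degree 5 in
  n coming from the unions and from n r / k.\<close>

definition path_prob :: "('o list \<Rightarrow> 'o \<Rightarrow> real) \<Rightarrow> 'o list \<Rightarrow> real" where
  "path_prob K os = (\<Prod>j<length os. K (take j os) (os ! j))"

definition paths :: "nat \<Rightarrow> nat \<Rightarrow> nat list set" where
  "paths M t = {os. set os \<subseteq> {..M} \<and> length os = t}"

lemma path_prob_Nil [simp]: "path_prob K [] = 1"
  by (simp add: path_prob_def)

lemma path_prob_snoc [simp]: "path_prob K (os @ [o']) = path_prob K os * K os o'"
  by (simp add: path_prob_def nth_append)

lemma finite_paths [simp]: "finite (paths M t)"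
  unfolding paths_def by (rule finite_lists_length_eq) simp

lemma paths_0 [simp]: "paths M 0 = {[]}"
  by (auto simp: paths_def)

lemma length_paths: "os \<in> paths M t \<Longrightarrow> length os = t"
  by (simp add: paths_def)

lemma sum_paths_Suc:
  fixes F :: "nat list \<Rightarrow> real"
  shows "(\<Sum>os\<in>paths M (Suc t). F os) = (\<Sum>os\<in>paths M t. \<Sum>x\<le>M. F (os @ [x]))"
proof -
  have "(\<Sum>os\<in>paths M t. \<Sum>x\<le>M. F (os @ [x])) = (\<Sum>(os, x)\<in>paths M t \<times> {..M}. F (os @ [x]))"
    by (rule sum.cartesian_product)
  also have "\<dots> = (\<Sum>os\<in>paths M (Suc t). F os)"
  proof (rule sum.reindex_bij_witness [where i = "\<lambda>os. (butlast os, last os)"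
        and j = "\<lambda>(os, x). os @ [x]"])
    fix os assume os: "os \<in> paths M (Suc t)"
    then have ne: "os \<noteq> []" by (auto simp: paths_def)
    show "(case (butlast os, last os) of (os, x) \<Rightarrow> os @ [x]) = os"
      using ne by simp
    show "(butlast os, last os) \<in> paths M t \<times> {..M}"
      using os ne by (auto simp: paths_def dest: in_set_butlastD last_in_set)
  qed (auto simp: paths_def)
  finally show ?thesis ..
qed

locale kernel =
  fixes M :: nat and K :: "nat list \<Rightarrow> nat \<Rightarrow> real"
  assumes kernel_nonneg: "\<And>os x. 0 \<le> K os x"
    and kernel_sum: "\<And>os. (\<Sum>x\<le>M. K os x) = 1"
begin

lemma path_prob_nonneg: "0 \<le> path_prob K os"
  by (simp add: path_prob_def prod_nonneg kernel_nonneg)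

lemma sum_path_prob: "(\<Sum>os\<in>paths M t. path_prob K os) = 1"
  by (induction t) (simp_all add: sum_paths_Suc sum_distrib_left [symmetric] kernel_sum)

text \<open>Tower rule: the last outcome is summed out first, so a bound on each conditional mean of
  \<open>u\<close> passes to the expected total. The bound is again a sum along the path, which lets
  errors be charged to full queries only, whatever \<open>t\<close> is.\<close>

lemma path_expectation_step_bound:
  assumes "\<And>os. (\<Sum>x\<le>M. K os x * u os x) \<le> v os"
  shows "(\<Sum>os\<in>paths M t. path_prob K os * (\<Sum>j<t. u (take j os) (os ! j))) \<le>
         (\<Sum>os\<in>paths M t. path_prob K os * (\<Sum>j<t. v (take j os)))"
proof (induction t)
  case (Suc t)
  have eq1: "(\<Sum>x\<le>M. path_prob K (os @ [x]) *
          (\<Sum>j<Suc t. u (take j (os @ [x])) ((os @ [x]) ! j))) =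
        path_prob K os * (\<Sum>j<t. u (take j os) (os ! j)) +
        path_prob K os * (\<Sum>x\<le>M. K os x * u os x)" if "os \<in> paths M t" for os
  proof -
    have "(\<Sum>j<Suc t. u (take j (os @ [x])) ((os @ [x]) ! j)) =
        (\<Sum>j<t. u (take j os) (os ! j)) + u os x" for x
      using length_paths [OF that] by (simp add: nth_append)
    then have "(\<Sum>x\<le>M. path_prob K (os @ [x]) *
          (\<Sum>j<Suc t. u (take j (os @ [x])) ((os @ [x]) ! j))) =
        (\<Sum>x\<le>M. path_prob K os * (\<Sum>j<t. u (take j os) (os ! j)) * K os x
           + path_prob K os * (K os x * u os x))"
      by (intro sum.cong) (simp_all add: algebra_simps)
    also have "\<dots> = path_prob K os * (\<Sum>j<t. u (take j os) (os ! j)) * (\<Sum>x\<le>M. K os x) +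
        path_prob K os * (\<Sum>x\<le>M. K os x * u os x)"
      by (simp only: sum.distrib sum_distrib_left)
    finally show ?thesis by (simp add: kernel_sum)
  qed
  have eq2: "(\<Sum>x\<le>M. path_prob K (os @ [x]) * (\<Sum>j<Suc t. v (take j (os @ [x])))) =
        path_prob K os * (\<Sum>j<t. v (take j os)) + path_prob K os * v os"
    if "os \<in> paths M t" for os
  proof -
    have ev: "(\<Sum>j<Suc t. v (take j (os @ [x]))) = (\<Sum>j<t. v (take j os)) + v os" for x
      using length_paths [OF that] by simp
    have "(\<Sum>x\<le>M. path_prob K (os @ [x]) * (\<Sum>j<Suc t. v (take j (os @ [x])))) =
        path_prob K os * ((\<Sum>j<t. v (take j os)) + v os) * (\<Sum>x\<le>M. K os x)"
      unfolding sum_distrib_left [where A = "{..M}"] by (intro sum.cong refl) (simp only: ev path_prob_snoc mult_ac)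
    then show ?thesis by (simp add: kernel_sum algebra_simps)
  qed
  have "(\<Sum>os\<in>paths M t. path_prob K os * (\<Sum>x\<le>M. K os x * u os x)) \<le>
        (\<Sum>os\<in>paths M t. path_prob K os * v os)"
    by (intro sum_mono mult_left_mono assms path_prob_nonneg)
  with Suc.IH show ?case
    by (simp only: sum_paths_Suc eq1 eq2 sum.distrib cong: sum.cong)
qed simp

end

text \<open>\<open>K'\<close> is the reference law and \<open>act\<close> marks the histories after
  which the next outcome may tell the two laws apart. Only these cost a factor exp \<kappa> in the
  moment of order \<open>q\<close>; \<open>abs_cont\<close> makes the convention x / 0 = 0
  harmless.\<close>

locale kernel_pair = K: kernel M K + K': kernel M K' for M K K' +
  fixes q :: nat and act :: "nat list \<Rightarrow> bool" and \<kappa> :: real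
  assumes abs_cont: "\<And>os x. K' os x = 0 \<Longrightarrow> K os x = 0"
    and renyi_step: "\<And>os. (\<Sum>x\<le>M. K' os x * (K os x / K' os x) ^ q) \<le> exp (\<kappa> * of_bool (act os))"
    and q_pos: "q > 0"
begin

lemma path_abs_cont: "path_prob K' os = 0 \<Longrightarrow> path_prob K os = 0"
  unfolding path_prob_def using abs_cont by auto

text \<open>Discounting by exp \<kappa> for every active step turns the moment into a
  supermartingale under \<open>K'\<close>, so it stays below its initial value 1 although the active
  steps are chosen adaptively.\<close>

lemma renyi_composition:
  "(\<Sum>os\<in>paths M t. path_prob K' os * (path_prob K os / path_prob K' os) ^ q *
     exp (- (\<kappa> * (\<Sum>j<t. of_bool (act (take j os)))))) \<le> 1"
proof (induction t)
  case (Suc t)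
  have "(\<Sum>os\<in>paths M (Suc t). path_prob K' os * (path_prob K os / path_prob K' os) ^ q *
     exp (- (\<kappa> * (\<Sum>j<Suc t. of_bool (act (take j os)))))) =
     (\<Sum>os\<in>paths M t. path_prob K' os * (path_prob K os / path_prob K' os) ^ q *
       exp (- (\<kappa> * (\<Sum>j<t. of_bool (act (take j os))))) *
       (exp (- (\<kappa> * of_bool (act os))) * (\<Sum>x\<le>M. K' os x * (K os x / K' os x) ^ q)))"
    unfolding sum_paths_Suc
  proof (intro sum.cong refl, goal_cases)
    case (1 os)
    have ev: "(\<Sum>j<Suc t. of_bool (act (take j (os @ [x])))) =
        (\<Sum>j<t. of_bool (act (take j os))) + (of_bool (act os) :: real)" for x
      using length_paths [OF 1] by simp
    show ?case
      unfolding sum_distrib_left [where A = "{..M}"]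
      by (intro sum.cong refl)
         (simp only: ev path_prob_snoc power_mult_distrib power_divide distrib_left minus_add_distrib
            exp_add times_divide_eq_left times_divide_eq_right divide_divide_eq_left mult_ac)
  qed
  also have "\<dots> \<le> (\<Sum>os\<in>paths M t. path_prob K' os * (path_prob K os / path_prob K' os) ^ q *
       exp (- (\<kappa> * (\<Sum>j<t. of_bool (act (take j os))))) * 1)"
  proof (intro sum_mono mult_left_mono)
    fix os
    have "exp (- (\<kappa> * of_bool (act os))) * (\<Sum>x\<le>M. K' os x * (K os x / K' os x) ^ q) \<le>
        exp (- (\<kappa> * of_bool (act os))) * exp (\<kappa> * of_bool (act os))"
      by (intro mult_left_mono renyi_step) simp
    then show "exp (- (\<kappa> * of_bool (act os))) * (\<Sum>x\<le>M. K' os x * (K os x / K' os x) ^ q) \<le> 1"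
      by (simp add: exp_add [symmetric])
  qed (simp add: K.path_prob_nonneg K'.path_prob_nonneg)
  finally show ?case using Suc.IH by simp
qed simp

lemma renyi_bound:
  assumes budget: "\<And>os. os \<in> paths M t \<Longrightarrow> path_prob K os > 0 \<Longrightarrow>
      (\<Sum>j<t. of_bool (act (take j os))) \<le> b"
    and "\<kappa> \<ge> 0"
  shows "(\<Sum>os\<in>paths M t. path_prob K' os * (path_prob K os / path_prob K' os) ^ q) \<le> exp (\<kappa> * b)"
proof -
  have "(\<Sum>os\<in>paths M t. path_prob K' os * (path_prob K os / path_prob K' os) ^ q) \<le>
     exp (\<kappa> * b) * (\<Sum>os\<in>paths M t. path_prob K' os * (path_prob K os / path_prob K' os) ^ q *
     exp (- (\<kappa> * (\<Sum>j<t. of_bool (act (take j os))))))"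
    unfolding sum_distrib_left [where A = "paths M t"]
  proof (intro sum_mono)
    fix os assume os: "os \<in> paths M t"
    show "path_prob K' os * (path_prob K os / path_prob K' os) ^ q \<le> exp (\<kappa> * b) *
      (path_prob K' os * (path_prob K os / path_prob K' os) ^ q *
       exp (- (\<kappa> * (\<Sum>j<t. of_bool (act (take j os))))))"
    proof (cases "path_prob K os > 0")
      case True
      have "\<kappa> * (\<Sum>j<t. of_bool (act (take j os))) \<le> \<kappa> * b"
        by (intro mult_left_mono budget os True assms)
      then have "1 \<le> exp (\<kappa> * b) * exp (- (\<kappa> * (\<Sum>j<t. of_bool (act (take j os)))))"
        by (simp add: exp_add [symmetric])
      then have "path_prob K' os * (path_prob K os / path_prob K' os) ^ q * 1 \<le>
          path_prob K' os * (path_prob K os / path_prob K' os) ^ q *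
          (exp (\<kappa> * b) * exp (- (\<kappa> * (\<Sum>j<t. of_bool (act (take j os))))))"
        by (intro mult_left_mono) (simp_all add: K.path_prob_nonneg K'.path_prob_nonneg)
      then show ?thesis by (simp add: mult_ac)
    next
      \<comment> \<open>Off the support of \<open>K\<close> the budget may fail, but there the ratio
        is 0 and \<open>q > 0\<close> makes the term vanish.\<close>
      case False
      then have "path_prob K os = 0" using K.path_prob_nonneg [of os] by simp
      then show ?thesis using q_pos by (simp add: power_0_left)
    qed
  qed
  also have "\<dots> \<le> exp (\<kappa> * b) * 1"
    by (intro mult_left_mono renyi_composition) simp
  finally show ?thesis by simp
qed

text \<open>Where the likelihood ratio \<open>R\<close> exceeds \<open>exp \<epsilon>\<close>, it is bounded by
  \<open>R * (R / exp \<epsilon>) ^ (q - 1)\<close>, whose mean is controlled by the Renyi bound.\<close>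

lemma approximate_dp:
  assumes budget: "\<And>os. os \<in> paths M t \<Longrightarrow> path_prob K os > 0 \<Longrightarrow>
      (\<Sum>j<t. of_bool (act (take j os))) \<le> b"
    and "\<kappa> \<ge> 0" "0 \<le> B"
    and g: "\<And>os. os \<in> paths M t \<Longrightarrow> 0 \<le> g os"
      "\<And>os. os \<in> paths M t \<Longrightarrow> path_prob K os > 0 \<Longrightarrow> g os \<le> B"
  shows "(\<Sum>os\<in>paths M t. path_prob K os * g os) \<le>
     exp \<epsilon> * (\<Sum>os\<in>paths M t. path_prob K' os * g os) + exp (\<kappa> * b - \<epsilon> * (real q - 1)) * B"
proof -
  let ?R = "\<lambda>os. path_prob K os / path_prob K' os"
  have "(\<Sum>os\<in>paths M t. path_prob K os * g os) \<le>
     (\<Sum>os\<in>paths M t. exp \<epsilon> * (path_prob K' os * g os) +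
        exp (- (\<epsilon> * (real q - 1))) * B * (path_prob K' os * ?R os ^ q))"
  proof (intro sum_mono)
    fix os assume os: "os \<in> paths M t"
    show "path_prob K os * g os \<le> exp \<epsilon> * (path_prob K' os * g os) +
        exp (- (\<epsilon> * (real q - 1))) * B * (path_prob K' os * ?R os ^ q)"
    proof (cases "path_prob K os \<le> exp \<epsilon> * path_prob K' os")
      case True
      then have "path_prob K os * g os \<le> exp \<epsilon> * path_prob K' os * g os"
        by (intro mult_right_mono g os)
      moreover have "0 \<le> exp (- (\<epsilon> * (real q - 1))) * B * (path_prob K' os * ?R os ^ q)"
        using assms by (simp add: K.path_prob_nonneg K'.path_prob_nonneg)
      ultimately show ?thesis by (simp add: mult_ac)
    next
      case False
      have pos': "path_prob K' os > 0"
      proof (rule ccontr)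
        assume "\<not> path_prob K' os > 0"
        then have "path_prob K' os = 0" using K'.path_prob_nonneg [of os] by simp
        with path_abs_cont [OF this] False show False by simp
      qed
      then have R: "exp \<epsilon> \<le> ?R os"
        using False by (auto simp: field_simps)
      have pos: "path_prob K os > 0"
        using False mult_pos_pos [OF exp_gt_zero [of \<epsilon>] pos'] by linarith
      have "1 = exp (- (\<epsilon> * (real q - 1))) * exp \<epsilon> ^ (q - 1)"
        using q_pos by (simp add: exp_of_nat_mult [symmetric] exp_add [symmetric] of_nat_diff mult.commute)
      also have "\<dots> \<le> exp (- (\<epsilon> * (real q - 1))) * ?R os ^ (q - 1)"
        by (intro mult_left_mono power_mono R) auto
      finally have "path_prob K os * B * 1 \<le>
          path_prob K os * B * (exp (- (\<epsilon> * (real q - 1))) * ?R os ^ (q - 1))"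
        using pos assms by (intro mult_left_mono) auto
      moreover have "path_prob K' os * ?R os ^ q = path_prob K os * ?R os ^ (q - 1)"
        using q_pos pos' by (cases q) auto
      moreover have "path_prob K os * g os \<le> path_prob K os * B"
        using pos g(2) [OF os pos] by simp
      moreover have "0 \<le> exp \<epsilon> * (path_prob K' os * g os)"
        using g(1) [OF os] pos' by simp
      ultimately show ?thesis by (simp add: mult_ac)
    qed
  qed
  also have "\<dots> = exp \<epsilon> * (\<Sum>os\<in>paths M t. path_prob K' os * g os) +
      exp (- (\<epsilon> * (real q - 1))) * B * (\<Sum>os\<in>paths M t. path_prob K' os * ?R os ^ q)"
    by (simp add: sum.distrib sum_distrib_left)
  also have "\<dots> \<le> exp \<epsilon> * (\<Sum>os\<in>paths M t. path_prob K' os * g os) +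
      exp (- (\<epsilon> * (real q - 1))) * B * exp (\<kappa> * b)"
    using assms by (intro add_left_mono mult_left_mono renyi_bound budget) auto
  also have "exp (- (\<epsilon> * (real q - 1))) * B * exp (\<kappa> * b) = exp (\<kappa> * b - \<epsilon> * (real q - 1)) * B"
    by (simp add: exp_diff exp_minus divide_inverse)
  finally show ?thesis .
qed

end

section \<open>Sequences of noisy threshold tests\<close>

text \<open>Law of the index of the first success when test \<open>l\<close> succeeds with
  probability \<open>f l\<close>. At index \<open>M\<close> the run ends without a test, hence the
  factor 1.\<close>

definition stop_prob :: "(nat \<Rightarrow> real) \<Rightarrow> nat \<Rightarrow> nat \<Rightarrow> real" where
  "stop_prob f M m = (\<Prod>l<m. 1 - f l) * (if m = M then 1 else f m)"

lemma stop_prob_Suc_0 [simp]: "stop_prob f (Suc M) 0 = f 0"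
  by (simp add: stop_prob_def)

lemma stop_prob_0 [simp]: "stop_prob f 0 0 = 1"
  by (simp add: stop_prob_def)

lemma stop_prob_Suc_Suc [simp]:
  "stop_prob f (Suc M) (Suc m) = (1 - f 0) * stop_prob (\<lambda>l. f (Suc l)) M m"
  unfolding stop_prob_def by (subst prod.lessThan_Suc_shift) simp

lemma sum_stop_prob: "(\<Sum>m\<le>M. stop_prob f M m) = 1"
  by (induction M arbitrary: f)
     (simp_all add: sum.atMost_Suc_shift sum_distrib_left [symmetric] del: sum.atMost_Suc)

lemma stop_prob_nonneg:
  assumes "\<And>l. 0 \<le> f l \<and> f l \<le> 1"
  shows "0 \<le> stop_prob f M m"
  using assms by (simp add: stop_prob_def prod_nonneg)

lemma exp_le_quadratic:
  fixes x :: real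
  assumes "\<bar>x\<bar> \<le> 1"
  shows "exp x \<le> 1 + x + x\<^sup>2"
proof (cases "x \<ge> 0")
  case True
  then show ?thesis using assms by (intro exp_bound) auto
next
  case False
  define y where "y = - x"
  have y: "0 < y" "y \<le> 1" using False assms by (auto simp: y_def)
  have "1 \<le> (1 - y + y\<^sup>2) * (1 + y)"
    using y by (simp add: algebra_simps power2_eq_square)
  also have "\<dots> \<le> (1 - y + y\<^sup>2) * exp y"
    using y by (intro mult_left_mono) (simp_all add: add_nonneg_nonneg)
  finally show ?thesis
    by (simp add: y_def exp_minus field_simps)
qed

lemma one_plus_power_le:
  fixes x :: real
  assumes "-1 \<le> x" "\<bar>real q * x\<bar> \<le> 1"
  shows "(1 + x) ^ q \<le> 1 + q * x + (q * x)\<^sup>2"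
proof -
  have "(1 + x) ^ q \<le> exp x ^ q"
    using assms by (intro power_mono) auto
  also have "\<dots> = exp (q * x)"
    by (simp add: exp_of_nat_mult)
  also have "\<dots> \<le> 1 + q * x + (q * x)\<^sup>2"
    by (rule exp_le_quadratic [OF assms(2)])
  finally show ?thesis .
qed

text \<open>The factor \<open>f'\<close> in the quadratic term makes the cost of a sequence of tests that stops at
  the first success independent of its length, see \<open>stop_prob_renyi\<close>.\<close>

lemma bernoulli_renyi:
  fixes f f' \<eta> :: real
  assumes f: "0 \<le> f" "f \<le> 1" "0 < f'" "f' < 1"
    and close: "\<bar>f - f'\<bar> \<le> \<eta> * f'" "\<bar>f - f'\<bar> \<le> \<eta> * (1 - f')"
    and q: "real q * \<eta> \<le> 1 / 4"
  shows "f' * (f / f') ^ q + (1 - f') * ((1 - f) / (1 - f')) ^ q \<le> 1 + 2 * (q * \<eta>)\<^sup>2 * f'"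
    and "(1 - f') * ((1 - f) / (1 - f')) ^ q \<le> 1 - f' / 2"
proof -
  define a where "a = (f - f') / f'"
  define b where "b = (f' - f) / (1 - f')"
  have eta: "\<eta> \<ge> 0"
    using close(1) f(3) by (smt (verit) mult_neg_pos)
  have ab: "\<bar>a\<bar> \<le> \<eta>" "\<bar>b\<bar> \<le> \<eta>"
    using close f by (auto simp: a_def b_def divide_simps abs_minus_commute)
  have qab: "\<bar>q * a\<bar> \<le> 1 / 4" "\<bar>q * b\<bar> \<le> 1 / 4"
    using ab q mult_left_mono [OF ab(1), of q] mult_left_mono [OF ab(2), of q]
    by (auto simp: abs_mult)
  have eqs: "f / f' = 1 + a" "(1 - f) / (1 - f') = 1 + b"
    using f by (auto simp: a_def b_def divide_simps)
  have "(1 + a) \<ge> 0" "1 + b \<ge> 0"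
    unfolding eqs [symmetric] using f by auto
  then have pow: "(1 + a) ^ q \<le> 1 + q * a + (q * a)\<^sup>2" "(1 + b) ^ q \<le> 1 + q * b + (q * b)\<^sup>2"
    using qab by (auto intro!: one_plus_power_le)
  \<comment> \<open>The relative deviations have mean zero under the reference law, so the
    first-order terms cancel and only the variance is paid.\<close>
  have mean: "f' * a + (1 - f') * b = 0"
    using f by (simp add: a_def b_def)
  have b1: "(1 - f') * b = f' - f"
    using f by (auto simp: b_def)
  have var: "f' * a\<^sup>2 + (1 - f') * b\<^sup>2 \<le> 2 * \<eta>\<^sup>2 * f'"
  proof -
    have "f' * a\<^sup>2 \<le> \<eta>\<^sup>2 * f'"
      using ab f power_mono [OF ab(1), of 2] by (simp add: mult.commute)
    \<comment> \<open>One factor of the square is measured against \<open>f'\<close> and the other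
      against \<open>1 - f'\<close>; this keeps the bound proportional to \<open>f'\<close> even
      when failure is the likely outcome.\<close>
    moreover have "(1 - f') * b\<^sup>2 \<le> \<eta>\<^sup>2 * f'"
    proof -
      have "(1 - f') * b\<^sup>2 = \<bar>f' - f\<bar> * \<bar>b\<bar>"
        using f unfolding b1 [symmetric] by (simp add: abs_mult power2_eq_square)
      also have "\<dots> \<le> (\<eta> * f') * \<eta>"
        using ab close by (intro mult_mono) (auto simp: abs_minus_commute)
      finally show ?thesis by (simp add: power2_eq_square mult_ac)
    qed
    ultimately show ?thesis by linarith
  qed
  have "f' * (1 + a) ^ q + (1 - f') * (1 + b) ^ q \<le>
      f' * (1 + q * a + (q * a)\<^sup>2) + (1 - f') * (1 + q * b + (q * b)\<^sup>2)"
    using f pow by (intro add_mono mult_left_mono) auto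
  also have "\<dots> = 1 + q * (f' * a + (1 - f') * b) + (real q)\<^sup>2 * (f' * a\<^sup>2 + (1 - f') * b\<^sup>2)"
    by (simp add: algebra_simps power2_eq_square)
  also have "\<dots> \<le> 1 + (real q)\<^sup>2 * (2 * \<eta>\<^sup>2 * f')"
    using var by (simp add: mean mult_left_mono)
  finally show "f' * (f / f') ^ q + (1 - f') * ((1 - f) / (1 - f')) ^ q \<le> 1 + 2 * (q * \<eta>)\<^sup>2 * f'"
    by (simp add: eqs power_mult_distrib mult_ac)
  have "(q * b)\<^sup>2 \<le> \<bar>q * b\<bar>"
    using qab(2) mult_left_mono [of "\<bar>q * b\<bar>" 1 "\<bar>q * b\<bar>"] by (simp add: power2_eq_square flip: abs_mult)
  then have "(1 + b) ^ q \<le> 1 + 2 * \<bar>q * b\<bar>"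
    using pow(2) by linarith
  then have "(1 - f') * (1 + b) ^ q \<le> (1 - f') * (1 + 2 * \<bar>q * b\<bar>)"
    using f by (intro mult_left_mono) auto
  also have "\<dots> = 1 - f' + 2 * q * \<bar>(1 - f') * b\<bar>"
    unfolding abs_mult using f by (simp add: algebra_simps)
  also have "\<dots> \<le> 1 - f' + 2 * q * (\<eta> * f')"
    unfolding b1 using close by (intro add_left_mono mult_left_mono) (auto simp: abs_minus_commute)
  also have "\<dots> \<le> 1 - f' + 2 * (1 / 4) * f'"
  proof -
    have "real q * (\<eta> * f') \<le> 1 / 4 * f'"
      using mult_right_mono [OF q, of f'] f by (simp only: mult.assoc less_imp_le)
    then show ?thesis by linarith
  qed
  finally show "(1 - f') * ((1 - f) / (1 - f')) ^ q \<le> 1 - f' / 2"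
    by (simp add: eqs)
qed

text \<open>Induction on the first test. With x = (q \<eta>)^2 the first test costs at most 2 x f',
  and the remaining ones are weighted by at most 1 - f' / 2. The value 1 + 4 x is the fixed point: 1
  + 2 x f' + (1 - f' / 2) 4 x = 1 + 4 x.\<close>

lemma stop_prob_renyi:
  assumes f: "\<And>l. 0 \<le> f l \<and> f l \<le> 1" "\<And>l. 0 < f' l \<and> f' l < 1"
    and close: "\<And>l. \<bar>f l - f' l\<bar> \<le> \<eta> * f' l" "\<And>l. \<bar>f l - f' l\<bar> \<le> \<eta> * (1 - f' l)"
    and q: "real q * \<eta> \<le> 1 / 4"
  shows "(\<Sum>m\<le>M. stop_prob f' M m * (stop_prob f M m / stop_prob f' M m) ^ q) \<le> 1 + 4 * (q * \<eta>)\<^sup>2"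
  using f close
proof (induction M arbitrary: f f')
  case (Suc M)
  let ?c = "(1 - f' 0) * ((1 - f 0) / (1 - f' 0)) ^ q"
  note step = bernoulli_renyi [of "f 0" "f' 0" \<eta> q]
  have c: "0 \<le> ?c"
    using Suc.prems(1,2) [of 0] by simp
  have "(\<Sum>m\<le>Suc M. stop_prob f' (Suc M) m * (stop_prob f (Suc M) m / stop_prob f' (Suc M) m) ^ q) =
      f' 0 * (f 0 / f' 0) ^ q + ?c * (\<Sum>m\<le>M. stop_prob (\<lambda>l. f' (Suc l)) M m *
        (stop_prob (\<lambda>l. f (Suc l)) M m / stop_prob (\<lambda>l. f' (Suc l)) M m) ^ q)"
    unfolding sum.atMost_Suc_shift stop_prob_Suc_0 stop_prob_Suc_Suc sum_distrib_left
    by (intro arg_cong2 [where f = "(+)"] refl sum.cong)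
       (simp only: power_mult_distrib power_divide times_divide_eq_left times_divide_eq_right
          divide_divide_eq_left mult_ac)
  also have "\<dots> \<le> f' 0 * (f 0 / f' 0) ^ q + ?c * (1 + 4 * (q * \<eta>)\<^sup>2)"
    using Suc.prems by (intro add_left_mono mult_left_mono Suc.IH c) auto
  also have "\<dots> = (f' 0 * (f 0 / f' 0) ^ q + ?c) + ?c * (4 * (q * \<eta>)\<^sup>2)"
    by (simp add: algebra_simps)
  also have "\<dots> \<le> (1 + 2 * (q * \<eta>)\<^sup>2 * f' 0) + (1 - f' 0 / 2) * (4 * (q * \<eta>)\<^sup>2)"
    using Suc.prems q by (intro add_mono mult_right_mono step) auto
  also have "\<dots> = 1 + 4 * (q * \<eta>)\<^sup>2"
    by (simp add: algebra_simps)
  finally show ?case .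
qed simp

section \<open>Tails and shifts of the Laplace distribution\<close>

definition laplace_tail :: "real \<Rightarrow> real \<Rightarrow> real" where
  "laplace_tail b u = measure (laplace b) {u..}"

lemma sets_laplace [simp, measurable_cong]: "sets (laplace b) = sets borel"
  by (simp add: laplace_def)

lemma space_laplace [simp]: "space (laplace b) = UNIV"
  by (simp add: laplace_def)

lemma emeasure_laplace_upper:
  assumes b: "b > 0" and u: "u \<ge> 0"
  shows "emeasure (laplace b) {u..} = ennreal (exp (- u / b) / 2)"
proof -
  have "emeasure (laplace b) {u..} =
      (\<integral>\<^sup>+x. ennreal (exp (- \<bar>x\<bar> / b) / (2 * b)) * indicator {u..} x \<partial>lborel)"
    unfolding laplace_def by (subst emeasure_density) auto
  also have "\<dots> = (\<integral>\<^sup>+x. ennreal (exp (- x / b) / (2 * b)) * indicator {u..} x \<partial>lborel)"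
    using u by (intro nn_integral_cong) (auto split: split_indicator)
  also have "\<dots> = ennreal (0 - (- exp (- u / b) / 2))"
  proof (rule nn_integral_FTC_atLeast)
    show "((\<lambda>x. - exp (- x / b) / 2) \<longlongrightarrow> 0) at_top"
      using b by real_asymp
  qed (use b in \<open>auto intro!: derivative_eq_intros\<close>)
  finally show ?thesis by simp
qed

lemma emeasure_laplace_reflect:
  assumes [measurable]: "S \<in> sets borel"
  shows "emeasure (laplace b) {x. - x \<in> S} = emeasure (laplace b) S"
proof -
  have "emeasure (laplace b) S =
      (\<integral>\<^sup>+x. ennreal (exp (- \<bar>x\<bar> / b) / (2 * b)) * indicator S x \<partial>lborel)"
    unfolding laplace_def by (subst emeasure_density) auto
  also have "\<dots> = (\<integral>\<^sup>+x. ennreal (exp (- \<bar>x\<bar> / b) / (2 * b)) * indicator {x. - x \<in> S} x \<partial>lborel)"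
    by (subst nn_integral_real_affine [where c = "-1" and t = 0]) (auto simp: indicator_def)
  also have "\<dots> = emeasure (laplace b) {x. - x \<in> S}"
    unfolding laplace_def by (subst emeasure_density) auto
  finally show ?thesis ..
qed

text \<open>The densities at \<open>x - d\<close> and \<open>x\<close> differ by a factor of at most
  exp (1 / b), by the triangle inequality. This is the privacy of a count that changes by at most
  one.\<close>

lemma emeasure_laplace_shift:
  assumes [measurable]: "S \<in> sets borel" and b: "b > 0" and d: "\<bar>d\<bar> \<le> 1"
  shows "emeasure (laplace b) S \<le> ennreal (exp (1 / b)) * emeasure (laplace b) {x. x - d \<in> S}"
proof -
  have "emeasure (laplace b) S =
      (\<integral>\<^sup>+x. ennreal (exp (- \<bar>x\<bar> / b) / (2 * b)) * indicator S x \<partial>lborel)"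
    unfolding laplace_def by (subst emeasure_density) auto
  also have "\<dots> = (\<integral>\<^sup>+x. ennreal (exp (- \<bar>x - d\<bar> / b) / (2 * b)) * indicator {x. x - d \<in> S} x \<partial>lborel)"
    by (subst nn_integral_real_affine [where c = "1" and t = "- d"]) (auto simp: indicator_def)
  also have "\<dots> \<le> (\<integral>\<^sup>+x. ennreal (exp (1 / b)) *
      (ennreal (exp (- \<bar>x\<bar> / b) / (2 * b)) * indicator {x. x - d \<in> S} x) \<partial>lborel)"
  proof (intro nn_integral_mono)
    fix x
    have "- \<bar>x - d\<bar> / b \<le> 1 / b + - \<bar>x\<bar> / b"
      using b d by (simp add: divide_simps)
    then have "exp (- \<bar>x - d\<bar> / b) \<le> exp (1 / b) * exp (- \<bar>x\<bar> / b)"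
      unfolding exp_add [symmetric] by simp
    then have "ennreal (exp (- \<bar>x - d\<bar> / b) / (2 * b)) \<le> ennreal (exp (1 / b) * (exp (- \<bar>x\<bar> / b) / (2 * b)))"
      using b by (intro ennreal_leI) (simp add: divide_simps)
    then show "ennreal (exp (- \<bar>x - d\<bar> / b) / (2 * b)) * indicator {x. x - d \<in> S} x \<le>
        ennreal (exp (1 / b)) * (ennreal (exp (- \<bar>x\<bar> / b) / (2 * b)) * indicator {x. x - d \<in> S} x)"
      using b by (auto simp: ennreal_mult [symmetric] split: split_indicator)
  qed
  also have "\<dots> = ennreal (exp (1 / b)) * emeasure (laplace b) {x. x - d \<in> S}"
    unfolding laplace_def by (subst emeasure_density) (auto simp: nn_integral_cmult)
  finally show ?thesis .
qed

lemma AE_laplace_neq: "AE x in laplace b. x \<noteq> a"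
  unfolding laplace_def by (subst AE_density) (auto intro: AE_mp [OF AE_lborel_singleton])

text \<open>By reflection both half lines have the same mass, and a single point is null, so the
  tail already evaluated at 0 settles the total.\<close>

lemma prob_space_laplace:
  assumes b: "b > 0"
  shows "prob_space (laplace b)"
proof
  have "emeasure (laplace b) {..<0} = emeasure (laplace b) {..0}"
    using AE_laplace_neq [where b = b and a = 0] by (intro emeasure_eq_AE) (auto elim!: eventually_mono)
  also have "\<dots> = emeasure (laplace b) {x. - x \<in> {0..}}"
    by (intro arg_cong [where f = "emeasure (laplace b)"]) auto
  also have "\<dots> = emeasure (laplace b) {0..}"
    by (rule emeasure_laplace_reflect) simp
  finally have "emeasure (laplace b) {..<0} = ennreal (1 / 2)"
    using emeasure_laplace_upper [OF b, of 0] by simp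
  then have "emeasure (laplace b) ({..<0} \<union> {0..}) = ennreal (1 / 2) + ennreal (1 / 2)"
    using emeasure_laplace_upper [OF b, of 0] by (subst plus_emeasure [symmetric]) auto
  also have "\<dots> = 1"
    by (subst ennreal_plus [symmetric]) simp_all
  also have "{..<0::real} \<union> {0..} = UNIV" by auto
  finally show "emeasure (laplace b) (space (laplace b)) = 1"
    by simp
qed

lemma laplace_tail_nonneg_arg:
  assumes "b > 0" "u \<ge> 0"
  shows "laplace_tail b u = exp (- u / b) / 2"
  using emeasure_laplace_upper [OF assms] by (simp add: laplace_tail_def measure_def)

lemma measure_laplace_below:
  assumes "b > 0"
  shows "measure (laplace b) {..<u} = 1 - laplace_tail b u"
proof -
  interpret prob_space "laplace b" using assms by (rule prob_space_laplace)
  have "{..<u} = space (laplace b) - {u..}" by auto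
  then show ?thesis
    using prob_compl [of "{u..}"] by (simp add: laplace_tail_def)
qed

lemma laplace_tail_minus:
  assumes "b > 0"
  shows "laplace_tail b (- u) = 1 - laplace_tail b u"
proof -
  have "measure (laplace b) {..<u} = measure (laplace b) {..u}"
    using AE_laplace_neq [where b = b and a = u] by (intro measure_eq_AE) (auto elim!: eventually_mono)
  also have "\<dots> = measure (laplace b) {x. - x \<in> {- u..}}"
    by (intro arg_cong [where f = "measure (laplace b)"]) auto
  also have "\<dots> = laplace_tail b (- u)"
    unfolding laplace_tail_def measure_def by (subst emeasure_laplace_reflect) auto
  finally show ?thesis
    using measure_laplace_below [OF assms, of u] by simp
qed

lemma laplace_tail_strict:
  assumes "b > 0"
  shows "0 < laplace_tail b u" "laplace_tail b u < 1"
proof -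
  have "0 < laplace_tail b v \<and> laplace_tail b v < 1" if "v \<ge> 0" for v
  proof -
    have "exp (- v / b) \<le> 1" using that assms by simp
    then show ?thesis
      using that assms by (simp add: laplace_tail_nonneg_arg del: exp_le_one_iff)
  qed
  from this [of u] this [of "- u"] show "0 < laplace_tail b u" "laplace_tail b u < 1"
    using laplace_tail_minus [OF assms, of u] by (cases "u \<ge> 0"; simp)+
qed

text \<open>The moment bound for a test needs closeness relative to both its success and its failure
  probability. The second inequality is the first one for the reflected distribution.\<close>

lemma laplace_tail_lipschitz:
  assumes b: "b > 0" and uv: "\<bar>u - v\<bar> \<le> 1"
  shows "\<bar>laplace_tail b u - laplace_tail b v\<bar> \<le> (exp (1 / b) - 1) * laplace_tail b v"
    and "\<bar>laplace_tail b u - laplace_tail b v\<bar> \<le> (exp (1 / b) - 1) * (1 - laplace_tail b v)"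
proof -
  interpret prob_space "laplace b" using b by (rule prob_space_laplace)
  have le: "laplace_tail b u \<le> exp (1 / b) * laplace_tail b v"
    if "\<bar>u - v\<bar> \<le> 1" for u v
  proof -
    have "emeasure (laplace b) {u..} \<le> ennreal (exp (1 / b)) * emeasure (laplace b) {x. x - (v - u) \<in> {u..}}"
      using b that by (intro emeasure_laplace_shift) auto
    also have "{x. x - (v - u) \<in> {u..}} = {v..}" by auto
    finally have "ennreal (laplace_tail b u) \<le> ennreal (exp (1 / b) * laplace_tail b v)"
      by (simp add: laplace_tail_def emeasure_eq_measure ennreal_mult)
    then show ?thesis by (simp add: laplace_tail_def)
  qed
  \<comment> \<open>For x > 0 one has 1 - 1 / x \<le> x - 1, so a decrease by the factor exp (1 / b)
    is covered by the same relative bound as an increase.\<close>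
  have "exp (1 / b) * exp (1 / b) - 2 * exp (1 / b) + 1 \<ge> 0"
    using zero_le_square [of "exp (1 / b) - 1"] by (simp add: algebra_simps)
  then have inv: "1 - 1 / exp (1 / b) \<le> exp (1 / b) - 1"
    by (simp add: field_simps)
  have abs_le: "\<bar>x - y\<bar> \<le> (exp (1 / b) - 1) * y"
    if "0 \<le> y" "x \<le> exp (1 / b) * y" "y \<le> exp (1 / b) * x" for x y :: real
  proof -
    have "y / exp (1 / b) \<le> x" using that(3) by (simp add: field_simps)
    then have "y - x \<le> (1 - 1 / exp (1 / b)) * y" by (simp add: algebra_simps)
    also have "\<dots> \<le> (exp (1 / b) - 1) * y" by (intro mult_right_mono inv that)
    finally have "y - x \<le> (exp (1 / b) - 1) * y" .
    moreover have "x - y \<le> (exp (1 / b) - 1) * y" using that(2) by (simp add: algebra_simps)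
    ultimately show ?thesis by simp
  qed
  show "\<bar>laplace_tail b u - laplace_tail b v\<bar> \<le> (exp (1 / b) - 1) * laplace_tail b v"
    using uv laplace_tail_strict [OF b, of v] by (intro abs_le le) auto
  have "\<bar>laplace_tail b (- u) - laplace_tail b (- v)\<bar> \<le> (exp (1 / b) - 1) * laplace_tail b (- v)"
    using uv laplace_tail_strict [OF b, of "- v"] by (intro abs_le le) auto
  then show "\<bar>laplace_tail b u - laplace_tail b v\<bar> \<le> (exp (1 / b) - 1) * (1 - laplace_tail b v)"
    by (simp add: laplace_tail_minus [OF b] abs_minus_commute)
qed

lemma laplace_tail_le_exp:
  assumes "b > 0" "u \<ge> 0"
  shows "laplace_tail b u \<le> exp (- u / b)"
  using assms by (simp add: laplace_tail_nonneg_arg)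

lemma one_minus_laplace_tail_le_exp:
  assumes "b > 0" "u \<le> 0"
  shows "1 - laplace_tail b u \<le> exp (u / b)"
  using laplace_tail_minus [OF assms(1), of u] laplace_tail_le_exp [of b "- u"] assms by simp

section \<open>Bottom-k sketches and the estimator\<close>

definition key_rank :: "(nat \<Rightarrow> real) \<Rightarrow> nat set \<Rightarrow> nat \<Rightarrow> nat" where
  "key_rank \<rho> V i = card {j \<in> V. \<rho> j < \<rho> i \<or> (\<rho> j = \<rho> i \<and> j < i)}"

lemma in_keys_bk_sketch: "i \<in> fst ` bk_sketch k \<rho> V \<longleftrightarrow> i \<in> V \<and> key_rank \<rho> V i < k"
  unfolding bk_sketch_def key_rank_def by (simp add: image_iff)

lemma keys_bk_sketch: "fst ` bk_sketch k \<rho> V = {i \<in> V. key_rank \<rho> V i < k}"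
  using in_keys_bk_sketch by blast

lemma card_keys_bk_sketch: "finite V \<Longrightarrow> card (fst ` bk_sketch k \<rho> V) = min k (card V)"
  unfolding keys_bk_sketch key_rank_def by (rule card_less_rank) auto

lemma key_rank_below:
  assumes "\<rho> i < \<tau>"
  shows "key_rank \<rho> V i = key_rank \<rho> {j \<in> V. \<rho> j < \<tau>} i"
  unfolding key_rank_def using assms by (intro arg_cong [where f = card]) auto

text \<open>The keys below \<tau> form an initial segment of the order in which the sketch is
  filled, so the sketch holds all of them or \<open>k\<close> of them.\<close>

lemma sum_bk_sketch_below:
  assumes "finite V"
  shows "(\<Sum>(i, x)\<in>bk_sketch k \<rho> V. of_bool (x < \<tau>)) = real (min k (card {i \<in> V. \<rho> i < \<tau>}))"
proof -
  have inj: "inj_on (\<lambda>i. (i, \<rho> i)) A" for A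
    by (simp add: inj_on_def)
  have "bk_sketch k \<rho> V = (\<lambda>i. (i, \<rho> i)) ` {i \<in> V. key_rank \<rho> V i < k}"
    by (auto simp: bk_sketch_def key_rank_def)
  then have "(\<Sum>(i, x)\<in>bk_sketch k \<rho> V. of_bool (x < \<tau>)) =
      (\<Sum>i\<in>{i \<in> V. key_rank \<rho> V i < k}. of_bool (\<rho> i < \<tau>) :: real)"
    by (simp add: sum.reindex [OF inj])
  also have "\<dots> = real (card {i \<in> {i \<in> V. key_rank \<rho> V i < k}. \<rho> i < \<tau>})"
    using assms by (simp add: Int_def)
  also have "{i \<in> {i \<in> V. key_rank \<rho> V i < k}. \<rho> i < \<tau>} =
      {i \<in> {j \<in> V. \<rho> j < \<tau>}. key_rank \<rho> {j \<in> V. \<rho> j < \<tau>} i < k}"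
    using key_rank_below [of \<rho> _ \<tau> V] by (intro Collect_cong) (metis (mono_tags, lifting) mem_Collect_eq)
  also have "card \<dots> = min k (card {j \<in> V. \<rho> j < \<tau>})"
    unfolding key_rank_def using assms by (intro card_less_rank) auto
  finally show ?thesis .
qed

text \<open>A key of \<open>V\<close> outside the sketch is preceded by at least \<open>k\<close>
  others. If it lies below \<tau>, so do they, and the capped count is saturated without it.\<close>

lemma min_card_below_not_in_sketch:
  assumes V: "finite V" and i: "i \<notin> fst ` bk_sketch k \<rho> V"
  shows "min k (card {j \<in> V. \<rho> j < \<tau>}) = min k (card {j \<in> V - {i}. \<rho> j < \<tau>})"
proof (cases "i \<in> V \<and> \<rho> i < \<tau>")
  case True
  then have "k \<le> key_rank \<rho> V i"
    using i by (auto simp: in_keys_bk_sketch)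
  also have "\<dots> \<le> card {j \<in> V - {i}. \<rho> j < \<tau>}"
    unfolding key_rank_def using V True by (intro card_mono) auto
  finally have "k \<le> card {j \<in> V - {i}. \<rho> j < \<tau>}" .
  moreover have "card {j \<in> V - {i}. \<rho> j < \<tau>} \<le> card {j \<in> V. \<rho> j < \<tau>}"
    using V by (intro card_mono) auto
  ultimately show ?thesis by simp
next
  case False
  then have "{j \<in> V. \<rho> j < \<tau>} = {j \<in> V - {i}. \<rho> j < \<tau>}" by auto
  then show ?thesis by simp
qed

lemma card_below_remove:
  assumes "finite V"
  shows "card {j \<in> V. \<rho> j < \<tau>} = card {j \<in> V - {i}. \<rho> j < \<tau>} + of_bool (i \<in> V \<and> \<rho> i < \<tau>)"
proof (cases "i \<in> V \<and> \<rho> i < \<tau>")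
  case True
  then have "{j \<in> V. \<rho> j < \<tau>} = insert i {j \<in> V - {i}. \<rho> j < \<tau>}" by auto
  with True assms show ?thesis by simp
next
  case False
  then have "{j \<in> V. \<rho> j < \<tau>} = {j \<in> V - {i}. \<rho> j < \<tau>}" by auto
  with False show ?thesis by simp
qed

section \<open>Thresholds, noisy tests and the stopping index of the estimator\<close>

locale estimator =
  fixes k n :: nat and \<alpha> e :: real
  assumes k1: "1 \<le> k" and kn: "k \<le> n" and \<alpha>: "0 < \<alpha>" "\<alpha> < 1 / 2" and e: "0 < e"
begin

definition tau :: "nat \<Rightarrow> real" where
  "tau l = (1 + \<alpha> / 4) ^ l * (real k / (2 * real n))"

definition steps :: nat where
  "steps = (LEAST m. 1 \<le> tau m)"

definition T :: real where
  "T = (1 - \<alpha>) * real k"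

definition hits :: "(nat \<Rightarrow> real) \<Rightarrow> nat set \<Rightarrow> nat \<Rightarrow> nat" where
  "hits \<rho> V l = min k (card {i \<in> V. \<rho> i < tau l})"

definition pass :: "(nat \<Rightarrow> real) \<Rightarrow> nat set \<Rightarrow> nat \<Rightarrow> real" where
  "pass \<rho> V l = laplace_tail (1 / e) (T - real (hits \<rho> V l))"

definition stop :: "(nat \<Rightarrow> real) \<Rightarrow> nat set \<Rightarrow> (nat \<Rightarrow> real) \<Rightarrow> nat" where
  "stop \<rho> V Z = (LEAST m. 1 \<le> tau m \<or> T \<le> real (hits \<rho> V m) + Z m)"

lemma k_pos: "0 < real k" and n_pos: "0 < real n" and T_pos: "0 < T"
  using k1 kn \<alpha> by (auto simp: T_def)

lemma tau_pos: "0 < tau l"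
  using k_pos n_pos \<alpha> by (simp add: tau_def)

lemma tau_0: "tau 0 = real k / (2 * real n)"
  by (simp add: tau_def)

lemma tau_Suc: "tau (Suc l) = (1 + \<alpha> / 4) * tau l"
  by (simp add: tau_def)

lemma tau_mono: "l \<le> m \<Longrightarrow> tau l \<le> tau m"
  unfolding tau_def using \<alpha> by (intro mult_right_mono power_increasing) auto

lemma tau_unbounded: "\<exists>m. 1 \<le> tau m"
proof -
  obtain m where "2 * real n / real k < (1 + \<alpha> / 4) ^ m"
    using real_arch_pow [of "1 + \<alpha> / 4"] \<alpha> by auto
  then have "1 \<le> tau m"
    using k_pos n_pos by (simp add: tau_def field_simps)
  then show ?thesis ..
qed

lemma tau_ge_1_iff: "1 \<le> tau l \<longleftrightarrow> steps \<le> l"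
proof
  show "1 \<le> tau l \<Longrightarrow> steps \<le> l"
    unfolding steps_def by (rule Least_le)
  have "1 \<le> tau steps"
    unfolding steps_def using tau_unbounded by (rule LeastI_ex)
  then show "steps \<le> l \<Longrightarrow> 1 \<le> tau l"
    using tau_mono order_trans by blast
qed

lemma tau_less_1_iff: "tau l < 1 \<longleftrightarrow> l < steps"
  using tau_ge_1_iff [of l] by linarith

text \<open>Bernoulli's inequality replaces a logarithm: the number of thresholds enters the final
  bound only as a polynomial factor, where a bound linear in \<open>n\<close> is enough.\<close>

lemma steps_bound: "real steps \<le> 8 * real n / (\<alpha> * real k) + 1"
proof (cases steps)
  case (Suc l)
  have "(1 + real l * (\<alpha> / 4)) * (real k / (2 * real n)) \<le> tau l"
    unfolding tau_def using \<alpha> by (intro mult_right_mono Bernoulli_inequality) auto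
  also have "\<dots> < 1"
    using Suc by (simp add: tau_less_1_iff)
  finally have "(1 + real l * (\<alpha> / 4)) * real k < 2 * real n"
    using n_pos by (simp add: field_simps)
  then have "real l * (\<alpha> * real k) \<le> 8 * real n"
    using k_pos by (simp add: algebra_simps)
  then have "real l \<le> 8 * real n / (\<alpha> * real k)"
    using \<alpha> k_pos by (simp add: field_simps)
  then show ?thesis using Suc by simp
qed (use \<alpha> in simp)

text \<open>Each condition confines a single noise value to a half line, so independence of the
  noise will give a product law. At index \<open>steps\<close> the loop ends because the threshold
  has reached 1, hence the guard.\<close>

lemma stop_eq_iff:
  assumes "m \<le> steps"
  shows "stop \<rho> V Z = m \<longleftrightarrow>
    (\<forall>l<m. Z l < T - real (hits \<rho> V l)) \<and> (m < steps \<longrightarrow> T - real (hits \<rho> V m) \<le> Z m)"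
proof -
  let ?P = "\<lambda>m. 1 \<le> tau m \<or> T \<le> real (hits \<rho> V m) + Z m"
  have "stop \<rho> V Z = m \<longleftrightarrow> ?P m \<and> (\<forall>l<m. \<not> ?P l)"
  proof
    assume "stop \<rho> V Z = m"
    then show "?P m \<and> (\<forall>l<m. \<not> ?P l)"
      unfolding stop_def using LeastI_ex [of ?P] not_less_Least [of _ ?P] tau_unbounded by blast
  next
    assume "?P m \<and> (\<forall>l<m. \<not> ?P l)"
    then show "stop \<rho> V Z = m"
      unfolding stop_def by (intro Least_equality) (auto simp: not_le [symmetric])
  qed
  also have "\<dots> \<longleftrightarrow> (\<forall>l<m. Z l < T - real (hits \<rho> V l)) \<and>
      (m < steps \<longrightarrow> T - real (hits \<rho> V m) \<le> Z m)"
    using assms by (auto simp: tau_ge_1_iff)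
  finally show ?thesis .
qed

lemma stop_le_steps: "stop \<rho> V Z \<le> steps"
  unfolding stop_def by (rule Least_le) (simp add: tau_ge_1_iff)

lemma robust_est_eq:
  assumes V: "finite V"
  shows "robust_est k n \<alpha> Z (bk_sketch k \<rho> V) =
    (if card V < k then real (card V) else T / tau (stop \<rho> V Z))"
proof (cases "card V < k")
  case True
  then show ?thesis using V by (simp add: robust_est_def card_bk_sketch)
next
  case False
  let ?b = "\<lambda>(m, \<tau>). \<tau> < 1 \<and> (\<Sum>(i, x)\<in>bk_sketch k \<rho> V. of_bool (x < \<tau>)) + Z m < T"
  let ?c = "\<lambda>(m, \<tau>). (Suc m, (1 + \<alpha> / 4) * \<tau>)"
  have b: "?b (m, tau m) \<longleftrightarrow> \<not> (1 \<le> tau m \<or> T \<le> real (hits \<rho> V m) + Z m)" for m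
    by (simp add: sum_bk_sketch_below [OF V] hits_def not_le)
  \<comment> \<open>Invariant of the loop: after \<open>m\<close> rounds the state is
    \<open>(m, tau m)\<close>, as long as the least stopping index has not been passed.\<close>
  have "while ?b ?c (0, tau 0) = while ?b ?c (m, tau m)" if "m \<le> stop \<rho> V Z" for m
    using that
  proof (induction m)
    case (Suc m)
    have "m < stop \<rho> V Z" using Suc.prems by simp
    then have "?b (m, tau m)"
      unfolding b stop_def by (rule not_less_Least)
    then have "while ?b ?c (m, tau m) = while ?b ?c (Suc m, tau (Suc m))"
      by (subst while_unfold) (simp add: tau_Suc)
    with Suc show ?case by simp
  qed simp
  from this [of "stop \<rho> V Z"]
  have "while ?b ?c (0, tau 0) = while ?b ?c (stop \<rho> V Z, tau (stop \<rho> V Z))" by simp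
  moreover have "\<not> ?b (stop \<rho> V Z, tau (stop \<rho> V Z))"
    unfolding b not_not unfolding stop_def
    by (rule LeastI_ex) (use tau_unbounded in blast)
  then have "while ?b ?c (stop \<rho> V Z, tau (stop \<rho> V Z)) = (stop \<rho> V Z, tau (stop \<rho> V Z))"
    by (subst while_unfold) (simp only: if_False)
  ultimately have "while ?b ?c (0, tau 0) = (stop \<rho> V Z, tau (stop \<rho> V Z))" by simp
  then show ?thesis
    using False V by (simp add: robust_est_def card_bk_sketch T_def tau_0)
qed

lemma pass_strict: "0 < pass \<rho> V l" "pass \<rho> V l < 1"
  unfolding pass_def using e by (auto intro: laplace_tail_strict)

text \<open>Both capped counts agree with the one over \<open>V - {i}\<close>. This is why a query
  costs privacy for key \<open>i\<close> only if one of the two sketches contains it.\<close>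

lemma pass_update_irrelevant:
  assumes V: "finite V" and i: "i \<notin> fst ` bk_sketch k \<rho> V" "i \<notin> fst ` bk_sketch k (\<rho>(i := y)) V"
  shows "pass \<rho> V l = pass (\<rho>(i := y)) V l"
proof -
  have "{j \<in> V - {i}. (\<rho>(i := y)) j < tau l} = {j \<in> V - {i}. \<rho> j < tau l}" by auto
  then show ?thesis
    unfolding pass_def hits_def
    by (simp only: min_card_below_not_in_sketch [OF V i(1)] min_card_below_not_in_sketch [OF V i(2)])
qed

text \<open>Both uncapped counts exceed the count without \<open>i\<close> by 0 or 1, so the
  argument of the Laplace tail moves by at most one.\<close>

lemma pass_update_close:
  assumes V: "finite V"
  shows "\<bar>pass \<rho> V l - pass (\<rho>(i := y)) V l\<bar> \<le> (exp e - 1) * pass (\<rho>(i := y)) V l"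
    and "\<bar>pass \<rho> V l - pass (\<rho>(i := y)) V l\<bar> \<le> (exp e - 1) * (1 - pass (\<rho>(i := y)) V l)"
proof -
  have "{j \<in> V - {i}. (\<rho>(i := y)) j < tau l} = {j \<in> V - {i}. \<rho> j < tau l}" by auto
  then have "\<bar>(T - real (hits \<rho> V l)) - (T - real (hits (\<rho>(i := y)) V l))\<bar> \<le> 1"
    unfolding hits_def
    by (simp only: card_below_remove [OF V, of \<rho> _ i] card_below_remove [OF V, of "\<rho>(i := y)" _ i])
       (simp add: min_def)
  from laplace_tail_lipschitz [OF _ this, of "1 / e"] e
  show "\<bar>pass \<rho> V l - pass (\<rho>(i := y)) V l\<bar> \<le> (exp e - 1) * pass (\<rho>(i := y)) V l"
    and "\<bar>pass \<rho> V l - pass (\<rho>(i := y)) V l\<bar> \<le> (exp e - 1) * (1 - pass (\<rho>(i := y)) V l)"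
    unfolding pass_def by simp_all
qed

end

section \<open>The law of the transcript for fixed keys\<close>

context estimator
begin

abbreviation noise :: "(nat \<times> nat \<Rightarrow> real) measure" where
  "noise \<equiv> \<Pi>\<^sub>M jm\<in>UNIV. laplace (1 / e)"

end

locale transcript = estimator +
  fixes A :: "real list \<Rightarrow> nat set"
  assumes A: "\<And>as. A as \<subseteq> {1..n}"
begin

definition reply :: "nat set \<Rightarrow> nat \<Rightarrow> real" where
  "reply V x = (if card V < k then real (card V) else T / tau x)"

text \<open>Transcripts record stopping indices, which take finitely many values, instead of real
  answers. The answers can be recovered because a reply is determined by the query set and the
  index.\<close>

definition replies :: "nat list \<Rightarrow> real list" where
  "replies os = foldl (\<lambda>as x. as @ [reply (A as) x]) [] os"

definition Q :: "nat list \<Rightarrow> nat set" where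
  "Q os = A (replies os)"

definition outcome :: "(nat \<Rightarrow> real) \<Rightarrow> nat set \<Rightarrow> (nat \<Rightarrow> real) \<Rightarrow> nat" where
  "outcome \<rho> V Z = (if card V < k then 0 else stop \<rho> V Z)"

primrec outs :: "(nat \<Rightarrow> real) \<Rightarrow> (nat \<times> nat \<Rightarrow> real) \<Rightarrow> nat \<Rightarrow> nat list" where
  "outs \<rho> Z 0 = []"
| "outs \<rho> Z (Suc j) = outs \<rho> Z j @ [outcome \<rho> (Q (outs \<rho> Z j)) (\<lambda>m. Z (j, m))]"

text \<open>A query with fewer than \<open>k\<close> keys is answered by its size, whatever the keys
  and the noise are. Its index is set to 0, and the law is a point mass that does not depend on
  \<rho>.\<close>

definition K :: "(nat \<Rightarrow> real) \<Rightarrow> nat list \<Rightarrow> nat \<Rightarrow> real" where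
  "K \<rho> os x = (if card (Q os) < k then of_bool (x = 0) else stop_prob (pass \<rho> (Q os)) steps x)"

lemma replies_snoc: "replies (os @ [x]) = replies os @ [reply (Q os) x]"
  by (simp add: replies_def Q_def)

lemma finite_A [simp]: "finite (A as)"
  using A finite_subset by blast

lemma Q_subset: "Q os \<subseteq> {1..n}"
  unfolding Q_def by (rule A)

lemma finite_Q [simp]: "finite (Q os)"
  by (simp add: Q_def)

lemma card_Q_le: "card (Q os) \<le> n"
  using card_mono [OF _ Q_subset [of os]] by simp

lemma answers_eq_replies: "answers k n \<alpha> (\<lambda>_. A) (\<rho>, Z, w) j = replies (outs \<rho> Z j)"
proof (induction j)
  case 0
  show ?case by (simp add: replies_def)
next
  case (Suc j)
  then show ?case
    by (simp add: replies_snoc robust_est_eq reply_def outcome_def Q_def)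
qed

lemma length_outs [simp]: "length (outs \<rho> Z j) = j"
  by (induction j) auto

lemma outs_in_paths: "outs \<rho> Z t \<in> paths steps t"
  by (induction t) (auto simp: paths_def outcome_def stop_le_steps)

lemma take_outs: "j \<le> t \<Longrightarrow> take j (outs \<rho> Z t) = outs \<rho> Z j"
  by (induction t) (auto simp: le_Suc_eq)

lemma query_eq: "query k n \<alpha> (\<lambda>_. A) (\<rho>, Z, w) j = Q (outs \<rho> Z j)"
  by (simp add: query_def answers_eq_replies Q_def)

lemma sketch_eq: "sketch k n \<alpha> (\<lambda>_. A) (\<rho>, Z, w) j = bk_sketch k \<rho> (Q (outs \<rho> Z j))"
  by (simp add: sketch_def query_eq)

lemma answer_eq:
  assumes "j < t"
  shows "answer k n \<alpha> (\<lambda>_. A) (\<rho>, Z, w) j = reply (Q (outs \<rho> Z j)) (outs \<rho> Z t ! j)"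
proof -
  have "outs \<rho> Z t ! j = take (Suc j) (outs \<rho> Z t) ! j" by simp
  also have "\<dots> = outcome \<rho> (Q (outs \<rho> Z j)) (\<lambda>m. Z (j, m))"
    using assms by (subst take_outs) (auto simp: nth_append)
  finally show ?thesis
    by (simp add: answer_def sketch_eq robust_est_eq reply_def outcome_def)
qed

lemma kernel_K: "kernel steps (K \<rho>)"
proof
  show "0 \<le> K \<rho> os x" for os x
    by (auto simp: K_def less_imp_le [OF pass_strict(1)] less_imp_le [OF pass_strict(2)]
        intro!: stop_prob_nonneg)
  show "(\<Sum>x\<le>steps. K \<rho> os x) = 1" for os
    by (cases "card (Q os) < k") (simp_all add: K_def sum_stop_prob)
qed

text \<open>Adaptivity disappears once a path is fixed: along \<open>os\<close> the query sets are
  the fixed sets \<open>Q (take j os)\<close>, and query \<open>j\<close> reads only row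
  \<open>j\<close> of the noise.\<close>

lemma outs_eq_iff:
  "length os = t \<Longrightarrow> outs \<rho> Z t = os \<longleftrightarrow>
     (\<forall>j<t. outcome \<rho> (Q (take j os)) (\<lambda>m. Z (j, m)) = os ! j)"
proof (induction t arbitrary: os)
  case (Suc t)
  then obtain os' x where os: "os = os' @ [x]" and len: "length os' = t"
    by (metis length_Suc_conv_rev)
  have "outs \<rho> Z (Suc t) = os \<longleftrightarrow>
      outs \<rho> Z t = os' \<and> outcome \<rho> (Q os') (\<lambda>m. Z (t, m)) = x"
    by (auto simp: os)
  also have "\<dots> \<longleftrightarrow> (\<forall>j<Suc t. outcome \<rho> (Q (take j os)) (\<lambda>m. Z (j, m)) = os ! j)"
    using len unfolding Suc.IH [OF len] by (simp add: os less_Suc_eq all_conj_distrib nth_append cong: conj_cong)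
  finally show ?case .
qed simp

sublocale noise: product_prob_space "\<lambda>_ :: nat \<times> nat. laplace (1 / e)" UNIV
  using prob_space_laplace [of "1 / e"] e
  by (simp add: product_prob_space_def product_sigma_finite_def product_prob_space_axioms_def
      prob_space_imp_sigma_finite)

text \<open>The values of the noise that lead to a given outcome sequence form a cylinder.\<close>

definition noise_range :: "(nat \<Rightarrow> real) \<Rightarrow> nat set \<Rightarrow> nat \<Rightarrow> nat \<Rightarrow> real set" where
  "noise_range \<rho> V m l =
     (if card V < k \<or> m < l \<or> (l = m \<and> m = steps) then UNIV
      else if l < m then {..<T - real (hits \<rho> V l)} else {T - real (hits \<rho> V l)..})"

lemma noise_range_borel [simp]: "noise_range \<rho> V m l \<in> sets borel"
  by (simp add: noise_range_def)

lemma outcome_eq_iff: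
  assumes "m \<le> steps" "card V < k \<Longrightarrow> m = 0"
  shows "outcome \<rho> V Z = m \<longleftrightarrow> (\<forall>l\<le>steps. Z l \<in> noise_range \<rho> V m l)"
proof (cases "card V < k")
  case False
  then have "outcome \<rho> V Z = m \<longleftrightarrow>
      (\<forall>l<m. Z l < T - real (hits \<rho> V l)) \<and> (m < steps \<longrightarrow> T - real (hits \<rho> V m) \<le> Z m)"
    using assms by (simp add: outcome_def stop_eq_iff)
  also have "\<dots> \<longleftrightarrow> (\<forall>l\<le>steps. Z l \<in> noise_range \<rho> V m l)"
  proof (intro iffI allI impI conjI)
    fix l
    assume *: "(\<forall>l<m. Z l < T - real (hits \<rho> V l)) \<and> (m < steps \<longrightarrow> T - real (hits \<rho> V m) \<le> Z m)"
      and "l \<le> steps"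
    then show "Z l \<in> noise_range \<rho> V m l"
      using False by (cases l m rule: linorder_cases) (auto simp: noise_range_def)
  next
    fix l
    assume *: "\<forall>l\<le>steps. Z l \<in> noise_range \<rho> V m l" and "l < m"
    then show "Z l < T - real (hits \<rho> V l)"
      using False assms(1) spec [OF *, of l] by (auto simp: noise_range_def)
  next
    assume *: "\<forall>l\<le>steps. Z l \<in> noise_range \<rho> V m l" and "m < steps"
    then show "T - real (hits \<rho> V m) \<le> Z m"
      using False spec [OF *, of m] by (auto simp: noise_range_def)
  qed
  finally show ?thesis .
qed (use assms in \<open>auto simp: outcome_def noise_range_def\<close>)

lemma prod_noise_range:
  assumes "os ! j \<le> steps" "card (Q (take j os)) < k \<Longrightarrow> os ! j = 0"
  shows "(\<Prod>l\<le>steps. measure (laplace (1 / e)) (noise_range \<rho> (Q (take j os)) (os ! j) l)) =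
    K \<rho> (take j os) (os ! j)"
proof -
  have UNIV: "measure (laplace (1 / e)) UNIV = 1"
    using prob_space.prob_space [OF prob_space_laplace, of "1 / e"] e by simp
  show ?thesis
  proof (cases "card (Q (take j os)) < k")
    case True
    then show ?thesis using assms UNIV by (simp add: noise_range_def K_def)
  next
    case False
    let ?V = "Q (take j os)" and ?m = "os ! j"
    \<comment> \<open>Noise values after the stopping index are unconstrained and contribute factors
      1.\<close>
    have "(\<Prod>l\<le>steps. measure (laplace (1 / e)) (noise_range \<rho> ?V ?m l)) =
        (\<Prod>l\<in>{..?m}. measure (laplace (1 / e)) (noise_range \<rho> ?V ?m l))"
      using assms False UNIV by (intro prod.mono_neutral_right) (auto simp: noise_range_def)
    also have "{..?m} = insert ?m {..<?m}" by auto
    also have "(\<Prod>l\<in>insert ?m {..<?m}. measure (laplace (1 / e)) (noise_range \<rho> ?V ?m l)) =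
        (if ?m = steps then 1 else pass \<rho> ?V ?m) *
        (\<Prod>l<?m. measure (laplace (1 / e)) (noise_range \<rho> ?V ?m l))"
      using False UNIV by (subst prod.insert) (auto simp: noise_range_def pass_def laplace_tail_def)
    also have "(\<Prod>l<?m. measure (laplace (1 / e)) (noise_range \<rho> ?V ?m l)) = (\<Prod>l<?m. 1 - pass \<rho> ?V l)"
      using False e by (intro prod.cong) (auto simp: noise_range_def pass_def measure_laplace_below)
    finally show ?thesis
      using False by (simp add: K_def stop_prob_def mult.commute)
  qed
qed

lemma space_noise [simp]: "space noise = UNIV"
  by (simp add: space_PiM)

lemma prob_outs:
  assumes os: "os \<in> paths steps t"
  shows "{Z. outs \<rho> Z t = os} \<in> sets noise"
    and "measure noise {Z. outs \<rho> Z t = os} = path_prob (K \<rho>) os"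
proof -
  have len: "length os = t" and le: "\<And>j. j < t \<Longrightarrow> os ! j \<le> steps"
    using os by (auto simp: paths_def dest: nth_mem)
  have "{Z. outs \<rho> Z t = os} \<in> sets noise \<and>
    measure noise {Z. outs \<rho> Z t = os} = path_prob (K \<rho>) os"
  proof (cases "\<forall>j<t. card (Q (take j os)) < k \<longrightarrow> os ! j = 0")
    \<comment> \<open>A path that gives a small query a nonzero index cannot occur, and its kernel
      factor is 0 as well.\<close>
    case False
    then obtain j where j: "j < t" "card (Q (take j os)) < k" "os ! j \<noteq> 0" by auto
    then have "{Z. outs \<rho> Z t = os} = {}"
      unfolding outs_eq_iff [OF len] by (auto simp: outcome_def)
    moreover have "path_prob (K \<rho>) os = 0"
      unfolding path_prob_def using j len by (intro prod_zero) (auto simp: K_def)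
    ultimately show ?thesis by simp
  next
    case True
    let ?X = "\<lambda>(j, l). noise_range \<rho> (Q (take j os)) (os ! j) l"
    let ?J = "{..<t} \<times> {..steps}"
    have meas: "?X jl \<in> sets (laplace (1 / e))" for jl
      by (cases jl) simp
    have eq: "{Z. outs \<rho> Z t = os} = {Z \<in> space noise. \<forall>i\<in>?J. Z i \<in> ?X i}"
      unfolding outs_eq_iff [OF len] using True le by (auto simp: outcome_eq_iff)
    have "emeasure noise {Z \<in> space noise. \<forall>i\<in>?J. Z i \<in> ?X i} =
        (\<Prod>i\<in>?J. emeasure (laplace (1 / e)) (?X i))"
      by (rule noise.emeasure_PiM_Collect) (auto simp: meas)
    also have "\<dots> = ennreal (\<Prod>i\<in>?J. measure (laplace (1 / e)) (?X i))"
    proof -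
      have "emeasure (laplace (1 / e)) S = ennreal (measure (laplace (1 / e)) S)" for S
        using prob_space_laplace [of "1 / e"] e
        by (intro finite_measure.emeasure_eq_measure prob_space.finite_measure) simp
      then show ?thesis
        by (simp only:) (rule prod_ennreal, simp)
    qed
    also have "(\<Prod>i\<in>?J. measure (laplace (1 / e)) (?X i)) =
        (\<Prod>j<t. \<Prod>l\<le>steps. measure (laplace (1 / e)) (?X (j, l)))"
      by (simp add: prod.cartesian_product split_def)
    also have "\<dots> = path_prob (K \<rho>) os"
      unfolding path_prob_def len using True le by (intro prod.cong) (auto simp: prod_noise_range)
    finally have "emeasure noise {Z \<in> space noise. \<forall>i\<in>?J. Z i \<in> ?X i} = ennreal (path_prob (K \<rho>) os)" .
    then have "measure noise {Z \<in> space noise. \<forall>i\<in>?J. Z i \<in> ?X i} = path_prob (K \<rho>) os"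
      using kernel.path_prob_nonneg [OF kernel_K] by (simp add: measure_def)
    moreover have "{Z \<in> space noise. \<forall>i\<in>?J. Z i \<in> ?X i} \<in> sets noise"
      using meas by (intro sets.sets_Collect_finite_All sets_Collect_single) auto
    ultimately show ?thesis unfolding eq by blast
  qed
  then show "{Z. outs \<rho> Z t = os} \<in> sets noise"
    and "measure noise {Z. outs \<rho> Z t = os} = path_prob (K \<rho>) os" by auto
qed

lemma prob_outs_set:
  "{Z. P (outs \<rho> Z t)} \<in> sets noise"
  "measure noise {Z. P (outs \<rho> Z t)} = (\<Sum>os\<in>paths steps t. path_prob (K \<rho>) os * of_bool (P os))"
proof -
  have eq: "{Z. P (outs \<rho> Z t)} = (\<Union>os\<in>{os \<in> paths steps t. P os}. {Z. outs \<rho> Z t = os})"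
    using outs_in_paths by auto
  show "{Z. P (outs \<rho> Z t)} \<in> sets noise"
    unfolding eq by (intro sets.finite_UN) (auto intro: prob_outs)
  have "measure noise {Z. P (outs \<rho> Z t)} =
      (\<Sum>os\<in>{os \<in> paths steps t. P os}. measure noise {Z. outs \<rho> Z t = os})"
    unfolding eq by (intro noise.finite_measure_finite_Union) (auto intro: prob_outs simp: disjoint_family_on_def)
  also have "\<dots> = (\<Sum>os\<in>paths steps t. path_prob (K \<rho>) os * of_bool (P os))"
    by (simp add: prob_outs sum.If_cases [symmetric] Int_def of_bool_def if_distrib cong: if_cong)
      (intro sum.mono_neutral_cong_left; auto simp: prob_outs)
  finally show "measure noise {Z. P (outs \<rho> Z t)} =
      (\<Sum>os\<in>paths steps t. path_prob (K \<rho>) os * of_bool (P os))" .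
qed

end

section \<open>Changing one key\<close>

lemma stop_prob_pos:
  assumes "\<And>l. 0 < f l \<and> f l < 1"
  shows "0 < stop_prob f M m"
  using assms by (simp add: stop_prob_def prod_pos)

context transcript
begin

text \<open>The budget is an almost sure statement about the game. Here it becomes a property of the
  keys alone, demanded on every transcript that is possible under \<rho>, so that it can be assumed
  both of the original and of the changed keys.\<close>

definition good :: "nat \<Rightarrow> nat \<Rightarrow> (nat \<Rightarrow> real) \<Rightarrow> bool" where
  "good r t \<rho> \<longleftrightarrow> (\<forall>os\<in>paths steps t. 0 < path_prob (K \<rho>) os \<longrightarrow>
     (\<forall>i\<in>{1..n}. (\<Sum>j<t. of_bool (i \<in> fst ` bk_sketch k \<rho> (Q (take j os)))) \<le> r))"

definition full_queries :: "nat \<Rightarrow> nat list \<Rightarrow> real" where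
  "full_queries t os = (\<Sum>j<t. of_bool (k \<le> card (Q (take j os))))"

definition path_mean :: "nat \<Rightarrow> (nat \<Rightarrow> real) \<Rightarrow> (nat list \<Rightarrow> real) \<Rightarrow> real" where
  "path_mean t \<rho> g = (\<Sum>os\<in>paths steps t. path_prob (K \<rho>) os * g os)"

lemma path_prob_K_nonneg: "0 \<le> path_prob (K \<rho>) os"
  by (rule kernel.path_prob_nonneg [OF kernel_K])

lemma path_mean_nonneg: "(\<And>os. 0 \<le> g os) \<Longrightarrow> 0 \<le> path_mean t \<rho> g"
  unfolding path_mean_def by (intro sum_nonneg mult_nonneg_nonneg path_prob_K_nonneg)

lemma path_mean_mono:
  assumes "\<And>os. os \<in> paths steps t \<Longrightarrow> 0 < path_prob (K \<rho>) os \<Longrightarrow> g os \<le> h os"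
  shows "path_mean t \<rho> g \<le> path_mean t \<rho> h"
  unfolding path_mean_def
proof (intro sum_mono)
  fix os assume "os \<in> paths steps t"
  then show "path_prob (K \<rho>) os * g os \<le> path_prob (K \<rho>) os * h os"
    using assms [of os] path_prob_K_nonneg [of \<rho> os]
    by (cases "path_prob (K \<rho>) os = 0") (auto intro!: mult_left_mono)
qed

lemma path_mean_const: "path_mean t \<rho> (\<lambda>_. c) = c"
  unfolding path_mean_def
  by (simp add: sum_distrib_right [symmetric] kernel.sum_path_prob [OF kernel_K])

lemma path_mean_le:
  assumes "\<And>os. os \<in> paths steps t \<Longrightarrow> 0 < path_prob (K \<rho>) os \<Longrightarrow> g os \<le> c"
  shows "path_mean t \<rho> g \<le> c"
  using path_mean_mono [of t \<rho> g "\<lambda>_. c"] assms by (simp add: path_mean_const)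

text \<open>Double counting of pairs of a query and a key in its sketch: a full query has
  \<open>k\<close> such keys, and a key has at most \<open>r\<close> such queries. This takes the
  place of a bound on \<open>t\<close>.\<close>

lemma full_queries_bound:
  assumes "good r t \<rho>" "os \<in> paths steps t" "0 < path_prob (K \<rho>) os"
  shows "full_queries t os \<le> real (n * r) / real k"
proof -
  let ?S = "\<lambda>j. fst ` bk_sketch k \<rho> (Q (take j os))"
  have sub: "?S j \<subseteq> {1..n}" for j
    using Q_subset unfolding keys_bk_sketch by blast
  have "(\<Sum>j<t. k * of_bool (k \<le> card (Q (take j os)))) \<le> (\<Sum>j<t. card (?S j))"
    by (intro sum_mono) (simp add: card_keys_bk_sketch)
  also have "\<dots> = (\<Sum>j<t. \<Sum>i\<in>{1..n}. of_bool (i \<in> ?S j))"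
  proof (intro sum.cong refl)
    fix j
    have "{1..n} \<inter> ?S j = ?S j" using sub by blast
    then show "card (?S j) = (\<Sum>i\<in>{1..n}. of_bool (i \<in> ?S j))" by simp
  qed
  also have "\<dots> = (\<Sum>i\<in>{1..n}. \<Sum>j<t. of_bool (i \<in> ?S j))"
    by (rule sum.swap)
  also have "\<dots> \<le> (\<Sum>i\<in>{1..n}. r)"
    using assms unfolding good_def by (intro sum_mono) blast
  finally have "k * (\<Sum>j<t. of_bool (k \<le> card (Q (take j os)))) \<le> n * r"
    by (simp only: sum_distrib_left sum_constant card_atLeastAtMost) simp
  then have "real (k * (\<Sum>j<t. of_bool (k \<le> card (Q (take j os))))) \<le> real (n * r)"
    by (simp only: of_nat_le_iff)
  then have "real k * full_queries t os \<le> real (n * r)"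
    unfolding full_queries_def by (simp only: of_nat_mult of_nat_sum of_nat_of_bool)
  then show ?thesis
    using k_pos by (simp add: field_simps)
qed

text \<open>A query is active if either version of the key is in its sketch. Along one path there
  are at most \<open>r\<close> such queries for each version, hence 2 r in all, and twice the cost 4
  (q (exp e - 1))^2 per query gives the coefficient 8.\<close>

lemma key_dp:
  assumes i: "i \<in> {1..n}"
    and good: "good r t \<rho>" "good r t (\<rho>(i := y))"
    and q: "0 < q" "real q * (exp e - 1) \<le> 1 / 4"
    and B: "0 \<le> B"
    and g: "\<And>os. 0 \<le> g os"
      "\<And>os. os \<in> paths steps t \<Longrightarrow> 0 < path_prob (K \<rho>) os \<Longrightarrow> g os \<le> B"
  shows "path_mean t \<rho> g \<le> exp \<epsilon> * path_mean t (\<rho>(i := y)) g +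
    exp (8 * (real q * (exp e - 1))\<^sup>2 * real r - \<epsilon> * (real q - 1)) * B"
proof -
  let ?\<rho>' = "\<rho>(i := y)" and ?\<kappa> = "4 * (real q * (exp e - 1))\<^sup>2"
  let ?s = "\<lambda>\<rho> os. i \<in> fst ` bk_sketch k \<rho> (Q os)"
  let ?act = "\<lambda>os. ?s \<rho> os \<or> ?s ?\<rho>' os"
  interpret kernel_pair steps "K \<rho>" "K ?\<rho>'" q ?act ?\<kappa>
  proof (intro kernel_pair.intro kernel_K kernel_pair_axioms.intro)
    fix os x
    show "K ?\<rho>' os x = 0 \<Longrightarrow> K \<rho> os x = 0"
      using stop_prob_pos [of "pass ?\<rho>' (Q os)" steps x] pass_strict
      by (auto simp: K_def split: if_splits)
    show "(\<Sum>x\<le>steps. K ?\<rho>' os x * (K \<rho> os x / K ?\<rho>' os x) ^ q) \<le> exp (?\<kappa> * of_bool (?act os))"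
    proof (cases "card (Q os) < k \<or> \<not> ?act os")
      case True
      have "K \<rho> os = K ?\<rho>' os"
      proof (cases "card (Q os) < k")
        case False
        then have "pass \<rho> (Q os) = pass ?\<rho>' (Q os)"
          using True by (intro ext pass_update_irrelevant) auto
        then show ?thesis by (intro ext) (simp add: K_def)
      qed (simp add: K_def fun_eq_iff)
      then have "(\<Sum>x\<le>steps. K ?\<rho>' os x * (K \<rho> os x / K ?\<rho>' os x) ^ q) = (\<Sum>x\<le>steps. K ?\<rho>' os x)"
        by (intro sum.cong) auto
      also have "\<dots> = 1"
        by (rule kernel.kernel_sum [OF kernel_K])
      finally show ?thesis by simp
    next
      case False
      have "(\<Sum>x\<le>steps. K ?\<rho>' os x * (K \<rho> os x / K ?\<rho>' os x) ^ q) \<le> 1 + ?\<kappa>"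
        using False q pass_strict unfolding K_def
        by (simp, intro stop_prob_renyi pass_update_close) (auto simp: less_imp_le)
      also have "\<dots> \<le> exp ?\<kappa>"
        by (rule exp_ge_add_one_self)
      finally show ?thesis using False by simp
    qed
  qed (use q in auto)
  have "path_mean t \<rho> g \<le> exp \<epsilon> * path_mean t ?\<rho>' g + exp (?\<kappa> * (2 * real r) - \<epsilon> * (real q - 1)) * B"
    unfolding path_mean_def
  proof (rule approximate_dp)
    fix os assume os: "os \<in> paths steps t" and pos: "0 < path_prob (K \<rho>) os"
    \<comment> \<open>Absolute continuity makes the path possible for the changed keys too, so their
      budget applies to it.\<close>
    have "0 < path_prob (K ?\<rho>') os"
      using path_abs_cont [of os] pos path_prob_K_nonneg [of ?\<rho>' os] by linarith
    then have "(\<Sum>j<t. of_bool (?s \<rho> (take j os))) \<le> r" "(\<Sum>j<t. of_bool (?s ?\<rho>' (take j os))) \<le> r"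
      using good os pos i unfolding good_def by blast+
    moreover have "(\<Sum>j<t. of_bool (?act (take j os))) \<le>
        (\<Sum>j<t. of_bool (?s \<rho> (take j os))) + (\<Sum>j<t. of_bool (?s ?\<rho>' (take j os)) :: nat)"
      unfolding sum.distrib [symmetric] by (intro sum_mono) auto
    ultimately have "(\<Sum>j<t. of_bool (?act (take j os))) \<le> 2 * r" by linarith
    then have "real (\<Sum>j<t. of_bool (?act (take j os))) \<le> real (2 * r)"
      by (simp only: of_nat_le_iff)
    then show "(\<Sum>j<t. of_bool (?act (take j os))) \<le> 2 * real r"
      by (simp only: of_nat_sum of_nat_of_bool of_nat_mult of_nat_numeral)
  qed (use g B in auto)
  then show ?thesis by (simp add: mult_ac)
qed

end

section \<open>Resampling one uniform key\<close>

abbreviation unif :: "real measure" where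
  "unif \<equiv> uniform_measure lborel {0..1}"

lemma prob_space_unif: "prob_space unif"
  by (rule prob_space_uniform_measure) auto

lemma measure_unif_below: "0 \<le> \<tau> \<Longrightarrow> \<tau> \<le> 1 \<Longrightarrow> measure unif {..<\<tau>} = \<tau>"
proof -
  assume \<tau>: "0 \<le> \<tau>" "\<tau> \<le> 1"
  have "{0..1} \<inter> {..<\<tau>} = {0..<\<tau>}" using \<tau> by auto
  then show ?thesis using \<tau> by (simp add: measure_uniform_measure)
qed

lemma measure_unif_above: "0 \<le> \<tau> \<Longrightarrow> \<tau> \<le> 1 \<Longrightarrow> measure unif {\<tau>..} = 1 - \<tau>"
proof -
  assume \<tau>: "0 \<le> \<tau>" "\<tau> \<le> 1"
  have "{0..1} \<inter> {\<tau>..} = {\<tau>..1}" using \<tau> by auto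
  then show ?thesis using \<tau> by (simp add: measure_uniform_measure)
qed

lemma integrable_bounded:
  fixes f :: "'a \<Rightarrow> real"
  assumes "prob_space M" "f \<in> borel_measurable M" "\<And>x. x \<in> space M \<Longrightarrow> \<bar>f x\<bar> \<le> C"
  shows "integrable M f"
proof -
  interpret prob_space M by fact
  show ?thesis using assms by (intro integrable_const_bound [of _ C]) auto
qed

text \<open>Draw coordinate \<open>i\<close> twice, as x in \<open>S\<close> and independently as y
  in \<open>S'\<close>, share the other coordinates, and integrate \<open>step\<close>. The left
  side does not involve y and acquires the probability of \<open>S'\<close>; the right side does not
  involve x and acquires that of \<open>S\<close>.\<close>

lemma resample_coordinate:
  fixes G :: "(nat \<Rightarrow> real) \<Rightarrow> real" and I :: "nat set" and P :: "real measure"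
  assumes P: "prob_space P"
    and I: "finite I" "i \<in> I"
    and G [measurable]: "G \<in> borel_measurable (\<Pi>\<^sub>M i\<in>I. P)"
    and bound: "\<And>\<rho>. 0 \<le> G \<rho> \<and> G \<rho> \<le> C"
    and S [measurable]: "S \<in> sets P" "S' \<in> sets P"
    and meas [measurable]: "Measurable.pred (\<Pi>\<^sub>M i\<in>I. P) gd"
    and gd: "AE \<rho> in (\<Pi>\<^sub>M i\<in>I. P). gd \<rho>"
    and step: "\<And>\<rho> y. gd \<rho> \<Longrightarrow> gd (\<rho>(i := y)) \<Longrightarrow> G \<rho> \<le> c * G (\<rho>(i := y)) + d"
    and cd: "0 \<le> c" "0 \<le> d"
  shows "measure P S' * (\<integral>\<rho>. indicator S (\<rho> i) * G \<rho> \<partial>(\<Pi>\<^sub>M i\<in>I. P)) \<le>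
    c * measure P S * (\<integral>\<rho>. indicator S' (\<rho> i) * G \<rho> \<partial>(\<Pi>\<^sub>M i\<in>I. P)) + d * measure P S * measure P S'"
proof -
  define J where "J = I - {i}"
  have J: "finite J" "i \<notin> J" and IJ: "I = insert i J"
    using I by (auto simp: J_def)
  interpret Pr: prob_space P by fact
  interpret pp: product_prob_space "\<lambda>_::nat. P" UNIV
    by unfold_locales
  interpret PJ: prob_space "\<Pi>\<^sub>M i\<in>J. P" by (intro prob_space_PiM P)
  have upd [measurable]: "(\<lambda>(\<sigma>, x). \<sigma>(i := x)) \<in> measurable ((\<Pi>\<^sub>M i\<in>J. P) \<Otimes>\<^sub>M P) (\<Pi>\<^sub>M i\<in>I. P)"
    unfolding IJ split_def by measurable
  have upd' [measurable]: "(\<lambda>x. \<sigma>(i := x)) \<in> measurable P (\<Pi>\<^sub>M i\<in>I. P)" if "\<sigma> \<in> space (\<Pi>\<^sub>M i\<in>J. P)" for \<sigma>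
    using measurable_compose [OF measurable_Pair1' [OF that] upd] by simp
  let ?F = "\<lambda>S \<rho>. indicator S (\<rho> i) * G \<rho>"
  have comp [measurable]: "(\<lambda>\<rho>. \<rho> i) \<in> measurable (\<Pi>\<^sub>M i\<in>I. P) P"
    using I by measurable
  have F_meas [measurable]: "?F S \<in> borel_measurable (\<Pi>\<^sub>M i\<in>I. P)" if [measurable]: "S \<in> sets P" for S
    by measurable
  have C: "0 \<le> C" using bound [of undefined] by linarith
  have F_bound: "\<bar>indicator S x * G \<rho>\<bar> \<le> C" "0 \<le> indicator S x * G \<rho>" "indicator S x * G \<rho> \<le> C"
    for S :: "real set" and x \<rho>
    using bound [of \<rho>] C by (auto simp: indicator_def)
  have ind_int: "integrable P (indicat_real S)" if "S \<in> sets P" for S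
    using that by (intro integrable_bounded [OF P, where C = 1]) (auto simp: indicator_def)
  define u where "u S \<sigma> = (\<integral>x. ?F S (\<sigma>(i := x)) \<partial>P)" for S \<sigma>
  have u_meas [measurable]: "u S \<in> borel_measurable (\<Pi>\<^sub>M i\<in>J. P)" if [measurable]: "S \<in> sets P" for S
  proof -
    have "(\<lambda>(\<sigma>, x). ?F S (\<sigma>(i := x))) \<in> borel_measurable ((\<Pi>\<^sub>M i\<in>J. P) \<Otimes>\<^sub>M P)"
      using measurable_compose [OF upd F_meas [OF that]] by (simp add: split_def)
    then show ?thesis unfolding u_def by (rule Pr.borel_measurable_lebesgue_integral)
  qed
  have F_int: "integrable P (\<lambda>x. ?F S (\<sigma>(i := x)))"
    if "S \<in> sets P" "\<sigma> \<in> space (\<Pi>\<^sub>M i\<in>J. P)" for S \<sigma>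
    by (rule integrable_bounded [OF P, where C = C], rule measurable_compose [OF upd' F_meas])
       (rule that F_bound)+
  have u_bound: "\<bar>u S \<sigma>\<bar> \<le> C" if "S \<in> sets P" "\<sigma> \<in> space (\<Pi>\<^sub>M i\<in>J. P)" for S \<sigma>
  proof -
    have "0 \<le> u S \<sigma>"
      unfolding u_def by (intro integral_nonneg_AE AE_I2 F_bound)
    moreover have "u S \<sigma> \<le> C"
      unfolding u_def by (intro Pr.integral_le_const F_int that AE_I2 F_bound)
    ultimately show ?thesis by simp
  qed
  have u_int: "integrable (\<Pi>\<^sub>M i\<in>J. P) (u S)" if "S \<in> sets P" for S
    using u_bound that by (intro integrable_bounded [where C = C] PJ.prob_space_axioms) auto
  have int_F: "(\<integral>\<rho>. ?F S \<rho> \<partial>(\<Pi>\<^sub>M i\<in>I. P)) = (\<integral>\<sigma>. u S \<sigma> \<partial>(\<Pi>\<^sub>M i\<in>J. P))"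
    if "S \<in> sets P" for S
    unfolding u_def IJ
    by (rule pp.product_integral_insert [OF J])
       (use F_meas [OF that] F_bound in \<open>auto intro!: integrable_bounded [where C = C] prob_space_PiM P simp flip: IJ\<close>)
  \<comment> \<open>A null set has null sections almost everywhere. This makes \<open>gd\<close>
    available at both draws of the coordinate once the others are fixed.\<close>
  have "AE \<sigma> in (\<Pi>\<^sub>M i\<in>J. P). AE x in P. gd (\<sigma>(i := x))"
  proof -
    let ?b = "\<lambda>\<rho>. indicator {\<rho> \<in> space (\<Pi>\<^sub>M i\<in>I. P). \<not> gd \<rho>} \<rho> :: ennreal"
    have b [measurable]: "?b \<in> borel_measurable (\<Pi>\<^sub>M i\<in>I. P)" by measurable
    have b2: "(\<lambda>(\<sigma>, x). ?b (\<sigma>(i := x))) \<in> borel_measurable ((\<Pi>\<^sub>M i\<in>J. P) \<Otimes>\<^sub>M P)"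
      using measurable_compose [OF upd b] by (simp add: split_def)
    have "0 = (\<integral>\<^sup>+\<rho>. ?b \<rho> \<partial>(\<Pi>\<^sub>M i\<in>I. P))"
      by (rule sym, subst nn_integral_0_iff_AE) (use gd in \<open>auto simp: indicator_def elim!: eventually_mono\<close>)
    also have "\<dots> = (\<integral>\<^sup>+\<sigma>. \<integral>\<^sup>+x. ?b (\<sigma>(i := x)) \<partial>P \<partial>(\<Pi>\<^sub>M i\<in>J. P))"
      using b unfolding IJ by (intro pp.product_nn_integral_insert [OF J])
    finally have "AE \<sigma> in (\<Pi>\<^sub>M i\<in>J. P). (\<integral>\<^sup>+x. ?b (\<sigma>(i := x)) \<partial>P) = 0"
      using Pr.borel_measurable_nn_integral [OF b2] by (simp add: nn_integral_0_iff_AE)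
    with AE_space show ?thesis
    proof eventually_elim
      case (elim \<sigma>)
      note \<sigma> = elim(1)
      have "(\<integral>\<^sup>+x. ?b (\<sigma>(i := x)) \<partial>P) = 0" by (rule elim(2))
      then have "AE x in P. ?b (\<sigma>(i := x)) = 0"
        using measurable_compose [OF upd' [OF \<sigma>] b] by (simp add: nn_integral_0_iff_AE)
      then show "AE x in P. gd (\<sigma>(i := x))"
      proof (rule AE_mp, intro AE_I2 impI)
        fix x assume "x \<in> space P" "?b (\<sigma>(i := x)) = 0"
        then show "gd (\<sigma>(i := x))"
          using measurable_space [OF upd' [OF \<sigma>], of x] by (auto simp: indicator_def split: if_splits)
      qed
    qed
  qed
  then have "AE \<sigma> in (\<Pi>\<^sub>M i\<in>J. P). measure P S' * u S \<sigma> \<le> c * measure P S * u S' \<sigma> + d * measure P S * measure P S'"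
  proof (rule AE_mp, intro AE_I2 impI)
    fix \<sigma> assume \<sigma>: "\<sigma> \<in> space (\<Pi>\<^sub>M i\<in>J. P)" and gd\<sigma>: "AE x in P. gd (\<sigma>(i := x))"
    have x: "measure P S' * ?F S (\<sigma>(i := x)) \<le> c * indicator S x * u S' \<sigma> + d * indicator S x * measure P S'"
      if gx: "gd (\<sigma>(i := x))" for x
    proof -
      have "(\<integral>y. indicator S' y * ?F S (\<sigma>(i := x)) \<partial>P) \<le>
          (\<integral>y. c * indicator S x * ?F S' (\<sigma>(i := y)) + d * indicator S x * indicator S' y \<partial>P)"
      proof (rule integral_mono_AE)
        show "AE y in P. indicator S' y * ?F S (\<sigma>(i := x)) \<le>
            c * indicator S x * ?F S' (\<sigma>(i := y)) + d * indicator S x * indicator S' y"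
          using gd\<sigma>
        proof (rule AE_mp, intro AE_I2 impI)
          fix y assume "gd (\<sigma>(i := y))"
          then have "G (\<sigma>(i := x)) \<le> c * G (\<sigma>(i := y)) + d"
            using step [OF gx, of y] by simp
          then show "indicator S' y * ?F S (\<sigma>(i := x)) \<le>
            c * indicator S x * ?F S' (\<sigma>(i := y)) + d * indicator S x * indicator S' y"
            by (simp add: indicator_def)
        qed
      qed (use S ind_int F_int [OF _ \<sigma>] in
          \<open>auto intro!: Bochner_Integration.integrable_add simp: mult.assoc\<close>)
      also have "\<dots> = c * indicator S x * u S' \<sigma> + d * indicator S x * measure P S'"
        by (subst Bochner_Integration.integral_add)
           (use S ind_int F_int [OF _ \<sigma>] in \<open>auto simp: mult.assoc u_def\<close>)
      finally show ?thesis
        using S by simp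
    qed
    have "measure P S' * u S \<sigma> = (\<integral>x. measure P S' * ?F S (\<sigma>(i := x)) \<partial>P)"
      by (simp add: u_def)
    also have "\<dots> \<le> (\<integral>x. c * u S' \<sigma> * indicator S x + d * measure P S' * indicator S x \<partial>P)"
    proof (rule integral_mono_AE)
      show "AE x in P. measure P S' * ?F S (\<sigma>(i := x)) \<le>
          c * u S' \<sigma> * indicator S x + d * measure P S' * indicator S x"
        using gd\<sigma> by eventually_elim (drule x, simp add: mult_ac)
    qed (use S ind_int F_int [OF _ \<sigma>] in \<open>auto intro!: Bochner_Integration.integrable_add\<close>)
    also have "\<dots> = c * measure P S * u S' \<sigma> + d * measure P S * measure P S'"
      by (subst Bochner_Integration.integral_add) (use S ind_int in auto)
    finally show "measure P S' * u S \<sigma> \<le> c * measure P S * u S' \<sigma> + d * measure P S * measure P S'" .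
  qed
  then have "(\<integral>\<sigma>. measure P S' * u S \<sigma> \<partial>(\<Pi>\<^sub>M i\<in>J. P)) \<le>
      (\<integral>\<sigma>. c * measure P S * u S' \<sigma> + d * measure P S * measure P S' \<partial>(\<Pi>\<^sub>M i\<in>J. P))"
    using S by (intro integral_mono_AE) (auto intro!: u_int Bochner_Integration.integrable_add)
  then show ?thesis
    using S by (simp add: u_int int_F PJ.prob_space)
qed

section \<open>Detailed balance for the number of small keys\<close>

lemma geometric_recurrence:
  fixes a :: "nat \<Rightarrow> real"
  assumes "\<And>d. d < N \<Longrightarrow> a (Suc d) \<le> x * a d + y" and "0 \<le> x" "x < 1" "0 \<le> y" and "d \<le> N"
  shows "a d \<le> x ^ d * a 0 + y / (1 - x)"
  using \<open>d \<le> N\<close>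
proof (induction d)
  case 0
  then show ?case using assms by simp
next
  case (Suc d)
  have "a (Suc d) \<le> x * a d + y"
    using Suc.prems by (intro assms) simp
  also have "\<dots> \<le> x * (x ^ d * a 0 + y / (1 - x)) + y"
    using Suc assms by (intro add_right_mono mult_left_mono) auto
  also have "\<dots> = x ^ Suc d * a 0 + y / (1 - x)"
    using assms by (simp add: field_simps)
  finally show ?case .
qed

lemma pred_precedes:
  fixes f g :: "'a \<Rightarrow> real"
  assumes [measurable]: "f \<in> borel_measurable M" "g \<in> borel_measurable M"
  shows "Measurable.pred M (\<lambda>x. f x < g x \<or> f x = g x \<and> c)"
  by measurable

section \<open>Measurability in the keys\<close>

context estimator
begin

abbreviation keysM :: "(nat \<Rightarrow> real) measure" where
  "keysM \<equiv> \<Pi>\<^sub>M i\<in>{1..n}. unif"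

text \<open>Without the cap at \<open>k\<close> that \<open>hits\<close> has: detailed balance
  concerns the true number of small keys.\<close>

definition cnt :: "(nat \<Rightarrow> real) \<Rightarrow> nat set \<Rightarrow> nat \<Rightarrow> nat" where
  "cnt \<rho> V l = card {i \<in> V. \<rho> i < tau l}"

lemma measurable_card_Collect:
  assumes "finite V" "\<And>i. i \<in> V \<Longrightarrow> Measurable.pred M (P i)"
  shows "(\<lambda>\<rho>. card {i \<in> V. P i \<rho>}) \<in> measurable M (count_space UNIV)"
proof -
  have "(\<lambda>\<rho>. \<Sum>i\<in>V. if P i \<rho> then 1 else 0 :: nat) \<in> measurable M (count_space UNIV)"
    by (intro measurable_sum_nat measurable_If) (use assms(2) in \<open>auto simp: pred_def\<close>)
  moreover have "card {i \<in> V. P i \<rho>} = (\<Sum>i\<in>V. if P i \<rho> then 1 else 0)" for \<rho>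
    using assms by (simp add: sum.If_cases Int_def)
  ultimately show ?thesis by simp
qed

lemma key_measurable:
  assumes "i \<in> {1..n}"
  shows "(\<lambda>\<rho>. \<rho> i) \<in> borel_measurable keysM"
proof -
  have "measurable keysM unif = borel_measurable keysM"
    by (rule measurable_cong_sets) simp_all
  then show ?thesis
    using measurable_component_singleton [OF assms, of "\<lambda>_. unif"] by simp
qed

lemma pred_key_below [measurable]:
  assumes "i \<in> {1..n}"
  shows "Measurable.pred keysM (\<lambda>\<rho>. \<rho> i < c)"
proof -
  have [measurable]: "(\<lambda>\<rho>. \<rho> i) \<in> borel_measurable keysM"
    by (rule key_measurable [OF assms])
  show ?thesis by measurable
qed

lemma cnt_measurable [measurable]:
  assumes "V \<subseteq> {1..n}"
  shows "(\<lambda>\<rho>. cnt \<rho> V l) \<in> measurable keysM (count_space UNIV)"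
  unfolding cnt_def
  by (rule measurable_card_Collect) (use assms finite_subset in \<open>auto intro!: pred_key_below\<close>)

lemma pass_measurable [measurable]:
  assumes "V \<subseteq> {1..n}"
  shows "(\<lambda>\<rho>. pass \<rho> V l) \<in> borel_measurable keysM"
proof -
  have "(\<lambda>c. laplace_tail (1 / e) (T - real (min k c))) \<in> borel_measurable (count_space UNIV)"
    by simp
  from measurable_compose [OF cnt_measurable [OF assms] this] show ?thesis
    by (simp add: pass_def hits_def cnt_def)
qed

lemma pred_in_sketch [measurable]:
  assumes "V \<subseteq> {1..n}"
  shows "Measurable.pred keysM (\<lambda>\<rho>. i \<in> fst ` bk_sketch k \<rho> V)"
proof (cases "i \<in> V")
  case True
  have "(\<lambda>\<rho>. key_rank \<rho> V i) \<in> measurable keysM (count_space UNIV)"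
    unfolding key_rank_def
  proof (rule measurable_card_Collect)
    fix j assume "j \<in> V"
    then show "Measurable.pred keysM (\<lambda>\<rho>. \<rho> j < \<rho> i \<or> \<rho> j = \<rho> i \<and> j < i)"
      using True assms by (intro pred_precedes key_measurable) auto
  qed (use assms finite_subset in auto)
  then have "Measurable.pred keysM (\<lambda>\<rho>. key_rank \<rho> V i < k)"
    by measurable
  then show ?thesis using True unfolding in_keys_bk_sketch by simp
qed (unfold in_keys_bk_sketch, simp)

end

context transcript
begin

lemma K_measurable [measurable]: "(\<lambda>\<rho>. K \<rho> os x) \<in> borel_measurable keysM"
proof (cases "card (Q os) < k")
  case False
  have [measurable]: "(\<lambda>\<rho>. pass \<rho> (Q os) l) \<in> borel_measurable keysM" for l
    by (rule pass_measurable [OF Q_subset])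
  show ?thesis
    unfolding K_def stop_prob_def by measurable
qed (simp add: K_def)

lemma path_prob_measurable [measurable]: "(\<lambda>\<rho>. path_prob (K \<rho>) os) \<in> borel_measurable keysM"
  unfolding path_prob_def by measurable

lemma good_measurable [measurable]: "Measurable.pred keysM (good r t)"
proof -
  have [measurable]: "Measurable.pred keysM (\<lambda>\<rho>. i \<in> fst ` bk_sketch k \<rho> (Q os))" for i os
    by (rule pred_in_sketch [OF Q_subset])
  have "(\<lambda>\<rho>. \<Sum>j<t. if i \<in> fst ` bk_sketch k \<rho> (Q (take j os)) then 1 else 0 :: nat) \<in>
      measurable keysM (count_space UNIV)" for i os
    by measurable
  then have [measurable]: "(\<lambda>\<rho>. \<Sum>j<t. of_bool (i \<in> fst ` bk_sketch k \<rho> (Q (take j os))) :: nat) \<in>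
      measurable keysM (count_space UNIV)" for i os
    by (simp only: of_bool_def)
  show ?thesis
    unfolding good_def by measurable
qed

text \<open>Occupation measure of the birth-death chain, integrated against the weight
  \<open>w\<close>: the visits are the queries of size \<open>m\<close>, and the state is the number
  of their keys below \<open>tau l\<close>.\<close>

definition occupation :: "nat \<Rightarrow> nat \<Rightarrow> nat \<Rightarrow> (nat \<Rightarrow> real) \<Rightarrow> (nat \<Rightarrow> real) \<Rightarrow> nat list \<Rightarrow> real" where
  "occupation t m l w \<rho> os =
     (\<Sum>j<t. of_bool (card (Q (take j os)) = m) * w (cnt \<rho> (Q (take j os)) l))"

definition occ_mean :: "nat \<Rightarrow> nat \<Rightarrow> nat \<Rightarrow> (nat \<Rightarrow> real) \<Rightarrow> real" where
  "occ_mean t m l w = (\<integral>\<rho>. path_mean t \<rho> (occupation t m l w \<rho>) \<partial>keysM)"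

lemma prob_space_keysM: "prob_space keysM"
  by (intro prob_space_PiM prob_space_unif)

lemma cnt_le_card: "cnt \<rho> (Q os) l \<le> card (Q os)"
  unfolding cnt_def by (intro card_mono) auto

lemma path_mean_occupation_measurable:
  "(\<lambda>\<rho>. path_mean t \<rho> (occupation t m l w \<rho>)) \<in> borel_measurable keysM"
proof -
  have "(\<lambda>\<rho>. w (cnt \<rho> (Q os) l)) \<in> borel_measurable keysM" for os
    by (rule measurable_compose [OF cnt_measurable [OF Q_subset]]) simp
  then show ?thesis
    unfolding path_mean_def occupation_def by measurable
qed

lemma path_mean_occupation_bound:
  "\<bar>path_mean t \<rho> (occupation t m l w \<rho>)\<bar> \<le> real t * (\<Sum>c\<le>n. \<bar>w c\<bar>)"
proof -
  have w: "\<bar>w (cnt \<rho> (Q os) l)\<bar> \<le> (\<Sum>c\<le>n. \<bar>w c\<bar>)" for os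
    using order_trans [OF cnt_le_card card_Q_le] by (intro member_le_sum) auto
  have "\<bar>occupation t m l w \<rho> os\<bar> \<le> (\<Sum>j<t. \<Sum>c\<le>n. \<bar>w c\<bar>)" for os
    unfolding occupation_def
    by (rule order_trans [OF sum_abs], intro sum_mono)
       (use w order_trans [OF abs_ge_zero w] in auto)
  then have occ: "\<bar>occupation t m l w \<rho> os\<bar> \<le> real t * (\<Sum>c\<le>n. \<bar>w c\<bar>)" for os
    by simp
  have "\<bar>path_mean t \<rho> (occupation t m l w \<rho>)\<bar> \<le> path_mean t \<rho> (\<lambda>os. \<bar>occupation t m l w \<rho> os\<bar>)"
    unfolding path_mean_def
    by (rule order_trans [OF sum_abs]) (simp add: abs_mult path_prob_K_nonneg)
  also have "\<dots> \<le> real t * (\<Sum>c\<le>n. \<bar>w c\<bar>)"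
    by (intro path_mean_le occ)
  finally show ?thesis .
qed

lemma integrable_occupation: "integrable keysM (\<lambda>\<rho>. path_mean t \<rho> (occupation t m l w \<rho>))"
  by (rule integrable_bounded [OF prob_space_keysM path_mean_occupation_measurable path_mean_occupation_bound])

lemma occ_mean_mono:
  assumes "\<And>c. c \<le> m \<Longrightarrow> w c \<le> w' c"
  shows "occ_mean t m l w \<le> occ_mean t m l w'"
  unfolding occ_mean_def
proof (intro integral_mono integrable_occupation path_mean_mono)
  fix \<rho> os
  show "occupation t m l w \<rho> os \<le> occupation t m l w' \<rho> os"
    unfolding occupation_def by (intro sum_mono) (auto intro!: assms simp: cnt_le_card)
qed

lemma occ_mean_cmult: "occ_mean t m l (\<lambda>x. c * w x) = c * occ_mean t m l w"
proof -
  have "path_mean t \<rho> (occupation t m l (\<lambda>x. c * w x) \<rho>) = c * path_mean t \<rho> (occupation t m l w \<rho>)" for \<rho>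
    unfolding path_mean_def occupation_def sum_distrib_left by (simp add: mult_ac)
  then show ?thesis by (simp add: occ_mean_def)
qed

lemma occ_mean_nonneg:
  assumes "\<And>c. 0 \<le> w c"
  shows "0 \<le> occ_mean t m l w"
  unfolding occ_mean_def path_mean_def occupation_def
  by (intro integral_nonneg_AE AE_I2 sum_nonneg mult_nonneg_nonneg path_prob_K_nonneg) (auto simp: assms)

text \<open>As a function of the path this does not involve the value of key \<open>i\<close>, see
  \<open>others_update\<close>; only the law of the path does. Privacy can therefore be applied with
  the functional kept fixed while the key is replaced.\<close>

definition others :: "nat \<Rightarrow> nat \<Rightarrow> nat \<Rightarrow> nat \<Rightarrow> (nat \<Rightarrow> bool) \<Rightarrow> (nat \<Rightarrow> real) \<Rightarrow> nat list \<Rightarrow> real" where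
  "others t m l i R \<rho> os = (\<Sum>j<t. of_bool (card (Q (take j os)) = m) *
     of_bool (i \<in> Q (take j os) \<and> R (cnt \<rho> (Q (take j os) - {i}) l)))"

lemma others_update: "others t m l i R (\<rho>(i := y)) = others t m l i R \<rho>"
proof -
  have "cnt (\<rho>(i := y)) (V - {i}) l = cnt \<rho> (V - {i}) l" for V
    unfolding cnt_def by (intro arg_cong [where f = card]) auto
  then show ?thesis by (simp add: others_def fun_eq_iff)
qed

text \<open>The death rate of the chain: with c = \<open>cnt \<rho> V l\<close>, each of the c small
  keys sees c - 1 other small ones. For c = 0 the truncated subtraction is harmless because of the
  factor c.\<close>

lemma sum_others_below:
  assumes "V \<subseteq> {1..n}"
  shows "(\<Sum>i\<in>{1..n}. indicator {..<tau l} (\<rho> i) * of_bool (i \<in> V \<and> R (cnt \<rho> (V - {i}) l))) =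
    (real (cnt \<rho> V l) * of_bool (R (cnt \<rho> V l - 1)) :: real)"
proof -
  have V: "finite V" using assms finite_subset by blast
  have "(\<Sum>i\<in>{1..n}. indicator {..<tau l} (\<rho> i) * of_bool (i \<in> V \<and> R (cnt \<rho> (V - {i}) l))) =
      (\<Sum>i\<in>{i \<in> V. \<rho> i < tau l}. of_bool (R (cnt \<rho> V l - 1)) :: real)"
  proof (rule sum.mono_neutral_cong_right)
    fix i assume "i \<in> {i \<in> V. \<rho> i < tau l}"
    then show "indicator {..<tau l} (\<rho> i) * of_bool (i \<in> V \<and> R (cnt \<rho> (V - {i}) l)) =
        (of_bool (R (cnt \<rho> V l - 1)) :: real)"
      using card_below_remove [OF V, of \<rho> "tau l" i] by (simp add: cnt_def)
  qed (use assms in \<open>auto simp: indicator_def\<close>)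
  then show ?thesis by (simp add: cnt_def)
qed

text \<open>The birth rate of the chain: each of the remaining keys sees all the small ones.\<close>

lemma sum_others_above:
  assumes "V \<subseteq> {1..n}"
  shows "(\<Sum>i\<in>{1..n}. indicator {tau l..} (\<rho> i) * of_bool (i \<in> V \<and> R (cnt \<rho> (V - {i}) l))) =
    ((real (card V) - real (cnt \<rho> V l)) * of_bool (R (cnt \<rho> V l)) :: real)"
proof -
  have V: "finite V" using assms finite_subset by blast
  have "(\<Sum>i\<in>{1..n}. indicator {tau l..} (\<rho> i) * of_bool (i \<in> V \<and> R (cnt \<rho> (V - {i}) l))) =
      (\<Sum>i\<in>V - {i \<in> V. \<rho> i < tau l}. of_bool (R (cnt \<rho> V l)) :: real)"
  proof (rule sum.mono_neutral_cong_right)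
    fix i assume "i \<in> V - {i \<in> V. \<rho> i < tau l}"
    then show "indicator {tau l..} (\<rho> i) * of_bool (i \<in> V \<and> R (cnt \<rho> (V - {i}) l)) =
        (of_bool (R (cnt \<rho> V l)) :: real)"
      using card_below_remove [OF V, of \<rho> "tau l" i] by (auto simp: cnt_def indicator_def)
  qed (use assms in \<open>auto simp: indicator_def\<close>)
  also have "\<dots> = real (card (V - {i \<in> V. \<rho> i < tau l})) * of_bool (R (cnt \<rho> V l))"
    by simp
  also have "card (V - {i \<in> V. \<rho> i < tau l}) = card V - cnt \<rho> V l"
    unfolding cnt_def by (rule card_Diff_subset) (use V in auto)
  also have "real (card V - cnt \<rho> V l) = real (card V) - real (cnt \<rho> V l)"
    unfolding cnt_def using V by (intro of_nat_diff card_mono) auto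
  finally show ?thesis .
qed

lemma sum_path_mean_others:
  assumes "\<And>V. V \<subseteq> {1..n} \<Longrightarrow> card V = m \<Longrightarrow>
     (\<Sum>i\<in>{1..n}. s i * of_bool (i \<in> V \<and> R (cnt \<rho> (V - {i}) l))) = w (cnt \<rho> V l)"
  shows "(\<Sum>i\<in>{1..n}. s i * path_mean t \<rho> (others t m l i R \<rho>)) = path_mean t \<rho> (occupation t m l w \<rho>)"
proof -
  have "(\<Sum>i\<in>{1..n}. s i * path_mean t \<rho> (others t m l i R \<rho>)) =
      (\<Sum>i\<in>{1..n}. \<Sum>os\<in>paths steps t. path_prob (K \<rho>) os * (s i * others t m l i R \<rho> os))"
    unfolding path_mean_def sum_distrib_left by (simp add: mult_ac)
  also have "\<dots> = path_mean t \<rho> (\<lambda>os. \<Sum>i\<in>{1..n}. s i * others t m l i R \<rho> os)"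
    unfolding path_mean_def by (subst sum.swap) (simp add: sum_distrib_left)
  also have "(\<lambda>os. \<Sum>i\<in>{1..n}. s i * others t m l i R \<rho> os) = occupation t m l w \<rho>"
  proof
    fix os
    have "(\<Sum>i\<in>{1..n}. s i * others t m l i R \<rho> os) =
        (\<Sum>i\<in>{1..n}. \<Sum>j<t. of_bool (card (Q (take j os)) = m) *
          (s i * of_bool (i \<in> Q (take j os) \<and> R (cnt \<rho> (Q (take j os) - {i}) l))))"
      unfolding others_def sum_distrib_left by (intro sum.cong refl) (simp only: mult_ac)
    also have "\<dots> = (\<Sum>j<t. of_bool (card (Q (take j os)) = m) *
        (\<Sum>i\<in>{1..n}. s i * of_bool (i \<in> Q (take j os) \<and> R (cnt \<rho> (Q (take j os) - {i}) l))))"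
      by (subst sum.swap) (simp only: sum_distrib_left)
    also have "\<dots> = occupation t m l w \<rho> os"
      unfolding occupation_def
    proof (intro sum.cong refl)
      fix j
      show "of_bool (card (Q (take j os)) = m) *
        (\<Sum>i\<in>{1..n}. s i * of_bool (i \<in> Q (take j os) \<and> R (cnt \<rho> (Q (take j os) - {i}) l))) =
        of_bool (card (Q (take j os)) = m) * w (cnt \<rho> (Q (take j os)) l)"
        using assms [OF Q_subset, of "take j os"] by (cases "card (Q (take j os)) = m") simp_all
    qed
    finally show "(\<Sum>i\<in>{1..n}. s i * others t m l i R \<rho> os) = occupation t m l w \<rho> os" .
  qed
  finally show ?thesis .
qed

lemma others_nonneg: "0 \<le> others t m l i R \<rho> os"
  by (simp add: others_def sum_nonneg)

lemma others_le_full_queries: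
  assumes "k \<le> m"
  shows "others t m l i R \<rho> os \<le> full_queries t os"
  unfolding others_def full_queries_def using assms by (intro sum_mono) auto

lemma others_le: "others t m l i R \<rho> os \<le> real t"
proof -
  have "others t m l i R \<rho> os \<le> (\<Sum>j<t. 1)"
    unfolding others_def by (intro sum_mono) auto
  then show ?thesis by simp
qed

lemma path_mean_others_measurable:
  "(\<lambda>\<rho>. path_mean t \<rho> (others t m l i R \<rho>)) \<in> borel_measurable keysM"
proof -
  have "(\<lambda>\<rho>. of_bool (R (cnt \<rho> (Q os - {i}) l)) :: real) \<in> borel_measurable keysM" for os
    using Q_subset by (intro measurable_compose [OF cnt_measurable]) auto
  then have "(\<lambda>\<rho>. of_bool (i \<in> Q os \<and> R (cnt \<rho> (Q os - {i}) l)) :: real) \<in> borel_measurable keysM" for os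
    by (cases "i \<in> Q os") simp_all
  then show ?thesis
    unfolding path_mean_def others_def by measurable
qed

text \<open>Approximate detailed balance: under an exactly product law independent of the transcript,
  resampling one key between \<open>S\<close> and \<open>S'\<close> would give equality without \<open>E\<close> and \<open>D\<close>.\<close>

lemma balance:
  assumes km: "k \<le> m"
    and gd: "AE \<rho> in keysM. good r t \<rho>"
    and dp: "\<And>i \<rho> y g. \<lbrakk>i \<in> {1..n}; good r t \<rho>; good r t (\<rho>(i := y)); \<And>os. 0 \<le> g os;
        \<And>os. g os \<le> full_queries t os\<rbrakk> \<Longrightarrow> path_mean t \<rho> g \<le> E * path_mean t (\<rho>(i := y)) g + D"
    and ED: "0 \<le> E" "0 \<le> D"
    and S [measurable]: "S \<in> sets borel" "S' \<in> sets borel"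
    and w: "\<And>\<rho> V. V \<subseteq> {1..n} \<Longrightarrow> card V = m \<Longrightarrow>
      (\<Sum>i\<in>{1..n}. indicator S (\<rho> i) * of_bool (i \<in> V \<and> R (cnt \<rho> (V - {i}) l))) = w (cnt \<rho> V l)"
    and w': "\<And>\<rho> V. V \<subseteq> {1..n} \<Longrightarrow> card V = m \<Longrightarrow>
      (\<Sum>i\<in>{1..n}. indicator S' (\<rho> i) * of_bool (i \<in> V \<and> R (cnt \<rho> (V - {i}) l))) = w' (cnt \<rho> V l)"
  shows "measure unif S' * occ_mean t m l w \<le>
    E * measure unif S * occ_mean t m l w' + real n * D * measure unif S * measure unif S'"
proof -
  let ?G = "\<lambda>i \<rho>. path_mean t \<rho> (others t m l i R \<rho>)"
  have bound: "0 \<le> ?G i \<rho> \<and> ?G i \<rho> \<le> real t" for i \<rho>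
    by (auto intro!: path_mean_nonneg path_mean_le others_nonneg others_le)
  have key: "measure unif S' * (\<integral>\<rho>. indicator S (\<rho> i) * ?G i \<rho> \<partial>keysM) \<le>
    E * measure unif S * (\<integral>\<rho>. indicator S' (\<rho> i) * ?G i \<rho> \<partial>keysM) + D * measure unif S * measure unif S'"
    if i: "i \<in> {1..n}" for i
  proof (rule resample_coordinate [OF prob_space_unif _ i path_mean_others_measurable bound _ _ good_measurable gd])
    fix \<rho> y assume "good r t \<rho>" "good r t (\<rho>(i := y))"
    then show "?G i \<rho> \<le> E * ?G i (\<rho>(i := y)) + D"
      unfolding others_update by (intro dp i others_nonneg others_le_full_queries km)
  qed (use ED S in auto)
  have int: "integrable keysM (\<lambda>\<rho>. indicator S (\<rho> i) * ?G i \<rho>)"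
    if i: "i \<in> {1..n}" and [measurable]: "S \<in> sets borel" for i S
  proof (rule integrable_bounded [OF prob_space_keysM])
    have [measurable]: "(\<lambda>\<rho>. \<rho> i) \<in> borel_measurable keysM" "?G i \<in> borel_measurable keysM"
      by (rule key_measurable [OF i]) (rule path_mean_others_measurable)
    show "(\<lambda>\<rho>. indicator S (\<rho> i) * ?G i \<rho>) \<in> borel_measurable keysM"
      by measurable
    show "\<bar>indicator S (\<rho> i) * ?G i \<rho>\<bar> \<le> real t" for \<rho>
      using bound [of \<rho> i] by (auto simp: indicator_def)
  qed
  have total: "(\<Sum>i\<in>{1..n}. \<integral>\<rho>. indicator S (\<rho> i) * ?G i \<rho> \<partial>keysM) = occ_mean t m l w"
    if "S \<in> sets borel" and w: "\<And>\<rho> V. V \<subseteq> {1..n} \<Longrightarrow> card V = m \<Longrightarrow>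
      (\<Sum>i\<in>{1..n}. indicator S (\<rho> i) * of_bool (i \<in> V \<and> R (cnt \<rho> (V - {i}) l))) = w (cnt \<rho> V l)"
    for S w
  proof -
    have "(\<Sum>i\<in>{1..n}. \<integral>\<rho>. indicator S (\<rho> i) * ?G i \<rho> \<partial>keysM) =
        (\<integral>\<rho>. (\<Sum>i\<in>{1..n}. indicator S (\<rho> i) * ?G i \<rho>) \<partial>keysM)"
      using int that(1) by (intro Bochner_Integration.integral_sum [symmetric]) auto
    also have "\<dots> = occ_mean t m l w"
      unfolding occ_mean_def by (intro Bochner_Integration.integral_cong refl sum_path_mean_others w)
    finally show ?thesis .
  qed
  have "(\<Sum>i\<in>{1..n}. measure unif S' * (\<integral>\<rho>. indicator S (\<rho> i) * ?G i \<rho> \<partial>keysM)) \<le>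
    (\<Sum>i\<in>{1..n}. E * measure unif S * (\<integral>\<rho>. indicator S' (\<rho> i) * ?G i \<rho> \<partial>keysM) +
      D * measure unif S * measure unif S')"
    by (intro sum_mono key)
  then have "measure unif S' * (\<Sum>i\<in>{1..n}. \<integral>\<rho>. indicator S (\<rho> i) * ?G i \<rho> \<partial>keysM) \<le>
    E * measure unif S * (\<Sum>i\<in>{1..n}. \<integral>\<rho>. indicator S' (\<rho> i) * ?G i \<rho> \<partial>keysM) +
      real n * (D * measure unif S * measure unif S')"
    by (simp only: sum.distrib sum_distrib_left [symmetric] sum_constant card_atLeastAtMost diff_Suc_1)
       (simp only: mult_ac)
  moreover have "(\<Sum>i\<in>{1..n}. \<integral>\<rho>. indicator S (\<rho> i) * ?G i \<rho> \<partial>keysM) = occ_mean t m l w"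
    by (rule total [OF S(1)]) (rule w)
  moreover have "(\<Sum>i\<in>{1..n}. \<integral>\<rho>. indicator S' (\<rho> i) * ?G i \<rho> \<partial>keysM) = occ_mean t m l w'"
    by (rule total [OF S(2)]) (rule w')
  ultimately show ?thesis
    by (simp only: mult.assoc)
qed

section \<open>Tails of the count by iterating the balance equation\<close>

context
  fixes m l r t :: nat and E D :: real
  assumes km: "k \<le> m" and mn: "m \<le> n" and l: "l < steps"
    and gd: "AE \<rho> in keysM. good r t \<rho>"
    and dp: "\<And>i \<rho> y g. \<lbrakk>i \<in> {1..n}; good r t \<rho>; good r t (\<rho>(i := y)); \<And>os. 0 \<le> g os;
        \<And>os. g os \<le> full_queries t os\<rbrakk> \<Longrightarrow> path_mean t \<rho> g \<le> E * path_mean t (\<rho>(i := y)) g + D"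
    and ED: "0 \<le> E" "0 \<le> D"
begin

private lemma tau01: "0 < tau l" "tau l < 1"
  using tau_pos l by (auto simp: tau_less_1_iff)

private lemma m_pos: "0 < real m"
  using km k1 by simp

text \<open>Starting value of the recursions below: a query of size \<open>m\<close> is full because
  \<open>k \<le> m\<close>, so the double count applies.\<close>

lemma occ_mean_of_bool_le: "occ_mean t m l (\<lambda>x. of_bool (P x)) \<le> real (n * r) / real k"
proof -
  interpret prob_space keysM by (rule prob_space_keysM)
  have "occ_mean t m l (\<lambda>x. of_bool (P x)) \<le> (\<integral>\<rho>. real (n * r) / real k \<partial>keysM)"
    unfolding occ_mean_def
  proof (rule integral_mono_AE [OF integrable_occupation])
    show "AE \<rho> in keysM. path_mean t \<rho> (occupation t m l (\<lambda>x. of_bool (P x)) \<rho>) \<le> real (n * r) / real k"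
      using gd
    proof eventually_elim
      case (elim \<rho>)
      show ?case
      proof (rule path_mean_le)
        fix os assume "os \<in> paths steps t" "0 < path_prob (K \<rho>) os"
        moreover have "occupation t m l (\<lambda>x. of_bool (P x)) \<rho> os \<le> full_queries t os"
          unfolding occupation_def full_queries_def using km by (intro sum_mono) auto
        ultimately show "occupation t m l (\<lambda>x. of_bool (P x)) \<rho> os \<le> real (n * r) / real k"
          using full_queries_bound [OF elim] by force
      qed
    qed
  qed (rule integrable_const)
  also have "\<dots> = real (n * r) / real k"
    by (simp only: lebesgue_integral_const prob_space real_scaleR_def mult_1_left)
  finally show ?thesis .
qed

private lemma measure_unif_tau:
  "measure unif {..<tau l} = tau l" "measure unif {tau l..} = 1 - tau l"
  by (rule measure_unif_below measure_unif_above; use tau01 in simp)+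

private lemma balance_below:
  "(1 - tau l) * occ_mean t m l (\<lambda>x. real x * of_bool (R (x - 1))) \<le>
    E * tau l * occ_mean t m l (\<lambda>x. (real m - real x) * of_bool (R x)) + real n * D * tau l * (1 - tau l)"
proof -
  have "measure unif {tau l..} * occ_mean t m l (\<lambda>x. real x * of_bool (R (x - 1))) \<le>
    E * measure unif {..<tau l} * occ_mean t m l (\<lambda>x. (real m - real x) * of_bool (R x)) +
    real n * D * measure unif {..<tau l} * measure unif {tau l..}"
  proof (rule balance [OF km gd dp ED, where R = R])
  fix \<rho> V assume V: "V \<subseteq> {1..n}" "card V = m"
  show "(\<Sum>i\<in>{1..n}. indicator {..<tau l} (\<rho> i) * of_bool (i \<in> V \<and> R (cnt \<rho> (V - {i}) l))) =
      real (cnt \<rho> V l) * of_bool (R (cnt \<rho> V l - 1))"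
    by (rule sum_others_below [OF V(1)])
  show "(\<Sum>i\<in>{1..n}. indicator {tau l..} (\<rho> i) * of_bool (i \<in> V \<and> R (cnt \<rho> (V - {i}) l))) =
      (real m - real (cnt \<rho> V l)) * of_bool (R (cnt \<rho> V l))"
    using sum_others_above [OF V(1), of l \<rho> R] V(2) by simp
  qed simp_all
  then show ?thesis by (simp only: measure_unif_tau)
qed

private lemma balance_above:
  "tau l * occ_mean t m l (\<lambda>x. (real m - real x) * of_bool (R x)) \<le>
    E * (1 - tau l) * occ_mean t m l (\<lambda>x. real x * of_bool (R (x - 1))) + real n * D * (1 - tau l) * tau l"
proof -
  have "measure unif {..<tau l} * occ_mean t m l (\<lambda>x. (real m - real x) * of_bool (R x)) \<le>
    E * measure unif {tau l..} * occ_mean t m l (\<lambda>x. real x * of_bool (R (x - 1))) +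
    real n * D * measure unif {tau l..} * measure unif {..<tau l}"
  proof (rule balance [OF km gd dp ED, where R = R])
  fix \<rho> V assume V: "V \<subseteq> {1..n}" "card V = m"
  show "(\<Sum>i\<in>{1..n}. indicator {..<tau l} (\<rho> i) * of_bool (i \<in> V \<and> R (cnt \<rho> (V - {i}) l))) =
      real (cnt \<rho> V l) * of_bool (R (cnt \<rho> V l - 1))"
    by (rule sum_others_below [OF V(1)])
  show "(\<Sum>i\<in>{1..n}. indicator {tau l..} (\<rho> i) * of_bool (i \<in> V \<and> R (cnt \<rho> (V - {i}) l))) =
      (real m - real (cnt \<rho> V l)) * of_bool (R (cnt \<rho> V l))"
    using sum_others_above [OF V(1), of l \<rho> R] V(2) by simp
  qed simp_all
  then show ?thesis by (simp only: measure_unif_tau)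
qed

text \<open>Balance with \<open>R\<close> the event of being at least \<open>c\<close>. The death
  weight is at least c + 1 on counts above c, the birth weight is at most m - c \<le> m (1 - tau l),
  and tau l m / (c + 1) \<le> 1 / \<theta>. Tail events in place of single counts give a recursion
  for the tails directly.\<close>

lemma upper_step:
  assumes \<theta>: "1 \<le> \<theta>" and c: "\<theta> * tau l * real m \<le> real c"
  shows "occ_mean t m l (\<lambda>x. of_bool (Suc c \<le> x)) \<le>
    E / \<theta> * occ_mean t m l (\<lambda>x. of_bool (c \<le> x)) + real n * D"
proof -
  let ?U = "\<lambda>c. occ_mean t m l (\<lambda>x. of_bool (c \<le> x))"
  have U: "0 \<le> ?U c" by (intro occ_mean_nonneg) simp
  have "(1 - tau l) * (real (Suc c) * ?U (Suc c)) \<le> (1 - tau l) * occ_mean t m l (\<lambda>x. real x * of_bool (c \<le> x - 1))"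
    unfolding occ_mean_cmult [symmetric] using tau01
    by (intro mult_left_mono occ_mean_mono) auto
  also have "\<dots> \<le> E * tau l * occ_mean t m l (\<lambda>x. (real m - real x) * of_bool (c \<le> x)) + real n * D * tau l * (1 - tau l)"
    by (rule balance_below)
  also have "\<dots> \<le> E * tau l * ((real m - real c) * ?U c) + real n * D * tau l * (1 - tau l)"
    unfolding occ_mean_cmult [symmetric] using tau01 ED
    by (intro add_right_mono mult_left_mono occ_mean_mono) (auto intro!: mult_nonneg_nonneg)
  also have "\<dots> \<le> E * tau l * (real m * (1 - tau l) * ?U c) + real n * D * tau l * (1 - tau l)"
  proof -
    have "1 * (tau l * real m) \<le> \<theta> * (tau l * real m)"
      using \<theta> tau01 by (intro mult_right_mono) auto
    then have "real m - real c \<le> real m * (1 - tau l)"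
      using c by (simp add: algebra_simps)
    then show ?thesis
      using ED tau01 U by (intro add_right_mono mult_left_mono mult_right_mono) auto
  qed
  also have "\<dots> = (1 - tau l) * (E * tau l * real m * ?U c + real n * D * tau l)"
    by (simp add: algebra_simps)
  finally have "real (Suc c) * ?U (Suc c) \<le> E * tau l * real m * ?U c + real n * D * tau l"
    using tau01 by (simp only: mult_le_cancel_left_pos diff_gt_0_iff_gt)
  also have "E * tau l * real m * ?U c \<le> E / \<theta> * real (Suc c) * ?U c"
  proof -
    have "tau l * real m \<le> real (Suc c) / \<theta>"
      using c \<theta> by (simp add: field_simps)
    then have "E * (tau l * real m) \<le> E * (real (Suc c) / \<theta>)"
      using ED by (intro mult_left_mono)
    then show ?thesis
      using U by (intro mult_right_mono) (auto simp: mult_ac)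
  qed
  \<comment> \<open>The whole inequality is about to be divided by c + 1, which is at least 1 and so
    exceeds \<open>tau l\<close>.\<close>
  also have "real n * D * tau l \<le> real (Suc c) * (real n * D)"
  proof -
    have "tau l \<le> real (Suc c)" using tau01 by simp
    then show ?thesis using ED mult_left_mono [of "tau l" "real (Suc c)" "real n * D"] by (simp add: mult_ac)
  qed
  finally have "real (Suc c) * ?U (Suc c) \<le> real (Suc c) * (E / \<theta> * ?U c + real n * D)"
    by (simp only: distrib_left mult_ac)
  then show ?thesis
    by (simp only: mult_le_cancel_left_pos of_nat_0_less_iff zero_less_Suc)
qed

text \<open>Mirror image, with \<open>R\<close> the event of being at most \<open>c\<close>: the
  birth weight is at least m - c \<ge> m (1 - tau l), and the death weight is at most c + 1 \<le>
  \<theta> tau l m.\<close>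

lemma lower_step:
  assumes \<theta>: "0 \<le> \<theta>" "\<theta> \<le> 1" and c: "real (Suc c) \<le> \<theta> * tau l * real m"
  shows "occ_mean t m l (\<lambda>x. of_bool (x \<le> c)) \<le>
    E * \<theta> * occ_mean t m l (\<lambda>x. of_bool (x \<le> Suc c)) + real n * D"
proof -
  let ?L = "\<lambda>c. occ_mean t m l (\<lambda>x. of_bool (x \<le> c))"
  have L: "0 \<le> ?L c" for c by (intro occ_mean_nonneg) simp
  have "\<theta> * (tau l * real m) \<le> 1 * (tau l * real m)"
    using \<theta> tau01 by (intro mult_right_mono) auto
  then have mc: "real m * (1 - tau l) \<le> real m - real c"
    using c by (simp add: algebra_simps)
  have "tau l * (real m * (1 - tau l) * ?L c) \<le> tau l * ((real m - real c) * ?L c)"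
    using mc L tau01 by (intro mult_left_mono mult_right_mono) auto
  also have "\<dots> \<le> tau l * occ_mean t m l (\<lambda>x. (real m - real x) * of_bool (x \<le> c))"
    unfolding occ_mean_cmult [symmetric] using tau01
    by (intro mult_left_mono occ_mean_mono) auto
  also have "\<dots> \<le> E * (1 - tau l) * occ_mean t m l (\<lambda>x. real x * of_bool (x - 1 \<le> c)) + real n * D * (1 - tau l) * tau l"
    by (rule balance_above)
  also have "\<dots> \<le> E * (1 - tau l) * (real (Suc c) * ?L (Suc c)) + real n * D * (1 - tau l) * tau l"
    unfolding occ_mean_cmult [symmetric] using tau01 ED
    by (intro add_right_mono mult_left_mono occ_mean_mono) (auto intro!: mult_nonneg_nonneg)
  also have "\<dots> \<le> E * (1 - tau l) * (\<theta> * tau l * real m * ?L (Suc c)) + real n * D * (1 - tau l) * (tau l * real m)"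
  proof -
    have "1 \<le> real m" using m_pos by simp
    then have "tau l * 1 \<le> tau l * real m"
      using tau01 by (intro mult_left_mono) auto
    then show ?thesis
      using c L tau01 ED by (intro add_mono mult_left_mono mult_right_mono) (auto intro!: mult_nonneg_nonneg)
  qed
  also have "\<dots> = (tau l * real m * (1 - tau l)) * (E * \<theta> * ?L (Suc c) + real n * D)"
    by (simp add: algebra_simps)
  finally have "(tau l * real m * (1 - tau l)) * ?L c \<le> (tau l * real m * (1 - tau l)) * (E * \<theta> * ?L (Suc c) + real n * D)"
    by (simp add: mult_ac)
  moreover have "0 < tau l * real m * (1 - tau l)"
    using tau01 m_pos by simp
  ultimately show ?thesis
    by (simp only: mult_le_cancel_left_pos)
qed

lemma upper_tail:
  assumes \<theta>: "1 \<le> \<theta>" "E / \<theta> < 1" and c: "\<theta> * tau l * real m \<le> real c"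
  shows "occ_mean t m l (\<lambda>x. of_bool (c + d \<le> x)) \<le>
    (E / \<theta>) ^ d * (real (n * r) / real k) + real n * D / (1 - E / \<theta>)"
proof -
  have x: "0 \<le> E / \<theta>" using \<theta> ED by simp
  have "occ_mean t m l (\<lambda>x. of_bool (c + d \<le> x)) \<le>
      (E / \<theta>) ^ d * occ_mean t m l (\<lambda>x. of_bool (c + 0 \<le> x)) + real n * D / (1 - E / \<theta>)"
  proof (rule geometric_recurrence [where N = d and a = "\<lambda>d. occ_mean t m l (\<lambda>x. of_bool (c + d \<le> x))"])
    fix d'
    show "occ_mean t m l (\<lambda>x. of_bool (c + Suc d' \<le> x)) \<le>
        E / \<theta> * occ_mean t m l (\<lambda>x. of_bool (c + d' \<le> x)) + real n * D"
      using upper_step [of \<theta> "c + d'"] \<theta> c by simp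
  qed (use \<theta> ED x in auto)
  also have "\<dots> \<le> (E / \<theta>) ^ d * (real (n * r) / real k) + real n * D / (1 - E / \<theta>)"
    using x by (intro add_right_mono mult_left_mono occ_mean_of_bool_le) auto
  finally show ?thesis .
qed

lemma lower_tail:
  assumes \<theta>: "0 \<le> \<theta>" "\<theta> \<le> 1" "E * \<theta> < 1" and c: "real (c + d) \<le> \<theta> * tau l * real m"
  shows "occ_mean t m l (\<lambda>x. of_bool (x \<le> c)) \<le>
    (E * \<theta>) ^ d * (real (n * r) / real k) + real n * D / (1 - E * \<theta>)"
proof -
  have x: "0 \<le> E * \<theta>" using \<theta> ED by simp
  \<comment> \<open>The index is reversed, so that descending from \<open>c + d\<close> to
    \<open>c\<close> becomes a recursion in increasing \<open>d'\<close>.\<close>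
  have "occ_mean t m l (\<lambda>x. of_bool (x \<le> c + d - d)) \<le>
      (E * \<theta>) ^ d * occ_mean t m l (\<lambda>x. of_bool (x \<le> c + d - 0)) + real n * D / (1 - E * \<theta>)"
  proof (rule geometric_recurrence [where N = d and a = "\<lambda>d'. occ_mean t m l (\<lambda>x. of_bool (x \<le> c + d - d'))"])
    fix d' assume "d' < d"
    then have "Suc (c + d - Suc d') = c + d - d'" "real (Suc (c + d - Suc d')) \<le> real (c + d)"
      by auto
    then show "occ_mean t m l (\<lambda>x. of_bool (x \<le> c + d - Suc d')) \<le>
        E * \<theta> * occ_mean t m l (\<lambda>x. of_bool (x \<le> c + d - d')) + real n * D"
      using lower_step [of \<theta> "c + d - Suc d'"] \<theta> c by simp
  qed (use \<theta> ED x in auto)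
  also have "\<dots> \<le> (E * \<theta>) ^ d * (real (n * r) / real k) + real n * D / (1 - E * \<theta>)"
    using x by (intro add_right_mono mult_left_mono occ_mean_of_bool_le) auto
  finally show ?thesis by simp
qed

end

end

section \<open>Accuracy against a deterministic adversary\<close>

lemma stop_prob_le_pass:
  assumes "\<And>l. 0 \<le> f l \<and> f l \<le> 1" "m \<noteq> M"
  shows "stop_prob f M m \<le> f m"
proof -
  have "(\<Prod>l<m. 1 - f l) \<le> 1" "0 \<le> (\<Prod>l<m. 1 - f l)"
    using assms by (auto intro!: prod_le_1 prod_nonneg)
  then show ?thesis
    using assms mult_right_mono [of "\<Prod>l<m. 1 - f l" 1 "f m"] by (simp add: stop_prob_def)
qed

lemma stop_prob_le_fail:
  assumes f: "\<And>l. 0 \<le> f l \<and> f l \<le> 1" and "l < m"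
  shows "stop_prob f M m \<le> 1 - f l"
proof -
  have "(\<Prod>l<m. 1 - f l) = (1 - f l) * (\<Prod>l\<in>{..<m} - {l}. 1 - f l)"
    using assms by (intro prod.remove) auto
  also have "\<dots> \<le> (1 - f l) * 1"
    using f by (intro mult_left_mono prod_le_1) auto
  finally have "(\<Prod>l<m. 1 - f l) \<le> 1 - f l" by simp
  moreover have "(\<Prod>l<m. 1 - f l) * (if m = M then 1 else f m) \<le> (\<Prod>l<m. 1 - f l) * 1"
    using f by (intro mult_left_mono prod_nonneg) auto
  ultimately show ?thesis by (simp add: stop_prob_def)
qed

context transcript
begin

definition accurate :: "nat set \<Rightarrow> nat \<Rightarrow> bool" where
  "accurate V x \<longleftrightarrow> reply V x \<in> {(1 - \<alpha>) * real (card V) .. (1 + \<alpha>) * real (card V)}"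

text \<open>Stopping at index \<open>l\<close> would overestimate, yet the count is above
  \<open>T\<close> or misses it by less than \<alpha> k / 100. That margin is reserved for the
  noise.\<close>

definition too_many :: "nat \<Rightarrow> nat \<Rightarrow> nat \<Rightarrow> bool" where
  "too_many m l x \<longleftrightarrow> (1 + \<alpha>) * (tau l * real m) < (1 - \<alpha>) * real k \<and> T - \<alpha> * real k / 100 < real x"

text \<open>The first two conditions single out the last threshold with tau l m \<le> k. For a set
  independent of the keys the mean count there exceeds k / (1 + \<alpha> / 4); the third says that
  the actual count does not clear \<open>T\<close> by the margin for the noise.\<close>

definition too_few :: "nat \<Rightarrow> nat \<Rightarrow> nat \<Rightarrow> bool" where
  "too_few m l x \<longleftrightarrow> tau l * real m \<le> real k \<and> real k < (1 + \<alpha> / 4) * (tau l * real m) \<and>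
     real x < T + \<alpha> * real k / 100"

definition atypical :: "(nat \<Rightarrow> real) \<Rightarrow> nat set \<Rightarrow> bool" where
  "atypical \<rho> V \<longleftrightarrow> (\<exists>l<steps. too_many (card V) l (cnt \<rho> V l) \<or> too_few (card V) l (cnt \<rho> V l))"

lemma accurate_small: "card V < k \<Longrightarrow> accurate V x"
  using \<alpha> by (simp add: accurate_def reply_def algebra_simps)

lemma pass_01: "0 \<le> pass \<rho> V l \<and> pass \<rho> V l \<le> 1"
  using pass_strict [of \<rho> V l] by simp

text \<open>An overestimate means that the test at \<open>x\<close> succeeded; an underestimate
  means that the loop ran past the last threshold with tau l m \<le> k, so the test there failed.
  For a typical query either event needs noise of size \<alpha> k / 100 against the count.\<close>

lemma inaccurate_prob:
  assumes V: "k \<le> card V" "card V \<le> n" and typical: "\<not> atypical \<rho> V"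
    and x: "x \<le> steps" "\<not> accurate V x"
  shows "stop_prob (pass \<rho> V) steps x \<le> exp (- (e * \<alpha> * real k / 100))"
proof -
  have m: "0 < real (card V)" using V k1 by simp
  have reply: "reply V x = T / tau x" using V by (simp add: reply_def)
  consider "(1 + \<alpha>) * real (card V) < T / tau x" | "T / tau x < (1 - \<alpha>) * real (card V)"
    using x(2) unfolding accurate_def reply by fastforce
  then show ?thesis
  proof cases
    case 1
    then have small: "(1 + \<alpha>) * (tau x * real (card V)) < (1 - \<alpha>) * real k"
      using tau_pos [of x] by (simp add: T_def field_simps)
    \<comment> \<open>A test at \<open>x\<close> was really performed: an overestimate forces tau x
      < 1, so \<open>x\<close> is not the final index \<open>steps\<close>.\<close>
    have "tau x * real k \<le> (1 + \<alpha>) * (tau x * real (card V))"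
      using \<alpha> tau_pos [of x] V mult_mono [of 1 "1 + \<alpha>" "tau x * real k" "tau x * real (card V)"] by simp
    also have "\<dots> < (1 - \<alpha>) * real k" by (rule small)
    also have "\<dots> \<le> real k" using \<alpha> by (simp add: algebra_simps)
    finally have xs: "x < steps"
      using k_pos by (simp flip: tau_less_1_iff)
    then have "real (cnt \<rho> V x) \<le> T - \<alpha> * real k / 100"
      using typical small unfolding atypical_def too_many_def by force
    then have u: "\<alpha> * real k / 100 \<le> T - real (hits \<rho> V x)"
      by (simp add: hits_def cnt_def min_def)
    have u0: "0 \<le> \<alpha> * real k / 100" using \<alpha> by simp
    have "stop_prob (pass \<rho> V) steps x \<le> pass \<rho> V x"
      using xs by (intro stop_prob_le_pass pass_01) auto
    also have "\<dots> \<le> exp (- (T - real (hits \<rho> V x)) / (1 / e))"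
      unfolding pass_def using e u u0 by (intro laplace_tail_le_exp) auto
    also have "- (T - real (hits \<rho> V x)) / (1 / e) = - (e * (T - real (hits \<rho> V x)))"
      by (simp add: algebra_simps)
    also have "exp \<dots> \<le> exp (- (e * (\<alpha> * real k / 100)))"
      using mult_left_mono [OF u, of e] e by (simp only: exp_le_cancel_iff neg_le_iff_le less_imp_le)
    finally show ?thesis by (simp add: mult.assoc)
  next
    case 2
    then have "(1 - \<alpha>) * real k < (1 - \<alpha>) * (tau x * real (card V))"
      using tau_pos [of x] by (simp add: T_def pos_divide_less_eq mult_ac)
    \<comment> \<open>The factor 1 - \<alpha> built into \<open>T\<close> cancels exactly.\<close>
    then have big: "real k < tau x * real (card V)"
      using \<alpha> by (simp add: mult_less_cancel_left_pos)
    \<comment> \<open>The first threshold is low enough for every query set: tau 0 m = k m / (2 n)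
      with m \<le> n.\<close>
    have "real k * real (card V) \<le> real k * (2 * real n)"
      using V by (intro mult_left_mono) auto
    then have start: "tau 0 * real (card V) \<le> real k"
      using n_pos by (simp add: tau_0 field_simps)
    have "\<exists>l<x. tau l * real (card V) \<le> real k \<and> real k < tau (Suc l) * real (card V)"
      using big
    proof (induction x)
      case 0
      then show ?case using start by simp
    next
      case (Suc x)
      then show ?case
        by (cases "real k < tau x * real (card V)") (auto intro: less_SucI simp: not_less)
    qed
    then obtain l where l: "l < x" "tau l * real (card V) \<le> real k"
        "real k < tau (Suc l) * real (card V)" by auto
    then have "l < steps" using x by simp
    then have "T + \<alpha> * real k / 100 \<le> real (cnt \<rho> V l)"
      using typical l unfolding atypical_def too_few_def tau_Suc by (force simp: mult.assoc)
    \<comment> \<open>The cap at \<open>k\<close> does not hide the surplus, because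
      \<open>T\<close> plus the margin is still at most \<open>k\<close>.\<close>
    moreover have "T + \<alpha> * real k / 100 \<le> real k"
      using \<alpha> k_pos by (simp add: T_def algebra_simps)
    ultimately have u: "T - real (hits \<rho> V l) \<le> - (\<alpha> * real k / 100)"
      by (simp add: hits_def cnt_def min_def)
    have u0: "0 \<le> \<alpha> * real k / 100" using \<alpha> by simp
    have "stop_prob (pass \<rho> V) steps x \<le> 1 - pass \<rho> V l"
      using l(1) by (intro stop_prob_le_fail pass_01)
    also have "\<dots> \<le> exp ((T - real (hits \<rho> V l)) / (1 / e))"
      unfolding pass_def using e u u0 by (intro one_minus_laplace_tail_le_exp) auto
    also have "(T - real (hits \<rho> V l)) / (1 / e) = e * (T - real (hits \<rho> V l))"
      by (simp add: mult.commute)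
    also have "exp \<dots> \<le> exp (e * - (\<alpha> * real k / 100))"
      using mult_left_mono [OF u, of e] e by (simp only: exp_le_cancel_iff less_imp_le)
    finally show ?thesis by (simp add: mult.assoc)
  qed
qed

text \<open>A union over the \<open>steps + 1\<close> indices of one full query, then the tower rule
  and the bound on the number of full queries.\<close>

lemma typical_inaccurate_mean:
  assumes good: "good r t \<rho>"
  shows "path_mean t \<rho> (\<lambda>os. \<Sum>j<t. of_bool (k \<le> card (Q (take j os)) \<and>
       \<not> atypical \<rho> (Q (take j os)) \<and> \<not> accurate (Q (take j os)) (os ! j))) \<le>
    (real steps + 1) * exp (- (e * \<alpha> * real k / 100)) * (real (n * r) / real k)"
proof -
  let ?\<delta> = "(real steps + 1) * exp (- (e * \<alpha> * real k / 100))"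
  let ?u = "\<lambda>os x. of_bool (k \<le> card (Q os) \<and> \<not> atypical \<rho> (Q os) \<and> \<not> accurate (Q os) x) :: real"
  let ?v = "\<lambda>os. ?\<delta> * of_bool (k \<le> card (Q os))"
  have "(\<Sum>x\<le>steps. K \<rho> os x * ?u os x) \<le> ?v os" for os
  proof (cases "k \<le> card (Q os)")
    case True
    have "(\<Sum>x\<le>steps. K \<rho> os x * ?u os x) \<le> (\<Sum>x\<le>steps. exp (- (e * \<alpha> * real k / 100)))"
    proof (intro sum_mono)
      fix x assume x: "x \<in> {..steps}"
      show "K \<rho> os x * ?u os x \<le> exp (- (e * \<alpha> * real k / 100))"
        using inaccurate_prob [OF True card_Q_le, of \<rho> x] x True by (auto simp: K_def)
    qed
    also have "\<dots> = ?v os" using True by (simp add: algebra_simps)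
    finally show ?thesis .
  qed simp
  then have "path_mean t \<rho> (\<lambda>os. \<Sum>j<t. ?u (take j os) (os ! j)) \<le>
      path_mean t \<rho> (\<lambda>os. \<Sum>j<t. ?v (take j os))"
    unfolding path_mean_def by (rule kernel.path_expectation_step_bound [OF kernel_K])
  also have "\<dots> = path_mean t \<rho> (\<lambda>os. ?\<delta> * full_queries t os)"
    unfolding full_queries_def by (simp only: sum_distrib_left)
  also have "\<dots> \<le> ?\<delta> * (real (n * r) / real k)"
    using full_queries_bound [OF good] by (intro path_mean_le mult_left_mono) auto
  finally show ?thesis .
qed

lemma atypical_count:
  "(\<Sum>j<t. of_bool (k \<le> card (Q (take j os)) \<and> atypical \<rho> (Q (take j os)))) \<le>
   (\<Sum>m\<in>{k..n}. \<Sum>l<steps. occupation t m l (\<lambda>x. of_bool (too_many m l x)) \<rho> os +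
      occupation t m l (\<lambda>x. of_bool (too_few m l x)) \<rho> os)"
proof -
  let ?V = "\<lambda>j. Q (take j os)"
  let ?f = "\<lambda>m l j. of_bool (card (?V j) = m) * of_bool (too_many m l (cnt \<rho> (?V j) l)) +
      of_bool (card (?V j) = m) * of_bool (too_few m l (cnt \<rho> (?V j) l)) :: real"
  have "of_bool (k \<le> card (?V j) \<and> atypical \<rho> (?V j)) \<le> (\<Sum>m\<in>{k..n}. \<Sum>l<steps. ?f m l j)" for j
  proof (cases "k \<le> card (?V j) \<and> atypical \<rho> (?V j)")
    case True
    then obtain l where l: "l < steps"
        "too_many (card (?V j)) l (cnt \<rho> (?V j) l) \<or> too_few (card (?V j)) l (cnt \<rho> (?V j) l)"
      by (auto simp: atypical_def)
    have "1 \<le> ?f (card (?V j)) l j"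
      using l by auto
    also have "\<dots> \<le> (\<Sum>l<steps. ?f (card (?V j)) l j)"
      using l by (intro member_le_sum) auto
    also have "\<dots> \<le> (\<Sum>m\<in>{k..n}. \<Sum>l<steps. ?f m l j)"
      using True card_Q_le
      by (intro member_le_sum [where f = "\<lambda>m. \<Sum>l<steps. ?f m l j"] sum_nonneg) auto
    finally show ?thesis using True by simp
  next
    case False
    then show ?thesis by (auto intro!: sum_nonneg)
  qed
  then have "(\<Sum>j<t. of_bool (k \<le> card (?V j) \<and> atypical \<rho> (?V j))) \<le>
      (\<Sum>j<t. \<Sum>m\<in>{k..n}. \<Sum>l<steps. ?f m l j)"
    by (intro sum_mono)
  also have "\<dots> = (\<Sum>m\<in>{k..n}. \<Sum>j<t. \<Sum>l<steps. ?f m l j)"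
    by (rule sum.swap)
  also have "\<dots> = (\<Sum>m\<in>{k..n}. \<Sum>l<steps. \<Sum>j<t. ?f m l j)"
    by (intro sum.cong refl sum.swap)
  finally show ?thesis
    by (simp only: occupation_def sum.distrib)
qed

section \<open>Decay rates and estimates for atypical counts\<close>

lemma one_minus_exp_ge:
  fixes x :: real
  assumes "0 \<le> x" "x \<le> 1 / 2"
  shows "x / 2 \<le> 1 - exp (- x)"
proof -
  have "exp (- x) \<le> 1 + (- x) + (- x)\<^sup>2"
    using assms by (intro exp_le_quadratic) auto
  moreover have "x * x \<le> x * (1 / 2)"
    using assms by (intro mult_left_mono) auto
  ultimately show ?thesis by (simp add: power2_eq_square)
qed

text \<open>The drift factor 1 + 9 \<alpha> / 10 has to beat the privacy loss exp (\<alpha> / 2) and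
  leave exp (\<alpha> / 10) over. For \<alpha> < 1 / 2 the quadratic term of exp (3 \<alpha> / 5) is
  at most 9 \<alpha> / 50, which leaves room.\<close>

lemma upper_rate: "exp (\<alpha> / 2) / (1 + 9 / 10 * \<alpha>) \<le> exp (- (\<alpha> / 10))"
proof -
  have "exp (\<alpha> / 2) * exp (\<alpha> / 10) = exp (3 / 5 * \<alpha>)"
    by (simp flip: exp_add)
  also have "\<dots> \<le> 1 + 3 / 5 * \<alpha> + (3 / 5 * \<alpha>)\<^sup>2"
    using \<alpha> by (intro exp_le_quadratic) auto
  also have "\<dots> \<le> 1 + 9 / 10 * \<alpha>"
    using \<alpha> mult_left_mono [of \<alpha> "1 / 2" \<alpha>] by (simp add: power2_eq_square)
  finally show ?thesis
    using \<alpha> by (simp add: exp_minus field_simps)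
qed

lemma lower_rate: "exp (\<alpha> / 2) * (1 - 7 / 10 * \<alpha>) \<le> exp (- (\<alpha> / 10))"
proof -
  have "1 - 7 / 10 * \<alpha> \<le> exp (- (7 / 10 * \<alpha>))"
    using exp_ge_add_one_self [of "- (7 / 10 * \<alpha>)"] by simp
  then have "exp (\<alpha> / 2) * (1 - 7 / 10 * \<alpha>) \<le> exp (\<alpha> / 2) * exp (- (7 / 10 * \<alpha>))"
    by (intro mult_left_mono) auto
  also have "\<dots> = exp (- (1 / 5 * \<alpha>))"
    by (simp flip: exp_add)
  also have "\<dots> \<le> exp (- (\<alpha> / 10))"
    using \<alpha> by simp
  finally show ?thesis .
qed

text \<open>Both tails decay geometrically with a ratio \<open>x \<le> exp (- \<alpha> / 10)\<close> over about \<open>\<alpha> k / 50\<close> steps.\<close>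

lemma tail_bound:
  assumes x: "0 \<le> x" "x \<le> exp (- (\<alpha> / 10))"
    and k: "300 \<le> \<alpha> * real k" and "0 \<le> N" "0 \<le> D"
  shows "x ^ nat \<lfloor>\<alpha> * real k / 50\<rfloor> * N + real n * D / (1 - x) \<le>
    exp (- (\<alpha>\<^sup>2 * real k / 600)) * N + 20 * real n * D / \<alpha>"
proof (rule add_mono)
  define d where "d = nat \<lfloor>\<alpha> * real k / 50\<rfloor>"
  have "\<alpha> * real k / 50 < real d + 1"
    unfolding d_def using k by linarith
  \<comment> \<open>Rounding down loses at most 1, and \<alpha> k / 50 - \<alpha> k / 60 = \<alpha>
    k / 300, which is at least 1 by the assumption on \<alpha> k.\<close>
  then have d: "\<alpha> * real k / 60 \<le> real d"
    using k by linarith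
  have "x ^ d \<le> exp (- (\<alpha> / 10)) ^ d"
    by (intro power_mono x)
  also have "\<dots> = exp (- (\<alpha> / 10 * real d))"
    by (simp add: exp_of_nat_mult [symmetric] mult.commute)
  also have "\<dots> \<le> exp (- (\<alpha> / 10 * (\<alpha> * real k / 60)))"
    using d \<alpha> by (simp add: mult_left_mono)
  finally have "x ^ d \<le> exp (- (\<alpha>\<^sup>2 * real k / 600))"
    by (simp add: power2_eq_square mult_ac)
  then show "x ^ nat \<lfloor>\<alpha> * real k / 50\<rfloor> * N \<le> exp (- (\<alpha>\<^sup>2 * real k / 600)) * N"
    unfolding d_def using assms by (intro mult_right_mono)
  have "\<alpha> / 20 \<le> 1 - exp (- (\<alpha> / 10))"
    using one_minus_exp_ge [of "\<alpha> / 10"] \<alpha> by simp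
  then have "\<alpha> / 20 \<le> 1 - x"
    using x by linarith
  then have "real n * D / (1 - x) \<le> real n * D / (\<alpha> / 20)"
    using assms \<alpha> by (intro divide_left_mono) auto
  then show "real n * D / (1 - x) \<le> 20 * real n * D / \<alpha>"
    by (simp add: mult_ac)
qed

context
  fixes m l r t :: nat and D :: real
  assumes km: "k \<le> m" and mn: "m \<le> n" and l: "l < steps"
    and gd: "AE \<rho> in keysM. good r t \<rho>"
    and dp: "\<And>i \<rho> y g. \<lbrakk>i \<in> {1..n}; good r t \<rho>; good r t (\<rho>(i := y)); \<And>os. 0 \<le> g os;
        \<And>os. g os \<le> full_queries t os\<rbrakk> \<Longrightarrow>
        path_mean t \<rho> g \<le> exp (\<alpha> / 2) * path_mean t (\<rho>(i := y)) g + D"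
    and D: "0 \<le> D"
    and k300: "300 \<le> \<alpha> * real k"
begin

lemma too_many_bound:
  "occ_mean t m l (\<lambda>x. of_bool (too_many m l x)) \<le>
    exp (- (\<alpha>\<^sup>2 * real k / 600)) * (real (n * r) / real k) + 20 * real n * D / \<alpha>"
proof (cases "(1 + \<alpha>) * (tau l * real m) < (1 - \<alpha>) * real k")
  case True
  let ?\<theta> = "1 + 9 / 10 * \<alpha>"
  define c where "c = nat \<lceil>?\<theta> * tau l * real m\<rceil>"
  define d where "d = nat \<lfloor>\<alpha> * real k / 50\<rfloor>"
  have tm: "0 \<le> ?\<theta> * tau l * real m"
    using \<alpha> tau_pos [of l] by simp
  then have c: "?\<theta> * tau l * real m \<le> real c" "real c \<le> ?\<theta> * tau l * real m + 1"
    unfolding c_def by linarith+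
  have d: "real d \<le> \<alpha> * real k / 50"
    unfolding d_def using k300 by linarith
  have "?\<theta> * tau l * real m \<le> (1 - \<alpha>) * real k - \<alpha> * real k / 30"
  proof -
    have "(1 + \<alpha>) * (?\<theta> * (tau l * real m)) \<le> ?\<theta> * ((1 - \<alpha>) * real k)"
      using True \<alpha> mult_left_mono [of "(1 + \<alpha>) * (tau l * real m)" "(1 - \<alpha>) * real k" ?\<theta>]
      by (simp add: mult_ac)
    also have "\<dots> \<le> (1 + \<alpha>) * ((1 - \<alpha>) * real k - \<alpha> * real k / 30)"
    proof -
      \<comment> \<open>After expansion this reads 4 / 30 \<alpha>^2 \<le> 2 / 30 \<alpha>, that is,
        \<alpha> \<le> 1 / 2.\<close>
      have "?\<theta> * (1 - \<alpha>) \<le> (1 + \<alpha>) * ((1 - \<alpha>) - \<alpha> / 30)"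
      proof -
        have "\<alpha> * \<alpha> \<le> \<alpha> * (1 / 2)"
          using \<alpha> by (intro mult_left_mono) auto
        moreover have "?\<theta> * (1 - \<alpha>) = 1 - \<alpha> / 10 - 9 / 10 * (\<alpha> * \<alpha>)"
          by (simp add: field_simps)
        moreover have "(1 + \<alpha>) * ((1 - \<alpha>) - \<alpha> / 30) = 1 - \<alpha> / 30 - 31 / 30 * (\<alpha> * \<alpha>)"
          by (simp add: field_simps)
        moreover have "1 - \<alpha> / 10 - 9 / 10 * s \<le> 1 - \<alpha> / 30 - 31 / 30 * s" if "s \<le> \<alpha> * (1 / 2)" for s
          using that by linarith
        ultimately show ?thesis by (simp only:)
      qed
      then have "?\<theta> * (1 - \<alpha>) * real k \<le> (1 + \<alpha>) * ((1 - \<alpha>) - \<alpha> / 30) * real k"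
        by (intro mult_right_mono) auto
      moreover have "(1 - \<alpha>) * real k - \<alpha> * real k / 30 = ((1 - \<alpha>) - \<alpha> / 30) * real k"
        by (simp add: left_diff_distrib)
      ultimately show ?thesis
        by (simp only: mult.assoc)
    qed
    finally have "(1 + \<alpha>) * (?\<theta> * tau l * real m) \<le> (1 + \<alpha>) * ((1 - \<alpha>) * real k - \<alpha> * real k / 30)"
      by (simp only: mult.assoc)
    moreover have "0 < 1 + \<alpha>" using \<alpha> by simp
    ultimately show ?thesis
      by (simp only: mult_le_cancel_left_pos)
  qed
  \<comment> \<open>The gap \<alpha> k / 30 holds the at most \<alpha> k / 50 steps, the margin
    \<alpha> k / 100 and the rounding of \<open>c\<close> by at most 1, because \<alpha> k / 300
    \<ge> 1.\<close>
  then have cd: "real (c + d) \<le> T - \<alpha> * real k / 100"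
    using c(2) d k300 unfolding T_def by simp
  have "occ_mean t m l (\<lambda>x. of_bool (too_many m l x)) \<le> occ_mean t m l (\<lambda>x. of_bool (c + d \<le> x))"
    using cd by (intro occ_mean_mono) (auto simp: too_many_def)
  also have "\<dots> \<le> (exp (\<alpha> / 2) / ?\<theta>) ^ d * (real (n * r) / real k) + real n * D / (1 - exp (\<alpha> / 2) / ?\<theta>)"
  proof (rule upper_tail [OF km mn l gd dp])
    have "exp (\<alpha> / 2) / ?\<theta> \<le> exp (- (\<alpha> / 10))" by (rule upper_rate)
    also have "\<dots> < 1" using \<alpha> by simp
    finally show "exp (\<alpha> / 2) / ?\<theta> < 1" .
  qed (use c D \<alpha> in auto)
  also have "\<dots> \<le> exp (- (\<alpha>\<^sup>2 * real k / 600)) * (real (n * r) / real k) + 20 * real n * D / \<alpha>"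
    unfolding d_def using \<alpha> D k300 by (intro tail_bound upper_rate) auto
  finally show ?thesis .
next
  case False
  then have "occ_mean t m l (\<lambda>x. of_bool (too_many m l x)) = 0"
    by (simp add: too_many_def occ_mean_def occupation_def path_mean_def)
  then show ?thesis using D \<alpha> by (simp add: add_nonneg_nonneg)
qed

lemma too_few_bound:
  "occ_mean t m l (\<lambda>x. of_bool (too_few m l x)) \<le>
    exp (- (\<alpha>\<^sup>2 * real k / 600)) * (real (n * r) / real k) + 20 * real n * D / \<alpha>"
proof (cases "tau l * real m \<le> real k \<and> real k < (1 + \<alpha> / 4) * (tau l * real m)")
  case True
  let ?\<theta> = "1 - 7 / 10 * \<alpha>"
  define c where "c = nat \<lfloor>T + \<alpha> * real k / 100\<rfloor>"
  define d where "d = nat \<lfloor>\<alpha> * real k / 50\<rfloor>"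
  have T0: "0 \<le> T + \<alpha> * real k / 100"
    using T_pos \<alpha> by simp
  then have c: "real c \<le> T + \<alpha> * real k / 100"
    unfolding c_def by linarith
  have d: "real d \<le> \<alpha> * real k / 50"
    unfolding d_def using k300 by linarith
  \<comment> \<open>\<open>T\<close> plus the margin is (1 - 99 / 100 \<alpha>) k, and \<alpha> k /
    50 steps upwards lead to (1 - 97 / 100 \<alpha>) k.\<close>
  have "(1 - 97 / 100 * \<alpha>) * real k \<le> ?\<theta> * tau l * real m"
  proof -
    have "(1 + \<alpha> / 4) * ((1 - 97 / 100 * \<alpha>) * real k) \<le> ?\<theta> * real k"
    proof -
      have "(1 + \<alpha> / 4) * (1 - 97 / 100 * \<alpha>) \<le> ?\<theta>"
        using \<alpha> by (simp add: algebra_simps)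
      from mult_right_mono [OF this, of "real k"] show ?thesis
        by (simp add: mult.assoc)
    qed
    also have "\<dots> \<le> ?\<theta> * ((1 + \<alpha> / 4) * (tau l * real m))"
      using True \<alpha> by (intro mult_left_mono) auto
    finally have "(1 + \<alpha> / 4) * ((1 - 97 / 100 * \<alpha>) * real k) \<le> (1 + \<alpha> / 4) * (?\<theta> * tau l * real m)"
      by (simp only: mult_ac)
    then show ?thesis
      using \<alpha> by (simp only: mult_le_cancel_left_pos)
  qed
  then have cd: "real (c + d) \<le> ?\<theta> * tau l * real m"
    using c d by (simp add: T_def algebra_simps)
  have "occ_mean t m l (\<lambda>x. of_bool (too_few m l x)) \<le> occ_mean t m l (\<lambda>x. of_bool (x \<le> c))"
  proof (intro occ_mean_mono)
    fix x
    show "of_bool (too_few m l x) \<le> (of_bool (x \<le> c) :: real)"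
      unfolding too_few_def c_def using T0 by (auto simp: le_nat_iff le_floor_iff)
  qed
  also have "\<dots> \<le> (exp (\<alpha> / 2) * ?\<theta>) ^ d * (real (n * r) / real k) + real n * D / (1 - exp (\<alpha> / 2) * ?\<theta>)"
  proof (rule lower_tail [OF km mn l gd dp])
    have "exp (\<alpha> / 2) * ?\<theta> \<le> exp (- (\<alpha> / 10))" by (rule lower_rate)
    also have "\<dots> < 1" using \<alpha> by simp
    finally show "exp (\<alpha> / 2) * ?\<theta> < 1" .
  qed (use cd D \<alpha> in auto)
  also have "\<dots> \<le> exp (- (\<alpha>\<^sup>2 * real k / 600)) * (real (n * r) / real k) + 20 * real n * D / \<alpha>"
    unfolding d_def using \<alpha> D k300 by (intro tail_bound lower_rate) auto
  finally show ?thesis .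
next
  case False
  then have "occ_mean t m l (\<lambda>x. of_bool (too_few m l x)) = 0"
    by (auto simp: too_few_def occ_mean_def occupation_def path_mean_def)
  then show ?thesis using D \<alpha> by (simp add: add_nonneg_nonneg)
qed

end

text \<open>The probability of some inaccurate answer is at most the expected number of them.
  Typical queries fail through the noise; atypical ones are counted by occupation measures for at
  most n sizes, \<open>steps\<close> thresholds and two directions, whence the factor 2 n steps.
  \<open>D\<close> is the truncation error of the likelihood ratio for functionals bounded by
  \<open>N\<close>.\<close>

lemma failure_bound:
  fixes q r t :: nat
  defines "N \<equiv> real (n * r) / real k"
  defines "D \<equiv> exp (8 * (real q * (exp e - 1))\<^sup>2 * real r - \<alpha> / 2 * (real q - 1)) * N"
  assumes gd: "AE \<rho> in keysM. good r t \<rho>"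
    and q: "0 < q" "real q * (exp e - 1) \<le> 1 / 4"
    and k300: "300 \<le> \<alpha> * real k"
  shows "(\<integral>\<rho>. path_mean t \<rho> (\<lambda>os. of_bool (\<exists>j<t. \<not> accurate (Q (take j os)) (os ! j))) \<partial>keysM) \<le>
    (real steps + 1) * exp (- (e * \<alpha> * real k / 100)) * N +
    2 * real n * real steps * (exp (- (\<alpha>\<^sup>2 * real k / 600)) * N + 20 * real n * D / \<alpha>)"
proof -
  interpret prob_space keysM by (rule prob_space_keysM)
  have N: "0 \<le> N" and D: "0 \<le> D" by (auto simp: N_def D_def)
  let ?\<delta> = "(real steps + 1) * exp (- (e * \<alpha> * real k / 100)) * N"
  let ?\<eta> = "exp (- (\<alpha>\<^sup>2 * real k / 600)) * N + 20 * real n * D / \<alpha>"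
  let ?V = "\<lambda>os j. Q (take j os)"
  let ?M = "\<lambda>m l \<rho>. path_mean t \<rho> (occupation t m l (\<lambda>x. of_bool (too_many m l x)) \<rho>)"
  let ?F = "\<lambda>m l \<rho>. path_mean t \<rho> (occupation t m l (\<lambda>x. of_bool (too_few m l x)) \<rho>)"
  have dp: "path_mean t \<rho> g \<le> exp (\<alpha> / 2) * path_mean t (\<rho>(i := y)) g + D"
    if "i \<in> {1..n}" and good: "good r t \<rho>" "good r t (\<rho>(i := y))" and g: "\<And>os. 0 \<le> g os"
      "\<And>os. g os \<le> full_queries t os" for i \<rho> y g
    unfolding D_def
  proof (rule key_dp [OF that(1-3) q N g(1)])
    show "g os \<le> N" if "os \<in> paths steps t" "0 < path_prob (K \<rho>) os" for os
      using order_trans [OF g(2) full_queries_bound [OF good(1) that]] by (simp add: N_def)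
  qed
  have "path_mean t \<rho> (\<lambda>os. of_bool (\<exists>j<t. \<not> accurate (?V os j) (os ! j))) \<le>
      ?\<delta> + (\<Sum>m\<in>{k..n}. \<Sum>l<steps. ?M m l \<rho> + ?F m l \<rho>)" if good: "good r t \<rho>" for \<rho>
  proof -
    let ?g1 = "\<lambda>os. \<Sum>j<t. of_bool (k \<le> card (?V os j) \<and> \<not> atypical \<rho> (?V os j) \<and> \<not> accurate (?V os j) (os ! j)) :: real"
    let ?g2 = "\<lambda>os. \<Sum>m\<in>{k..n}. \<Sum>l<steps. occupation t m l (\<lambda>x. of_bool (too_many m l x)) \<rho> os +
      occupation t m l (\<lambda>x. of_bool (too_few m l x)) \<rho> os"
    have "path_mean t \<rho> (\<lambda>os. of_bool (\<exists>j<t. \<not> accurate (?V os j) (os ! j))) \<le> path_mean t \<rho> (\<lambda>os. ?g1 os + ?g2 os)"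
    proof (rule path_mean_mono)
      fix os
      have "of_bool (\<exists>j<t. \<not> accurate (?V os j) (os ! j)) \<le>
          (\<Sum>j<t. of_bool (\<not> accurate (?V os j) (os ! j)) :: real)"
      proof (cases "\<exists>j<t. \<not> accurate (?V os j) (os ! j)")
        case True
        then obtain j where j: "j < t" "\<not> accurate (?V os j) (os ! j)" by auto
        have "of_bool (\<not> accurate (?V os j) (os ! j)) \<le>
            (\<Sum>j<t. of_bool (\<not> accurate (?V os j) (os ! j)) :: real)"
          using j by (intro member_le_sum) auto
        then show ?thesis using True j by simp
      qed (simp add: sum_nonneg)
      also have "\<dots> \<le> (\<Sum>j<t. of_bool (k \<le> card (?V os j) \<and> \<not> atypical \<rho> (?V os j) \<and> \<not> accurate (?V os j) (os ! j)) +
          of_bool (k \<le> card (?V os j) \<and> atypical \<rho> (?V os j)))"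
        using accurate_small by (intro sum_mono) (auto simp: not_le [symmetric])
      also have "\<dots> \<le> ?g1 os + ?g2 os"
        unfolding sum.distrib [of _ _ "{..<t}"] by (intro add_left_mono atypical_count)
      finally show "of_bool (\<exists>j<t. \<not> accurate (?V os j) (os ! j)) \<le> ?g1 os + ?g2 os" .
    qed
    also have "\<dots> = path_mean t \<rho> ?g1 + path_mean t \<rho> ?g2"
      by (simp add: path_mean_def distrib_left sum.distrib)
    also have "path_mean t \<rho> ?g1 \<le> ?\<delta>"
      using typical_inaccurate_mean [OF good] by (simp add: N_def)
    also have "path_mean t \<rho> ?g2 = (\<Sum>m\<in>{k..n}. \<Sum>l<steps. ?M m l \<rho> + ?F m l \<rho>)"
    proof -
      have "path_mean t \<rho> ?g2 = (\<Sum>os\<in>paths steps t. \<Sum>m\<in>{k..n}. \<Sum>l<steps.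
          path_prob (K \<rho>) os * (occupation t m l (\<lambda>x. of_bool (too_many m l x)) \<rho> os +
            occupation t m l (\<lambda>x. of_bool (too_few m l x)) \<rho> os))"
        unfolding path_mean_def sum_distrib_left ..
      also have "\<dots> = (\<Sum>m\<in>{k..n}. \<Sum>os\<in>paths steps t. \<Sum>l<steps.
          path_prob (K \<rho>) os * (occupation t m l (\<lambda>x. of_bool (too_many m l x)) \<rho> os +
            occupation t m l (\<lambda>x. of_bool (too_few m l x)) \<rho> os))"
        by (rule sum.swap)
      also have "\<dots> = (\<Sum>m\<in>{k..n}. \<Sum>l<steps. \<Sum>os\<in>paths steps t.
          path_prob (K \<rho>) os * (occupation t m l (\<lambda>x. of_bool (too_many m l x)) \<rho> os +
            occupation t m l (\<lambda>x. of_bool (too_few m l x)) \<rho> os))"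
        by (intro sum.cong refl sum.swap)
      finally show ?thesis
        by (simp only: path_mean_def distrib_left sum.distrib)
    qed
    finally show ?thesis by simp
  qed
  then have "AE \<rho> in keysM. path_mean t \<rho> (\<lambda>os. of_bool (\<exists>j<t. \<not> accurate (?V os j) (os ! j))) \<le>
      ?\<delta> + (\<Sum>m\<in>{k..n}. \<Sum>l<steps. ?M m l \<rho> + ?F m l \<rho>)"
    using gd by (auto elim: eventually_mono)
  then have "(\<integral>\<rho>. path_mean t \<rho> (\<lambda>os. of_bool (\<exists>j<t. \<not> accurate (?V os j) (os ! j))) \<partial>keysM) \<le>
      (\<integral>\<rho>. ?\<delta> + (\<Sum>m\<in>{k..n}. \<Sum>l<steps. ?M m l \<rho> + ?F m l \<rho>) \<partial>keysM)"
  proof (rule integral_mono_AE [rotated 2])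
    show "integrable keysM (\<lambda>\<rho>. path_mean t \<rho> (\<lambda>os. of_bool (\<exists>j<t. \<not> accurate (?V os j) (os ! j))))"
    proof (rule integrable_bounded [OF prob_space_keysM])
      show "(\<lambda>\<rho>. path_mean t \<rho> (\<lambda>os. of_bool (\<exists>j<t. \<not> accurate (?V os j) (os ! j)))) \<in> borel_measurable keysM"
        unfolding path_mean_def by measurable
      show "\<bar>path_mean t \<rho> (\<lambda>os. of_bool (\<exists>j<t. \<not> accurate (?V os j) (os ! j)))\<bar> \<le> 1" for \<rho>
        by (subst abs_of_nonneg) (auto intro!: path_mean_nonneg path_mean_le)
    qed
    show "integrable keysM (\<lambda>\<rho>. ?\<delta> + (\<Sum>m\<in>{k..n}. \<Sum>l<steps. ?M m l \<rho> + ?F m l \<rho>))"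
      by (intro Bochner_Integration.integrable_add Bochner_Integration.integrable_sum
          integrable_occupation integrable_const)
  qed
  also have "\<dots> = ?\<delta> + (\<Sum>m\<in>{k..n}. \<Sum>l<steps. occ_mean t m l (\<lambda>x. of_bool (too_many m l x)) +
      occ_mean t m l (\<lambda>x. of_bool (too_few m l x)))"
  proof -
    have "(\<integral>\<rho>. ?\<delta> + (\<Sum>m\<in>{k..n}. \<Sum>l<steps. ?M m l \<rho> + ?F m l \<rho>) \<partial>keysM) =
        (\<integral>\<rho>. ?\<delta> \<partial>keysM) + (\<integral>\<rho>. (\<Sum>m\<in>{k..n}. \<Sum>l<steps. ?M m l \<rho> + ?F m l \<rho>) \<partial>keysM)"
      by (intro Bochner_Integration.integral_add Bochner_Integration.integrable_add Bochner_Integration.integrable_sum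
          integrable_occupation integrable_const)
    also have "(\<integral>\<rho>. ?\<delta> \<partial>keysM) = ?\<delta>"
      by (simp only: lebesgue_integral_const prob_space real_scaleR_def mult_1_left)
    also have "(\<integral>\<rho>. (\<Sum>m\<in>{k..n}. \<Sum>l<steps. ?M m l \<rho> + ?F m l \<rho>) \<partial>keysM) =
        (\<Sum>m\<in>{k..n}. \<Sum>l<steps. occ_mean t m l (\<lambda>x. of_bool (too_many m l x)) +
          occ_mean t m l (\<lambda>x. of_bool (too_few m l x)))"
      unfolding occ_mean_def
      by (subst Bochner_Integration.integral_sum
          | intro Bochner_Integration.integrable_add Bochner_Integration.integrable_sum
              integrable_occupation sum.cong refl Bochner_Integration.integral_add)+
    finally show ?thesis .
  qed
  also have "\<dots> \<le> ?\<delta> + (\<Sum>m\<in>{k..n}. \<Sum>l<steps. ?\<eta> + ?\<eta>)"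
    unfolding N_def
    by (intro add_left_mono sum_mono add_mono too_many_bound too_few_bound gd dp D k300) auto
  also have "(\<Sum>m\<in>{k..n}. \<Sum>l<steps. ?\<eta> + ?\<eta>) = real (card {k..n}) * real steps * (2 * ?\<eta>)"
    by simp
  also have "\<dots> \<le> real n * real steps * (2 * ?\<eta>)"
    using N D \<alpha> k1 by (intro mult_right_mono) auto
  finally show ?thesis by (simp only: mult_ac)
qed

end

section \<open>Randomized adversaries\<close>

text \<open>The seed becomes the outermost variable, so that the adversary is a deterministic
  function of the answers inside.\<close>

lemma nn_integral_triple:
  assumes "prob_space M1" "prob_space M2" "prob_space M3"
    and f [measurable]: "f \<in> borel_measurable (M1 \<Otimes>\<^sub>M (M2 \<Otimes>\<^sub>M M3))"
  shows "(\<integral>\<^sup>+\<omega>. f \<omega> \<partial>(M1 \<Otimes>\<^sub>M (M2 \<Otimes>\<^sub>M M3))) =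
    (\<integral>\<^sup>+w. \<integral>\<^sup>+x. \<integral>\<^sup>+y. f (x, y, w) \<partial>M2 \<partial>M1 \<partial>M3)"
proof -
  interpret M1: prob_space M1 by fact
  interpret M2: prob_space M2 by fact
  interpret M3: prob_space M3 by fact
  interpret M23: pair_prob_space M2 M3 ..
  interpret M13: pair_prob_space M1 M3 ..
  have "(\<integral>\<^sup>+\<omega>. f \<omega> \<partial>(M1 \<Otimes>\<^sub>M (M2 \<Otimes>\<^sub>M M3))) = (\<integral>\<^sup>+x. \<integral>\<^sup>+p. f (x, p) \<partial>(M2 \<Otimes>\<^sub>M M3) \<partial>M1)"
    by (rule M23.nn_integral_fst [symmetric]) fact
  also have "\<dots> = (\<integral>\<^sup>+x. \<integral>\<^sup>+w. \<integral>\<^sup>+y. f (x, y, w) \<partial>M2 \<partial>M3 \<partial>M1)"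
    by (intro nn_integral_cong M23.nn_integral_snd [symmetric]) measurable
  also have "\<dots> = (\<integral>\<^sup>+w. \<integral>\<^sup>+x. \<integral>\<^sup>+y. f (x, y, w) \<partial>M2 \<partial>M1 \<partial>M3)"
    by (intro M13.Fubini' [symmetric]) measurable
  finally show ?thesis .
qed

lemma AE_triple:
  assumes M: "prob_space M1" "prob_space M2" "prob_space M3"
    and P [measurable]: "Measurable.pred (M1 \<Otimes>\<^sub>M (M2 \<Otimes>\<^sub>M M3)) P"
    and AE: "AE \<omega> in M1 \<Otimes>\<^sub>M (M2 \<Otimes>\<^sub>M M3). P \<omega>"
  shows "AE w in M3. AE x in M1. AE y in M2. P (x, y, w)"
proof -
  interpret M1: prob_space M1 by fact
  interpret M2: prob_space M2 by fact
  interpret M3: prob_space M3 by fact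
  let ?f = "\<lambda>\<omega>. of_bool (\<not> P \<omega>) :: ennreal"
  have "(\<integral>\<^sup>+w. \<integral>\<^sup>+x. \<integral>\<^sup>+y. ?f (x, y, w) \<partial>M2 \<partial>M1 \<partial>M3) = (\<integral>\<^sup>+\<omega>. ?f \<omega> \<partial>(M1 \<Otimes>\<^sub>M (M2 \<Otimes>\<^sub>M M3)))"
    by (rule nn_integral_triple [OF M, symmetric]) measurable
  also have "\<dots> = 0"
    by (subst nn_integral_0_iff_AE) (use AE in \<open>auto elim: eventually_mono\<close>)
  finally have "AE w in M3. (\<integral>\<^sup>+x. \<integral>\<^sup>+y. ?f (x, y, w) \<partial>M2 \<partial>M1) = 0"
    by (subst (asm) nn_integral_0_iff_AE) measurable
  with AE_space show ?thesis
  proof eventually_elim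
    case (elim w)
    note [measurable] = elim(1)
    have "AE x in M1. (\<integral>\<^sup>+y. ?f (x, y, w) \<partial>M2) = 0"
      using elim(2) by (subst (asm) nn_integral_0_iff_AE) measurable
    with AE_space show ?case
    proof eventually_elim
      case (elim x)
      note [measurable] = elim(1)
      have "AE y in M2. ?f (x, y, w) = 0"
        using elim(2) by (subst (asm) nn_integral_0_iff_AE) measurable
      then show ?case by (auto elim: eventually_mono)
    qed
  qed
qed

lemma answers_section:
  "answers k n \<alpha> A (\<rho>, Z, w) j = answers k n \<alpha> (\<lambda>_. A w) (\<rho>, Z, w) j"
  by (induction j) auto

lemma query_section: "query k n \<alpha> A (\<rho>, Z, w) j = query k n \<alpha> (\<lambda>_. A w) (\<rho>, Z, w) j"
  by (simp add: query_def answers_section [of k n \<alpha> A])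

lemma sketch_section: "sketch k n \<alpha> A (\<rho>, Z, w) j = sketch k n \<alpha> (\<lambda>_. A w) (\<rho>, Z, w) j"
  by (simp add: sketch_def query_section [of k n \<alpha> A])

lemma answer_section: "answer k n \<alpha> A (\<rho>, Z, w) j = answer k n \<alpha> (\<lambda>_. A w) (\<rho>, Z, w) j"
  by (simp add: answer_def sketch_section [of k n \<alpha> A])

lemma take_answers: "j \<le> t \<Longrightarrow> take j (answers k n \<alpha> A \<omega> t) = answers k n \<alpha> A \<omega> j"
  by (simp add: answers_eq_map take_map take_upt)

lemma nth_answers: "j < t \<Longrightarrow> answers k n \<alpha> A \<omega> t ! j = answer k n \<alpha> A \<omega> j"
  by (simp add: answers_eq_map)

definition within_budget ::
  "nat \<Rightarrow> nat \<Rightarrow> real \<Rightarrow> (real \<Rightarrow> real list \<Rightarrow> nat set) \<Rightarrow> nat \<Rightarrow> nat \<Rightarrow> (nat \<Rightarrow> real) \<times> (nat \<times> nat \<Rightarrow> real) \<times> real \<Rightarrow> bool" where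
  "within_budget k n \<alpha> A r t \<omega> \<longleftrightarrow>
     (\<forall>i\<in>{1..n}. (\<Sum>j<t. of_bool (i \<in> fst ` sketch k n \<alpha> A \<omega> j)) \<le> r)"

definition all_accurate ::
  "nat \<Rightarrow> nat \<Rightarrow> real \<Rightarrow> (real \<Rightarrow> real list \<Rightarrow> nat set) \<Rightarrow> nat \<Rightarrow> (nat \<Rightarrow> real) \<times> (nat \<times> nat \<Rightarrow> real) \<times> real \<Rightarrow> bool" where
  "all_accurate k n \<alpha> A t \<omega> \<longleftrightarrow>
     (\<forall>j<t. answer k n \<alpha> A \<omega> j \<in>
        {(1 - \<alpha>) * real (card (query k n \<alpha> A \<omega> j)) .. (1 + \<alpha>) * real (card (query k n \<alpha> A \<omega> j))})"

context transcript
begin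

text \<open>A possible transcript comes from a set of noise of positive measure, hence from some
  noise that obeys the budget, and the sketches depend on the noise only through the
  transcript.\<close>

lemma good_of_AE:
  assumes "AE Z in noise. within_budget k n \<alpha> (\<lambda>_. A) r t (\<rho>, Z, w)"
  shows "good r t \<rho>"
  unfolding good_def
proof (intro ballI impI)
  fix os i assume os: "os \<in> paths steps t" and pos: "0 < path_prob (K \<rho>) os" and i: "i \<in> {1..n}"
  have "\<exists>Z. outs \<rho> Z t = os \<and> within_budget k n \<alpha> (\<lambda>_. A) r t (\<rho>, Z, w)"
  proof (rule ccontr)
    assume "\<nexists>Z. outs \<rho> Z t = os \<and> within_budget k n \<alpha> (\<lambda>_. A) r t (\<rho>, Z, w)"
    then have "AE Z in noise. Z \<notin> {Z. outs \<rho> Z t = os}"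
      using assms by (auto elim!: eventually_mono)
    then have "measure noise {Z. outs \<rho> Z t = os} = 0"
      using prob_outs(1) [OF os] by (intro noise.P.prob_eq_0 [THEN iffD2]) auto
    then show False
      using pos by (simp add: prob_outs(2) [OF os])
  qed
  then obtain Z where Z: "outs \<rho> Z t = os" and b: "within_budget k n \<alpha> (\<lambda>_. A) r t (\<rho>, Z, w)"
    by blast
  have "(\<Sum>j<t. of_bool (i \<in> fst ` bk_sketch k \<rho> (Q (take j os)))) =
      (\<Sum>j<t. of_bool (i \<in> fst ` sketch k n \<alpha> (\<lambda>_. A) (\<rho>, Z, w) j) :: nat)"
    by (intro sum.cong refl) (simp add: sketch_eq Z [symmetric] take_outs)
  also have "\<dots> \<le> r"
    using b i unfolding within_budget_def by blast
  finally show "(\<Sum>j<t. of_bool (i \<in> fst ` bk_sketch k \<rho> (Q (take j os)))) \<le> r" .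
qed

lemma measure_inaccurate:
  "{Z. \<not> all_accurate k n \<alpha> (\<lambda>_. A) t (\<rho>, Z, w)} \<in> sets noise"
  "measure noise {Z. \<not> all_accurate k n \<alpha> (\<lambda>_. A) t (\<rho>, Z, w)} =
     path_mean t \<rho> (\<lambda>os. of_bool (\<exists>j<t. \<not> accurate (Q (take j os)) (os ! j)))"
proof -
  let ?P = "\<lambda>os. \<exists>j<t. \<not> accurate (Q (take j os)) (os ! j)"
  have "{Z. \<not> all_accurate k n \<alpha> (\<lambda>_. A) t (\<rho>, Z, w)} = {Z. ?P (outs \<rho> Z t)}"
  proof (intro Collect_cong)
    fix Z
    have "accurate (Q (take j (outs \<rho> Z t))) (outs \<rho> Z t ! j) \<longleftrightarrow>
        answer k n \<alpha> (\<lambda>_. A) (\<rho>, Z, w) j \<in>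
          {(1 - \<alpha>) * real (card (query k n \<alpha> (\<lambda>_. A) (\<rho>, Z, w) j)) ..
           (1 + \<alpha>) * real (card (query k n \<alpha> (\<lambda>_. A) (\<rho>, Z, w) j))}" if "j < t" for j
      using that by (simp only: accurate_def answer_eq [OF that] query_eq take_outs less_imp_le)
    then show "\<not> all_accurate k n \<alpha> (\<lambda>_. A) t (\<rho>, Z, w) \<longleftrightarrow> ?P (outs \<rho> Z t)"
      unfolding all_accurate_def by blast
  qed
  then show "{Z. \<not> all_accurate k n \<alpha> (\<lambda>_. A) t (\<rho>, Z, w)} \<in> sets noise"
    "measure noise {Z. \<not> all_accurate k n \<alpha> (\<lambda>_. A) t (\<rho>, Z, w)} =
     path_mean t \<rho> (\<lambda>os. of_bool (\<exists>j<t. \<not> accurate (Q (take j os)) (os ! j)))"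
    using prob_outs_set [of ?P \<rho> t] by (simp_all add: path_mean_def)
qed

lemma nn_integral_inaccurate:
  "(\<integral>\<^sup>+\<rho>. \<integral>\<^sup>+Z. of_bool (\<not> all_accurate k n \<alpha> (\<lambda>_. A) t (\<rho>, Z, w)) \<partial>noise \<partial>keysM) =
    ennreal (\<integral>\<rho>. path_mean t \<rho> (\<lambda>os. of_bool (\<exists>j<t. \<not> accurate (Q (take j os)) (os ! j))) \<partial>keysM)"
proof -
  let ?g = "\<lambda>\<rho>. path_mean t \<rho> (\<lambda>os. of_bool (\<exists>j<t. \<not> accurate (Q (take j os)) (os ! j)))"
  have "(\<integral>\<^sup>+Z. of_bool (\<not> all_accurate k n \<alpha> (\<lambda>_. A) t (\<rho>, Z, w)) \<partial>noise) = ennreal (?g \<rho>)" for \<rho>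
  proof -
    have "(\<integral>\<^sup>+Z. of_bool (\<not> all_accurate k n \<alpha> (\<lambda>_. A) t (\<rho>, Z, w)) \<partial>noise) =
        (\<integral>\<^sup>+Z. indicator {Z. \<not> all_accurate k n \<alpha> (\<lambda>_. A) t (\<rho>, Z, w)} Z \<partial>noise)"
      by (intro nn_integral_cong) (simp add: indicator_def)
    also have "\<dots> = ennreal (?g \<rho>)"
      using measure_inaccurate [of t \<rho> w] by (simp add: noise.P.emeasure_eq_measure)
    finally show ?thesis .
  qed
  then have "(\<integral>\<^sup>+\<rho>. \<integral>\<^sup>+Z. of_bool (\<not> all_accurate k n \<alpha> (\<lambda>_. A) t (\<rho>, Z, w)) \<partial>noise \<partial>keysM) =
      (\<integral>\<^sup>+\<rho>. ennreal (?g \<rho>) \<partial>keysM)" by simp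
  also have "\<dots> = ennreal (\<integral>\<rho>. ?g \<rho> \<partial>keysM)"
  proof (rule nn_integral_eq_integral)
    show "integrable keysM ?g"
    proof (rule integrable_bounded [OF prob_space_keysM])
      show "?g \<in> borel_measurable keysM"
        unfolding path_mean_def by measurable
      show "\<bar>?g \<rho>\<bar> \<le> 1" for \<rho>
        by (subst abs_of_nonneg) (auto intro!: path_mean_nonneg path_mean_le)
    qed
  qed (auto intro!: path_mean_nonneg)
  finally show ?thesis .
qed

end

section \<open>Measurability of the game and integration over the seed\<close>

context estimator
begin

text \<open>A countable set containing all replies. The adversary is measurable only for each fixed
  answer list, so joint measurability is obtained by splitting over the countably many
  lists.\<close>

definition reply_set :: "real set" where
  "reply_set = range real \<union> range (\<lambda>l. T / tau l)"

abbreviation gameM :: "real measure \<Rightarrow> ((nat \<Rightarrow> real) \<times> (nat \<times> nat \<Rightarrow> real) \<times> real) measure" where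
  "gameM W \<equiv> keysM \<Otimes>\<^sub>M (noise \<Otimes>\<^sub>M W)"

lemma reply_set_mem: "real m \<in> reply_set" "T / tau l \<in> reply_set"
  unfolding reply_set_def by blast+

lemma countable_replies: "countable (lists reply_set)"
  unfolding reply_set_def by (intro countable_lists countable_Un countable_image) auto

lemma prob_space_noise: "prob_space noise"
  using e by (intro prob_space_PiM prob_space_laplace) simp

context
  fixes W :: "real measure" and A :: "real \<Rightarrow> real list \<Rightarrow> nat set"
  assumes W: "prob_space W"
    and A: "\<And>as. (\<lambda>w. A w as) \<in> W \<rightarrow>\<^sub>M count_space (Pow {1..n})"
begin

lemma query_measurable: "(\<lambda>\<omega>. A (snd (snd \<omega>)) as) \<in> gameM W \<rightarrow>\<^sub>M count_space (Pow {1..n})"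
  by (rule measurable_compose [OF _ A]) measurable

lemma compose_query_measurable:
  assumes "\<And>V. V \<subseteq> {1..n} \<Longrightarrow> f V \<in> gameM W \<rightarrow>\<^sub>M N"
  shows "(\<lambda>\<omega>. f (A (snd (snd \<omega>)) as) \<omega>) \<in> gameM W \<rightarrow>\<^sub>M N"
proof (rule measurable_compose_countable' [where I = "Pow {1..n}" and g = "\<lambda>\<omega>. A (snd (snd \<omega>)) as"])
  show "f V \<in> gameM W \<rightarrow>\<^sub>M N" if "V \<in> Pow {1..n}" for V
    using that by (intro assms) simp
  show "countable (Pow {1..n})" by (rule countable_finite) simp
qed (rule query_measurable)

lemma stop_measurable:
  assumes V: "V \<subseteq> {1..n}"
  shows "(\<lambda>\<omega>. stop (fst \<omega>) V (\<lambda>m. fst (snd \<omega>) (j, m))) \<in> gameM W \<rightarrow>\<^sub>M count_space UNIV"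
proof -
  have [measurable]: "(\<lambda>\<omega>. real (hits (fst \<omega>) V m)) \<in> borel_measurable (gameM W)" for m
  proof -
    have "(\<lambda>c. real (min k c)) \<in> borel_measurable (count_space UNIV)" by simp
    from measurable_compose [OF measurable_compose [OF measurable_fst cnt_measurable [OF V]] this]
    show ?thesis by (simp add: hits_def cnt_def)
  qed
  have "(\<lambda>Z. Z jm) \<in> borel_measurable noise" for jm
  proof -
    have "measurable noise (laplace (1 / e)) = borel_measurable noise"
      by (rule measurable_cong_sets) simp_all
    then show ?thesis
      using measurable_component_singleton [of jm UNIV "\<lambda>_. laplace (1 / e)"] by simp
  qed
  from measurable_compose [OF measurable_compose [OF measurable_snd measurable_fst] this]
  have [measurable]: "(\<lambda>\<omega>. fst (snd \<omega>) jm) \<in> borel_measurable (gameM W)" for jm .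
  show ?thesis
    unfolding stop_def by measurable
qed

lemma query_subset: "\<omega> \<in> space (gameM W) \<Longrightarrow> A (snd (snd \<omega>)) as \<subseteq> {1..n}"
  using measurable_space [OF query_measurable [of as]] by simp

lemma answers_measurable:
  "(\<lambda>\<omega>. answers k n \<alpha> A \<omega> j) \<in> gameM W \<rightarrow>\<^sub>M count_space (lists reply_set)"
proof (induction j)
  case 0
  show ?case by simp
next
  case (Suc j)
  let ?r = "\<lambda>V \<omega>. if card V < k then real (card V) else T / tau (stop (fst \<omega>) V (\<lambda>m. fst (snd \<omega>) (j, m)))"
  have "(\<lambda>\<omega>. answers k n \<alpha> A \<omega> j @ [?r (A (snd (snd \<omega>)) (answers k n \<alpha> A \<omega> j)) \<omega>]) \<in>
      gameM W \<rightarrow>\<^sub>M count_space (lists reply_set)"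
  proof (rule measurable_compose_countable' [OF _ Suc countable_replies])
    fix as assume as: "as \<in> lists reply_set"
    show "(\<lambda>\<omega>. as @ [?r (A (snd (snd \<omega>)) as) \<omega>]) \<in> gameM W \<rightarrow>\<^sub>M count_space (lists reply_set)"
    proof (rule compose_query_measurable)
      fix V :: "nat set" assume V: "V \<subseteq> {1..n}"
      show "(\<lambda>\<omega>. as @ [?r V \<omega>]) \<in> gameM W \<rightarrow>\<^sub>M count_space (lists reply_set)"
      proof (cases "card V < k")
        case True
        then show ?thesis using as reply_set_mem(1) by simp
      next
        case False
        have "(\<lambda>x. as @ [T / tau x]) \<in> count_space UNIV \<rightarrow>\<^sub>M count_space (lists reply_set)"
          using as reply_set_mem(2) by simp
        from measurable_compose [OF stop_measurable [OF V] this] False show ?thesis by simp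
      qed
    qed
  qed
  then show ?case
  proof (rule measurable_cong [THEN iffD1, rotated])
    fix \<omega> assume \<omega>: "\<omega> \<in> space (gameM W)"
    have "finite (A (snd (snd \<omega>)) (answers k n \<alpha> A \<omega> j))"
      using query_subset [OF \<omega>] finite_subset by blast
    then show "answers k n \<alpha> A \<omega> j @ [?r (A (snd (snd \<omega>)) (answers k n \<alpha> A \<omega> j)) \<omega>] = answers k n \<alpha> A \<omega> (Suc j)"
      by (simp add: robust_est_eq split_beta)
  qed
qed

lemma pred_answers:
  assumes "\<And>as. Measurable.pred (gameM W) (P as)"
  shows "Measurable.pred (gameM W) (\<lambda>\<omega>. P (answers k n \<alpha> A \<omega> j) \<omega>)"
  by (rule measurable_compose_countable' [OF _ answers_measurable countable_replies]) (rule assms)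

lemma query_eq_answers: "query k n \<alpha> A \<omega> j = A (snd (snd \<omega>)) (answers k n \<alpha> A \<omega> j)"
  by (simp add: query_def split_beta)

lemma pred_within_budget: "Measurable.pred (gameM W) (within_budget k n \<alpha> A r t)"
proof -
  have [measurable]: "Measurable.pred (gameM W) (\<lambda>\<omega>. i \<in> fst ` sketch k n \<alpha> A \<omega> j)" for i j
    unfolding sketch_def query_eq_answers
    by (rule pred_answers [where P = "\<lambda>as \<omega>. i \<in> fst ` bk_sketch k (fst \<omega>) (A (snd (snd \<omega>)) as)"],
        rule compose_query_measurable [where f = "\<lambda>V \<omega>. i \<in> fst ` bk_sketch k (fst \<omega>) V"],
        rule measurable_compose [OF measurable_fst pred_in_sketch])
  have "(\<lambda>\<omega>. \<Sum>j<t. if i \<in> fst ` sketch k n \<alpha> A \<omega> j then 1 else 0 :: nat) \<in>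
      gameM W \<rightarrow>\<^sub>M count_space UNIV" for i
    by measurable
  then have [measurable]: "(\<lambda>\<omega>. \<Sum>j<t. of_bool (i \<in> fst ` sketch k n \<alpha> A \<omega> j) :: nat) \<in>
      gameM W \<rightarrow>\<^sub>M count_space UNIV" for i
    by (simp only: of_bool_def)
  show ?thesis
    unfolding within_budget_def by measurable
qed

lemma pred_all_accurate: "Measurable.pred (gameM W) (all_accurate k n \<alpha> A t)"
proof -
  let ?ok = "\<lambda>V x. x \<in> {(1 - \<alpha>) * real (card V) .. (1 + \<alpha>) * real (card V)}"
  have "Measurable.pred (gameM W) (\<lambda>\<omega>. ?ok (A (snd (snd \<omega>)) (take j as)) (as ! j))" for as j
    by (rule compose_query_measurable [where f = "\<lambda>V \<omega>. ?ok V (as ! j)"]) simp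
  then have *: "Measurable.pred (gameM W) (\<lambda>\<omega>. \<forall>j\<in>{..<t}. ?ok (A (snd (snd \<omega>)) (take j as)) (as ! j))" for as
    by (intro pred_intros_finite) auto
  have "Measurable.pred (gameM W) (\<lambda>\<omega>. \<forall>j\<in>{..<t}. ?ok
      (A (snd (snd \<omega>)) (take j (answers k n \<alpha> A \<omega> t))) (answers k n \<alpha> A \<omega> t ! j))"
    by (rule pred_answers [where P = "\<lambda>as \<omega>. \<forall>j\<in>{..<t}. ?ok (A (snd (snd \<omega>)) (take j as)) (as ! j)"]) (rule *)
  then show ?thesis
    unfolding all_accurate_def query_eq_answers
    by (rule measurable_cong [THEN iffD1, rotated]) (auto simp: take_answers nth_answers)
qed

lemma game_failure_bound:
  fixes q :: nat
  assumes budget: "AE \<omega> in gameM W. within_budget k n \<alpha> A r t \<omega>"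
    and q: "0 < q" "real q * (exp e - 1) \<le> 1 / 4"
    and k300: "300 \<le> \<alpha> * real k"
    and \<beta>: "(real steps + 1) * exp (- (e * \<alpha> * real k / 100)) * (real (n * r) / real k) +
      2 * real n * real steps * (exp (- (\<alpha>\<^sup>2 * real k / 600)) * (real (n * r) / real k) +
        20 * real n * (exp (8 * (real q * (exp e - 1))\<^sup>2 * real r - \<alpha> / 2 * (real q - 1)) *
          (real (n * r) / real k)) / \<alpha>) \<le> \<beta>"
  shows "measure (gameM W) {\<omega> \<in> space (gameM W). all_accurate k n \<alpha> A t \<omega>} \<ge> 1 - \<beta>"
proof -
  interpret keys: prob_space keysM by (intro prob_space_PiM prob_space_unif)
  interpret noise: prob_space noise by (rule prob_space_noise)
  interpret W: prob_space W by (rule W)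
  interpret NW: pair_prob_space noise W ..
  interpret G: pair_prob_space keysM "noise \<Otimes>\<^sub>M W" ..
  note spaces = keys.prob_space_axioms prob_space_noise W
  have [measurable]: "Measurable.pred (gameM W) (all_accurate k n \<alpha> A t)"
    by (rule pred_all_accurate)
  let ?f = "\<lambda>\<omega>. of_bool (\<not> all_accurate k n \<alpha> A t \<omega>) :: ennreal"
  have "emeasure (gameM W) {\<omega> \<in> space (gameM W). \<not> all_accurate k n \<alpha> A t \<omega>} = (\<integral>\<^sup>+\<omega>. ?f \<omega> \<partial>gameM W)"
  proof -
    have "{\<omega> \<in> space (gameM W). \<not> all_accurate k n \<alpha> A t \<omega>} \<in> sets (gameM W)" by measurable
    from nn_integral_indicator [OF this, symmetric] show ?thesis
      by (simp only:) (rule nn_integral_cong, simp add: indicator_def)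
  qed
  also have "\<dots> = (\<integral>\<^sup>+w. \<integral>\<^sup>+\<rho>. \<integral>\<^sup>+Z. ?f (\<rho>, Z, w) \<partial>noise \<partial>keysM \<partial>W)"
    by (rule nn_integral_triple [OF spaces]) measurable
  also have "\<dots> \<le> (\<integral>\<^sup>+w. ennreal \<beta> \<partial>W)"
  proof (rule nn_integral_mono_AE)
    \<comment> \<open>The almost sure budget descends to almost every seed, where
      \<open>good_of_AE\<close> turns it into a property of the keys.\<close>
    have "AE w in W. AE \<rho> in keysM. AE Z in noise. within_budget k n \<alpha> A r t (\<rho>, Z, w)"
      by (rule AE_triple [OF spaces pred_within_budget budget])
    with AE_space show "AE w in W. (\<integral>\<^sup>+\<rho>. \<integral>\<^sup>+Z. ?f (\<rho>, Z, w) \<partial>noise \<partial>keysM) \<le> ennreal \<beta>"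
    proof eventually_elim
      case (elim w)
      interpret transcript k n \<alpha> e "A w"
      proof unfold_locales
        show "A w as \<subseteq> {1..n}" for as
          using measurable_space [OF A elim(1), of as] by simp
      qed
      have "AE \<rho> in keysM. good r t \<rho>"
        using elim(2)
      proof eventually_elim
        case (elim \<rho>)
        then show ?case
          unfolding within_budget_def sketch_section [of k n \<alpha> A]
          by (intro good_of_AE [of r t \<rho> w]) (simp add: within_budget_def)
      qed
      from order_trans [OF failure_bound [OF this q k300] \<beta>]
      have "(\<integral>\<^sup>+\<rho>. \<integral>\<^sup>+Z. of_bool (\<not> all_accurate k n \<alpha> (\<lambda>_. A w) t (\<rho>, Z, w)) \<partial>noise \<partial>keysM) \<le> ennreal \<beta>"
        unfolding nn_integral_inaccurate by (rule ennreal_leI)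
      then show ?case
        by (simp only: all_accurate_def answer_section [of k n \<alpha> A] query_section [of k n \<alpha> A])
    qed
  qed
  also have "\<dots> = ennreal \<beta>"
    by (simp add: W.emeasure_space_1)
  finally have "ennreal (measure (gameM W) {\<omega> \<in> space (gameM W). \<not> all_accurate k n \<alpha> A t \<omega>}) \<le> ennreal \<beta>"
    by (simp only: G.emeasure_eq_measure)
  moreover have "0 \<le> \<beta>"
    using \<alpha> by (intro order_trans [OF _ \<beta>] add_nonneg_nonneg mult_nonneg_nonneg divide_nonneg_nonneg) auto
  ultimately have "measure (gameM W) {\<omega> \<in> space (gameM W). \<not> all_accurate k n \<alpha> A t \<omega>} \<le> \<beta>"
    by simp
  moreover have acc: "{\<omega> \<in> space (gameM W). all_accurate k n \<alpha> A t \<omega>} \<in> sets (gameM W)"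
    by measurable
  have "{\<omega> \<in> space (gameM W). \<not> all_accurate k n \<alpha> A t \<omega>} =
      space (gameM W) - {\<omega> \<in> space (gameM W). all_accurate k n \<alpha> A t \<omega>}"
    by blast
  then have "measure (gameM W) {\<omega> \<in> space (gameM W). \<not> all_accurate k n \<alpha> A t \<omega>} =
      1 - measure (gameM W) {\<omega> \<in> space (gameM W). all_accurate k n \<alpha> A t \<omega>}"
    using G.prob_compl [OF acc] by (simp only:)
  ultimately show ?thesis by linarith
qed

end

end

section \<open>The choice of the sketch size\<close>

text \<open>The hypothesis 2 \<beta> \<le> n gives ln 2 \<le> ln (n / \<beta>), so ln 4 = 2 ln 2 is
  absorbed by the factor 3.\<close>

lemma log_bounds:
  fixes n :: nat and \<beta> :: real
  assumes n: "1 \<le> n" and \<beta>: "0 < \<beta>" "\<beta> < 1" "2 * \<beta> \<le> real n"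
  shows "1 \<le> ln (4 * real n / \<beta>)" "ln (4 * real n / \<beta>) \<le> 3 * ln (real n / \<beta>)"
proof -
  have nb: "1 < real n / \<beta>" "2 \<le> real n / \<beta>"
    using n \<beta> by (auto simp: field_simps)
  have ln4: "ln (4::real) = 2 * ln 2"
    using ln_realpow [of 2 2] by simp
  have ln2: "1 / 2 \<le> ln (2::real)"
    using ln_le_minus_one [of "1 / 2 :: real"] by (simp add: ln_div)
  have l: "ln 2 \<le> ln (real n / \<beta>)"
    using nb by (intro ln_mono) auto
  have "ln (4 * real n / \<beta>) = ln (4 * (real n / \<beta>))" by simp
  also have "\<dots> = 2 * ln 2 + ln (real n / \<beta>)"
    using nb by (subst ln_mult_pos) (auto simp: ln4)
  finally show "1 \<le> ln (4 * real n / \<beta>)" "ln (4 * real n / \<beta>) \<le> 3 * ln (real n / \<beta>)"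
    using l ln2 by linarith+
qed

text \<open>Every rate is brought down to exp (- 5 L). The exponent 5 matches the degree of the
  polynomial: n for the size of the query, n for the threshold, n for the keys summed in
  \<open>balance\<close>, and n^2 for \<open>N / \<alpha>\<close>.\<close>

lemma parameter_bounds:
  fixes n r k :: nat and \<alpha> \<beta> :: real
  defines "L \<equiv> ln (4 * real n / \<beta>)" and "e \<equiv> eps0 n r \<alpha> \<beta>" and "N \<equiv> real (n * r) / real k"
  assumes n: "1 \<le> n" and \<alpha>: "0 < \<alpha>" "\<alpha> < 1 / 2" and \<beta>: "0 < \<beta>" "\<beta> < 1" "2 * \<beta> \<le> real n"
    and r: "48 * ln (real n / \<beta>) \<le> real r"
    and k: "20000 / \<alpha>\<^sup>2 * (sqrt (real r) * (L * sqrt L)) \<le> real k" and kn: "k \<le> n"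
  obtains q :: nat where "0 < q" "real q * (exp e - 1) \<le> 1 / 4" "300 \<le> \<alpha> * real k" "0 < e"
    "\<And>S. 0 \<le> S \<Longrightarrow> S \<le> 8 * real n / (\<alpha> * real k) + 1 \<Longrightarrow>
      (S + 1) * exp (- (e * \<alpha> * real k / 100)) * N +
      2 * real n * S * (exp (- (\<alpha>\<^sup>2 * real k / 600)) * N +
        20 * real n * (exp (8 * (real q * (exp e - 1))\<^sup>2 * real r - \<alpha> / 2 * (real q - 1)) * N) / \<alpha>) \<le> \<beta>"
proof -
  have L1: "1 \<le> L" and L3: "L \<le> 3 * ln (real n / \<beta>)"
    using log_bounds n \<beta> by (auto simp: L_def)
  \<comment> \<open>The constant 48 is 3 times 16: from 16 L \<le> r one gets sqrt (L / r) \<le> 1 /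
    4, which keeps q (exp e - 1) in the range of the quadratic estimates.\<close>
  have rL: "16 * L \<le> real r"
    using r L3 by linarith
  define s where "s = sqrt (real r)"
  define u where "u = sqrt L"
  have r1: "1 \<le> real r" using rL L1 by linarith
  have s2: "s * s = real r" and u2: "u * u = L"
    using L1 by (auto simp: s_def u_def)
  have s1: "1 \<le> s" and u1: "1 \<le> u"
    using r1 L1 by (auto simp: s_def u_def)
  have us: "4 * u \<le> s"
  proof -
    have "(4 * u)\<^sup>2 \<le> s\<^sup>2"
      using rL s2 u2 by (simp add: power2_eq_square)
    then show ?thesis by (rule power2_le_imp_le) (use s1 in simp)
  qed
  have e_eq: "e = \<alpha> / (32 * (s * u))"
    by (simp add: e_def eps0_def L_def [symmetric] s_def u_def real_sqrt_mult)
  have e0: "0 < e" using \<alpha> s1 u1 by (simp add: e_eq)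
  have k': "20000 * (s * (L * u)) \<le> \<alpha>\<^sup>2 * real k"
    using k \<alpha> by (simp add: s_def [symmetric] u_def [symmetric] field_simps)
  have Lu: "L \<le> L * u" "1 \<le> L * u"
    using L1 u1 mult_left_mono [of 1 u L] mult_mono [of 1 L 1 u] by auto
  have "1 * L \<le> s * (L * u)"
    using s1 L1 Lu by (intro mult_mono) auto
  then have ak2: "20000 * L \<le> \<alpha>\<^sup>2 * real k"
    using k' by simp
  have ak: "\<alpha>\<^sup>2 * real k \<le> \<alpha> * real k"
    using \<alpha> mult_left_mono [of \<alpha> 1 \<alpha>] by (intro mult_right_mono) (auto simp: power2_eq_square)
  have k300: "300 \<le> \<alpha> * real k"
    using ak ak2 L1 by linarith
  have k0: "0 < real k" using k300 \<alpha> by (cases "k = 0") auto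
  have "\<alpha> * real k \<le> 1 / 2 * real n"
    using \<alpha> kn by (intro mult_mono) auto
  then have n600: "600 \<le> real n" using k300 by linarith
  \<comment> \<open>The 3200 is 100 times the 32 in \<open>e_eq\<close>, and 5 times 3200 stays
    below the 20000 in the choice of \<open>k\<close>. This requirement explains the order sqrt r
    L^(3/2) / \<alpha>^2 of \<open>k\<close>.\<close>
  have noise: "5 * L \<le> e * \<alpha> * real k / 100"
  proof -
    have "5 * L * (3200 * (s * u)) \<le> \<alpha>\<^sup>2 * real k"
    proof -
      have "0 \<le> s * (L * u)" using s1 L1 u1 by auto
      then have "5 * L * (3200 * (s * u)) \<le> 20000 * (s * (L * u))"
        by (simp add: mult_ac)
      with k' show ?thesis by linarith
    qed
    then have "5 * L \<le> \<alpha>\<^sup>2 * real k / (3200 * (s * u))"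
      using s1 u1 by (subst pos_le_divide_eq) auto
    then show ?thesis by (simp add: e_eq power2_eq_square)
  qed
  have tail: "5 * L \<le> \<alpha>\<^sup>2 * real k / 600"
    using ak2 L1 by linarith
  \<comment> \<open>Large enough that \<alpha> (q - 1) / 2 reaches 12 L, yet small enough that q
    (exp e - 1) is at most 17 / 20 sqrt (L / r).\<close>
  define q where "q = nat \<lceil>25 * L / \<alpha>\<rceil> + 1"
  have La: "2 \<le> L / \<alpha>"
    using L1 \<alpha> by (simp add: field_simps)
  have qa: "25 * (L / \<alpha>) \<le> real q - 1" "real q \<le> 26 * (L / \<alpha>)"
  proof -
    have "0 \<le> 25 * L / \<alpha>" using L1 \<alpha> by simp
    then have "25 * L / \<alpha> \<le> real q - 1" "real q \<le> 25 * L / \<alpha> + 2"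
      unfolding q_def by linarith+
    then show "25 * (L / \<alpha>) \<le> real q - 1" "real q \<le> 26 * (L / \<alpha>)"
      using La by simp_all
  qed
  have "1 * 1 \<le> s * u" using s1 u1 by (intro mult_mono) auto
  then have e64: "e \<le> 1 / 64"
    unfolding e_eq using \<alpha> s1 u1 by (subst pos_divide_le_eq) auto
  have eta: "0 \<le> exp e - 1" "exp e - 1 \<le> 65 / 64 * e"
  proof -
    have "exp e \<le> 1 + e + e\<^sup>2"
      using e0 e64 by (intro exp_le_quadratic) auto
    moreover have "e * e \<le> 1 / 64 * e"
      using e0 e64 by (intro mult_right_mono) auto
    ultimately show "exp e - 1 \<le> 65 / 64 * e" by (simp add: power2_eq_square)
  qed (use e0 in simp)
  \<comment> \<open>17 / 20 rounds up 26 times 65 / 64 divided by 32, and 8 (17 / 20)^2 < 6 yields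
    the 6 L in \<open>q1\<close>.\<close>
  have qe: "real q * (exp e - 1) \<le> 17 / 20 * (u / s)"
  proof -
    have "real q * (exp e - 1) \<le> 26 * (L / \<alpha>) * (65 / 64 * e)"
      using qa eta \<alpha> L1 by (intro mult_mono) auto
    also have "\<dots> = 26 * 65 / 64 / 32 * (u / s)"
      using \<alpha> s1 u1 by (simp add: e_eq u2 [symmetric] field_simps)
    also have "\<dots> \<le> 17 / 20 * (u / s)"
      using s1 u1 by (intro mult_right_mono) auto
    finally show ?thesis .
  qed
  have us4: "u / s \<le> 1 / 4" using us s1 by (simp add: field_simps)
  have qe4: "real q * (exp e - 1) \<le> 1 / 4"
    using qe us4 by linarith
  have "(real q * (exp e - 1))\<^sup>2 \<le> (17 / 20 * (u / s))\<^sup>2"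
    using qe eta by (intro power_mono) auto
  also have "\<dots> = (17 / 20)\<^sup>2 * (L / real r)"
    by (simp add: power_mult_distrib power_divide power2_eq_square s2 u2)
  finally have "8 * (real q * (exp e - 1))\<^sup>2 * real r \<le> 8 * ((17 / 20)\<^sup>2 * (L / real r)) * real r"
    by (intro mult_right_mono mult_left_mono) auto
  also have "\<dots> = 8 * (17 / 20)\<^sup>2 * L"
    using r1 by simp
  also have "\<dots> \<le> 6 * L"
    using L1 by (simp add: power2_eq_square)
  finally have q1: "8 * (real q * (exp e - 1))\<^sup>2 * real r \<le> 6 * L" .
  have q2: "12 * L \<le> \<alpha> / 2 * (real q - 1)"
  proof -
    have "\<alpha> / 2 * (25 * (L / \<alpha>)) \<le> \<alpha> / 2 * (real q - 1)"
      using \<alpha> by (intro mult_left_mono qa) auto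
    moreover have "\<alpha> / 2 * (25 * (L / \<alpha>)) = 25 / 2 * L"
      using \<alpha> by simp
    ultimately show ?thesis using L1 by linarith
  qed
  have DD: "exp (8 * (real q * (exp e - 1))\<^sup>2 * real r - \<alpha> / 2 * (real q - 1)) \<le> exp (- (5 * L))"
    unfolding exp_le_cancel_iff using q1 q2 L1 by linarith
  have expL: "exp (- (5 * L)) = (\<beta> / (4 * real n)) ^ 5"
  proof -
    have "exp (- L) = \<beta> / (4 * real n)"
      unfolding L_def using n \<beta> by (simp add: exp_minus)
    moreover have "exp (- (5 * L)) = exp (- L) ^ 5"
      using exp_of_nat_mult [of 5 "- L"] by simp
    ultimately show ?thesis by simp
  qed
  have N: "0 \<le> N" "N / \<alpha> \<le> (real n)\<^sup>2" "N \<le> (real n)\<^sup>2"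
  proof -
    show "0 \<le> N" by (simp add: N_def)
    \<comment> \<open>The size of \<open>k\<close> gives sqrt r \<le> \<alpha>^2 k, hence r \<le>
      \<alpha> k^2 and N / \<alpha> \<le> n k \<le> n^2.\<close>
    have "1 * s \<le> 20000 * (s * (L * u))"
      using s1 Lu mult_left_mono [of 1 "L * u" s] by simp
    then have s: "s \<le> \<alpha>\<^sup>2 * real k" using k' by linarith
    have "real r \<le> (\<alpha>\<^sup>2 * real k) * (\<alpha>\<^sup>2 * real k)"
      unfolding s2 [symmetric] using s s1 by (intro mult_mono) auto
    also have "\<dots> \<le> (\<alpha> * real k) * (1 * real k)"
      using \<alpha> ak k0 power_le_one [of \<alpha> 2] by (intro mult_mono mult_right_mono) auto
    finally have "real r \<le> \<alpha> * real k * real k" by simp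
    then have "real n * real r \<le> real n * (\<alpha> * real k * real k)"
      by (intro mult_left_mono) auto
    then have "N / \<alpha> \<le> real n * real k"
      using k0 \<alpha> by (simp add: N_def field_simps)
    also have "\<dots> \<le> (real n)\<^sup>2"
      unfolding power2_eq_square using kn by (intro mult_left_mono) auto
    finally show "N / \<alpha> \<le> (real n)\<^sup>2" .
    moreover have "N \<le> N / \<alpha>"
      using \<open>0 \<le> N\<close> \<alpha> by (simp add: pos_le_divide_eq mult_left_le)
    ultimately show "N \<le> (real n)\<^sup>2" by linarith
  qed
  show thesis
  proof (rule that [of q])
    fix S :: real
    assume S: "0 \<le> S" "S \<le> 8 * real n / (\<alpha> * real k) + 1"
    have "8 * real n / (\<alpha> * real k) \<le> 8 * real n / 300"
      using k300 \<alpha> by (intro divide_left_mono) auto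
    then have S1: "S + 1 \<le> real n"
      using S n600 by linarith
    let ?x = "exp (- (5 * L))" and ?n = "real n"
    let ?D = "exp (8 * (real q * (exp e - 1))\<^sup>2 * real r - \<alpha> / 2 * (real q - 1)) * N"
    have "(S + 1) * exp (- (e * \<alpha> * real k / 100)) * N \<le> ?n * ?x * ?n\<^sup>2"
      using S1 S noise N by (intro mult_mono) auto
    moreover have "2 * ?n * S * (exp (- (\<alpha>\<^sup>2 * real k / 600)) * N + 20 * ?n * ?D / \<alpha>) \<le>
        2 * ?n * ?n * (?x * ?n\<^sup>2 + 20 * ?n * (?x * ?n\<^sup>2))"
    proof (intro mult_mono add_mono)
      have "20 * ?n * ?D / \<alpha> = 20 * ?n * (exp (8 * (real q * (exp e - 1))\<^sup>2 * real r - \<alpha> / 2 * (real q - 1)) * (N / \<alpha>))"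
        by simp
      also have "\<dots> \<le> 20 * ?n * (?x * ?n\<^sup>2)"
        using DD N \<alpha> by (intro mult_left_mono mult_mono) auto
      finally show "20 * ?n * ?D / \<alpha> \<le> 20 * ?n * (?x * ?n\<^sup>2)" .
    qed (use S1 S tail N \<alpha> in \<open>auto intro!: add_nonneg_nonneg\<close>)
    moreover have "?n * ?x * ?n\<^sup>2 + 2 * ?n * ?n * (?x * ?n\<^sup>2 + 20 * ?n * (?x * ?n\<^sup>2)) =
        ?x * (?n ^ 3 + 2 * ?n ^ 4 + 40 * ?n ^ 5)"
      by (simp add: algebra_simps eval_nat_numeral)
    moreover have "?x * (?n ^ 3 + 2 * ?n ^ 4 + 40 * ?n ^ 5) \<le> ?x * (43 * ?n ^ 5)"
    proof -
      have "?n ^ 3 \<le> ?n ^ 5" "?n ^ 4 \<le> ?n ^ 5"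
        using n by (auto intro!: power_increasing)
      then show ?thesis by (intro mult_left_mono) auto
    qed
    \<comment> \<open>The 4 inside the logarithm supplies 4^5 = 1024 against the coefficients 1 + 2
      + 40 = 43.\<close>
    moreover have "?x * (43 * ?n ^ 5) = 43 / 1024 * \<beta> ^ 5"
      using n unfolding expL by (simp add: power_divide power_mult_distrib)
    moreover have "\<beta> ^ 5 \<le> \<beta>"
      using \<beta> power_decreasing [of 1 5 \<beta>] by simp
    ultimately show "(S + 1) * exp (- (e * \<alpha> * real k / 100)) * N +
      2 * ?n * S * (exp (- (\<alpha>\<^sup>2 * real k / 600)) * N + 20 * ?n * ?D / \<alpha>) \<le> \<beta>"
      using \<beta> by linarith
  qed (use qe4 k300 e0 in \<open>auto simp: q_def\<close>)
qed

lemma prob_space_robust_game: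
  assumes "0 < eps0 n r \<alpha> \<beta>" "prob_space W"
  shows "prob_space (robust_game n r \<alpha> \<beta> W)"
proof -
  interpret keys: prob_space "\<Pi>\<^sub>M i\<in>{1..n}. unif"
    by (intro prob_space_PiM prob_space_unif)
  interpret noise: prob_space "\<Pi>\<^sub>M jm\<in>(UNIV :: (nat \<times> nat) set). laplace (1 / eps0 n r \<alpha> \<beta>)"
    using assms by (intro prob_space_PiM prob_space_laplace) simp
  interpret W: prob_space W by fact
  interpret NW: pair_prob_space "\<Pi>\<^sub>M jm\<in>(UNIV :: (nat \<times> nat) set). laplace (1 / eps0 n r \<alpha> \<beta>)" W ..
  interpret G: pair_prob_space "\<Pi>\<^sub>M i\<in>{1..n}. unif"
    "(\<Pi>\<^sub>M jm\<in>(UNIV :: (nat \<times> nat) set). laplace (1 / eps0 n r \<alpha> \<beta>)) \<Otimes>\<^sub>M W" ..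
  show ?thesis
    unfolding robust_game_def by (rule G.prob_space_axioms)
qed

text \<open>With more than \<open>n\<close> places the sketch is never full and every answer is
  exact. This covers the parameters outside the locale \<open>estimator\<close>, which assumes
  \<open>k \<le> n\<close>.\<close>

lemma all_accurate_large_sketch:
  assumes "n < k" "0 < \<alpha>" "\<And>as. A (snd (snd \<omega>)) as \<subseteq> {1..n}"
  shows "all_accurate k n \<alpha> A t \<omega>"
  unfolding all_accurate_def
proof (intro allI impI)
  fix j
  let ?V = "query k n \<alpha> A \<omega> j"
  have "?V \<subseteq> {1..n}"
    using assms(3) by (simp add: query_def split_beta)
  then have V: "finite ?V" "card ?V < k"
    using assms(1) finite_subset card_mono [of "{1..n}" ?V] by auto
  then have "answer k n \<alpha> A \<omega> j = real (card ?V)"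
    by (simp add: answer_def sketch_def robust_est_def card_bk_sketch split_beta)
  then show "answer k n \<alpha> A \<omega> j \<in>
      {(1 - \<alpha>) * real (card ?V) .. (1 + \<alpha>) * real (card ?V)}"
    using assms(2) by (simp add: algebra_simps)
qed

lemma sketch_size_bound:
  fixes l L R \<alpha> :: real
  assumes "0 < \<alpha>" "1 \<le> L" "L \<le> 3 * l" "0 \<le> R"
  shows "20000 / \<alpha>\<^sup>2 * (sqrt R * (L * sqrt L)) \<le> 120000 * \<alpha> powr - 2 * sqrt R * l powr (3 / 2)"
proof -
  have l: "0 < l" using assms by linarith
  \<comment> \<open>Weakening 3 to 4 under the root gives the plain factor 2, so 20000 becomes 20000
    times 3 times 2.\<close>
  have "sqrt L \<le> sqrt (4 * l)"
    using assms by (intro real_sqrt_le_mono) linarith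
  also have "\<dots> = 2 * sqrt l"
    by (simp add: real_sqrt_mult)
  finally have "L * sqrt L \<le> (3 * l) * (2 * sqrt l)"
    using assms l by (intro mult_mono) auto
  also have "\<dots> = 6 * (l powr 1 * l powr (1 / 2))"
    using l by (simp add: powr_half_sqrt)
  also have "\<dots> = 6 * l powr (3 / 2)"
    by (subst powr_add [symmetric]) simp
  finally have "20000 / \<alpha>\<^sup>2 * (sqrt R * (L * sqrt L)) \<le> 20000 / \<alpha>\<^sup>2 * (sqrt R * (6 * l powr (3 / 2)))"
    using assms by (intro mult_left_mono) auto
  also have "\<dots> = 120000 * \<alpha> powr - 2 * sqrt R * l powr (3 / 2)"
  proof -
    have "\<alpha> powr - 2 = 1 / \<alpha>\<^sup>2"
      using assms by (simp add: powr_minus_divide)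
    then show ?thesis by simp
  qed
  finally show ?thesis .
qed

theorem theorem4p1:
  shows "\<exists>C0 C :: real. C0 > 0 \<and> C > 0 \<and>
    (\<forall>(n::nat) (\<alpha>::real) (\<beta>::real) (r::nat).
       n \<ge> 1 \<and> 0 < \<alpha> \<and> \<alpha> < 1 / 2 \<and> 0 < \<beta> \<and> \<beta> < 1 \<and> 2 * \<beta> \<le> real n \<and>
       real r \<ge> C0 * ln (real n / \<beta>) \<longrightarrow>
       (\<exists>k::nat. k \<ge> 1 \<and>
          real k \<le> C * \<alpha> powr - 2 * sqrt (real r) * ln (real n / \<beta>) powr (3 / 2) \<and>
          (\<forall>(W :: real measure) (A :: real \<Rightarrow> real list \<Rightarrow> nat set) (t::nat).
             adaptive_adversary n W A \<and>
             (AE \<omega> in robust_game n r \<alpha> \<beta> W.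
                \<forall>i\<in>{1..n}. (\<Sum>j<t. of_bool (i \<in> fst ` sketch k n \<alpha> A \<omega> j)) \<le> r) \<longrightarrow>
             measure (robust_game n r \<alpha> \<beta> W)
               {\<omega> \<in> space (robust_game n r \<alpha> \<beta> W).
                  \<forall>j<t. answer k n \<alpha> A \<omega> j \<in>
                    {(1 - \<alpha>) * real (card (query k n \<alpha> A \<omega> j)) ..
                     (1 + \<alpha>) * real (card (query k n \<alpha> A \<omega> j))}}
             \<ge> 1 - \<beta>)))"
proof (rule exI [of _ 48], rule exI [of _ 240000], intro conjI allI impI)
  show "(48::real) > 0" "(240000::real) > 0" by simp_all
  fix n :: nat and \<alpha> \<beta> :: real and r :: nat
  assume "n \<ge> 1 \<and> 0 < \<alpha> \<and> \<alpha> < 1 / 2 \<and> 0 < \<beta> \<and> \<beta> < 1 \<and> 2 * \<beta> \<le> real n \<and>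
       real r \<ge> 48 * ln (real n / \<beta>)"
  then have n: "1 \<le> n" and \<alpha>: "0 < \<alpha>" "\<alpha> < 1 / 2" and \<beta>: "0 < \<beta>" "\<beta> < 1" "2 * \<beta> \<le> real n"
    and r: "48 * ln (real n / \<beta>) \<le> real r" by auto
  define L where "L = ln (4 * real n / \<beta>)"
  define X where "X = 20000 / \<alpha>\<^sup>2 * (sqrt (real r) * (L * sqrt L))"
  define k where "k = nat \<lceil>X\<rceil>"
  note L = log_bounds [OF n \<beta>, folded L_def]
  have r1: "1 \<le> real r" using r L by linarith
  have e: "0 < eps0 n r \<alpha> \<beta>"
    using \<alpha> r1 L(1) by (simp add: eps0_def L_def)
  \<comment> \<open>Since X is at least 1, rounding it up at most doubles it; this turns 120000 into
    240000.\<close>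
  have "1 * (1 * (1 * 1)) \<le> X"
    unfolding X_def using \<alpha> r1 L(1) power_le_one [of \<alpha> 2]
    by (intro mult_mono) (auto simp: field_simps)
  then have k: "1 \<le> k" "X \<le> real k" "real k \<le> 2 * X"
    unfolding k_def by linarith+
  have k_upper: "real k \<le> 240000 * \<alpha> powr - 2 * sqrt (real r) * ln (real n / \<beta>) powr (3 / 2)"
    using k(3) sketch_size_bound [OF \<alpha>(1) L, of "real r"] unfolding X_def by simp
  have success: "1 - \<beta> \<le> measure (robust_game n r \<alpha> \<beta> W) {\<omega> \<in> space (robust_game n r \<alpha> \<beta> W). all_accurate k n \<alpha> A t \<omega>}"
    if adv: "adaptive_adversary n W A"
      and budget: "AE \<omega> in robust_game n r \<alpha> \<beta> W. within_budget k n \<alpha> A r t \<omega>" for W A t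
  proof -
    have W: "prob_space W" and A: "\<And>as. (\<lambda>w. A w as) \<in> W \<rightarrow>\<^sub>M count_space (Pow {1..n})"
      using adv by (auto simp: adaptive_adversary_def)
    show ?thesis
    proof (cases "k \<le> n")
      case True
      interpret estimator k n \<alpha> "eps0 n r \<alpha> \<beta>"
        using k(1) True \<alpha> e by unfold_locales
      obtain q :: nat where q: "0 < q" "real q * (exp (eps0 n r \<alpha> \<beta>) - 1) \<le> 1 / 4" "300 \<le> \<alpha> * real k"
        and bound: "\<And>S. 0 \<le> S \<Longrightarrow> S \<le> 8 * real n / (\<alpha> * real k) + 1 \<Longrightarrow>
          (S + 1) * exp (- (eps0 n r \<alpha> \<beta> * \<alpha> * real k / 100)) * (real (n * r) / real k) +
          2 * real n * S * (exp (- (\<alpha>\<^sup>2 * real k / 600)) * (real (n * r) / real k) +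
          20 * real n * (exp (8 * (real q * (exp (eps0 n r \<alpha> \<beta>) - 1))\<^sup>2 * real r - \<alpha> / 2 * (real q - 1)) *
            (real (n * r) / real k)) / \<alpha>) \<le> \<beta>"
      proof (rule parameter_bounds [OF n \<alpha> \<beta> r k(2) [unfolded X_def L_def] True], goal_cases)
        case (1 q)
        show ?case using 1(2-4) by (rule 1(1)) (rule 1(6))
      qed
      show ?thesis
        unfolding robust_game_def
        by (rule game_failure_bound [OF W A budget [unfolded robust_game_def] q bound])
           (simp, rule steps_bound)
    next
      case False
      interpret G: prob_space "robust_game n r \<alpha> \<beta> W"
        by (rule prob_space_robust_game [OF e W])
      have "all_accurate k n \<alpha> A t \<omega>" if "\<omega> \<in> space (robust_game n r \<alpha> \<beta> W)" for \<omega>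
      proof (rule all_accurate_large_sketch)
        have "snd (snd \<omega>) \<in> space W"
          using that by (auto simp: robust_game_def space_pair_measure)
        then show "A (snd (snd \<omega>)) as \<subseteq> {1..n}" for as
          using measurable_space [OF A, of "snd (snd \<omega>)" as] by simp
      qed (use False \<alpha> in auto)
      then have "{\<omega> \<in> space (robust_game n r \<alpha> \<beta> W). all_accurate k n \<alpha> A t \<omega>} = space (robust_game n r \<alpha> \<beta> W)"
        by blast
      then show ?thesis using \<beta> by (simp add: G.prob_space)
    qed
  qed
  show "\<exists>k::nat. k \<ge> 1 \<and>
          real k \<le> 240000 * \<alpha> powr - 2 * sqrt (real r) * ln (real n / \<beta>) powr (3 / 2) \<and>
          (\<forall>(W :: real measure) (A :: real \<Rightarrow> real list \<Rightarrow> nat set) (t::nat).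
             adaptive_adversary n W A \<and>
             (AE \<omega> in robust_game n r \<alpha> \<beta> W.
                \<forall>i\<in>{1..n}. (\<Sum>j<t. of_bool (i \<in> fst ` sketch k n \<alpha> A \<omega> j)) \<le> r) \<longrightarrow>
             measure (robust_game n r \<alpha> \<beta> W)
               {\<omega> \<in> space (robust_game n r \<alpha> \<beta> W).
                  \<forall>j<t. answer k n \<alpha> A \<omega> j \<in>
                    {(1 - \<alpha>) * real (card (query k n \<alpha> A \<omega> j)) ..
                     (1 + \<alpha>) * real (card (query k n \<alpha> A \<omega> j))}}
             \<ge> 1 - \<beta>)"
    using k(1) k_upper success unfolding within_budget_def all_accurate_def by blast
qed

end
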